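(* Let $P$ be a probability distribution on $\mathbb N$ with $P(1)<1$, let $n_o\sim P$, and assume $\mathbb E[e^{\theta n_o}]<\infty$ for some $\theta>0$. Suppose $\beta_0>1$. Let $\mathcal A\subset\Omega=\mathbb Z_+\times\mathbb R_+$ be Borel and set $W_l(\mathcal A)=Z_l(\mathcal A)/\beta_0^{\,l}$. Then, conditioned on $n_o=m$ and $v_o=x$, where $x\in\mathbb R_+$ and $m\in\mathbb N$, there is a random variable $W(\mathcal A)$ such that $W_l(\mathcal A)$ converges to $W(\mathcal A)$ in $L^2$ and almost surely. Its first and second moments are $$\mathbb E[W(\mathcal A)\mid n_o=m,v_o=x]=\frac mx f_0(x)\,\bar\nu(\mathcal A),\qquad \mathbb E[W(\mathcal A)^2\mid n_o=m,v_o=x]=U(m,x)\,\bar\nu(\mathcal A)^2 .$$ Furthermore, if $\mathcal A,\mathcal B\subset\Omega$ are Borel sets with $\bar\nu(\mathcal A)>0$, then $$W(\mathcal B)=\frac{\bar\nu(\mathcal B)}{\bar\nu(\mathcal A)}\,W(\mathcal A)\qquad\text{a.s.}$$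
   Context: $\mathbb N=\{1,2,\dots\}$, $\mathbb Z_+=\{0,1,\dots\}$, $\mathbb R_+=[0,\infty)$. $\mathrm{Erlang}(k)$ has density $e^{-x}x^{k-1}/(k-1)!$. **Erlang Weighted Tree (EWT).** Let $\mathbb N^f=\bigcup_{i\ge0}\mathbb N^i$, $\mathbb N^0=\{o\}$, $\widehat P(k)=P(k+1)$. Independently over $\boldsymbol i\in\mathbb N^f$: $n_o\sim P$, $n_{\boldsymbol i}\sim\widehat P$ for $\boldsymbol i\ne o$; given $n_{\boldsymbol i}$, $v_{\boldsymbol i}\sim\mathrm{Erlang}(n_{\boldsymbol i}+1)$; given $(n_{\boldsymbol i},v_{\boldsymbol i})$, the costs $\zeta_{(\boldsymbol i,1)},\dots,\zeta_{(\boldsymbol i,n_{\boldsymbol i})}$ are i.i.d. uniform on $[0,v_{\boldsymbol i}]$. The backbone tree is the component of $o$ in the graph with edges $\{\boldsymbol i,(\boldsymbol i,j)\}$, $1\le j\le n_{\boldsymbol i}$. The EWT is the component of the root $o$ after keeping $\{\boldsymbol i,(\boldsymbol i,j)\}$ iff $\zeta_{(\boldsymbol i,j)}<v_{(\boldsymbol i,j)}$. The type of $\boldsymbol i$ is $(n_{\boldsymbol i},v_{\boldsymbol i})\in\Omega$. $Z_l(\mathcal A)$ is the number of vertices at distance $l$ from $o$ with type in $\mathcal A$. **Spectral quantities.** $g_2(x)=e^{-x}\sum_{k=2}^\infty P(k)\frac{x^{k-2}}{(k-2)!}$; $G_0\equiv1$, $G_i(x)=\int_{y=x}^\infty\int_{z=y}^\infty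 g_2(z)G_{i-1}(z)\,dz\,dy$; $L(\beta,x)=\sum_{i\ge0}G_i(x)(-1/\beta)^i$. $\beta_0$ is the largest $\beta>0$ with $L(\beta,0)=0$; $f_0(x)=L(\beta_0,x)\big/\big(\int_0^\infty g_2(y)L(\beta_0,y)^2dy\big)^{1/2}$. $\mu(m,x)=\frac mxf_0(x)$ (limit as $x\downarrow0$ at $x=0$), $\nu(k-1,z)=P(k)\frac{e^{-z}z^{k-1}}{(k-1)!}f_0(z)$, and $\bar\nu(\mathcal A)=\sum_{k\ge1}\int_{\{z:(k-1,z)\in\mathcal A\}}\nu(k-1,z)\,dz$. **The function $U$.** $M_l(m,x;\mathcal A)=\mathbb E[Z_l(\mathcal A)\mid n_o=m,v_o=x]$ (a measure in $\mathcal A$; $M_0(m,x;\cdot)$ is the unit mass at $(m,x)$), and $v(m,x;\mathcal A_1;\mathcal A_2)$ is the covariance of $Z_1(\mathcal A_1)$ and $Z_1(\mathcal A_2)$ given $n_o=m,v_o=x$, viewed as a signed measure on $\Omega\times\Omega$ determined by its values on rectangles $\mathcal A_1\times\mathcal A_2$. Then $$U(m,x)=\mu(m,x)^2+\sum_{\hat l=1}^\infty\beta_0^{-2\hat l}\int_{\Omega}\left(\int_{\Omega\times\Omega}\mu(k_1-1,z_1)\mu(k_2-1,z_2)\,dv(k-1,z;k_1-1,z_1;k_2-1,z_2)\right)dM_{\hat l-1}(m,x;k-1,z).$$ *)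

theory Defs
  imports "HOL-Probability.Probability"
begin

section \<open>The Erlang weighted tree\<close>

type_synonym ewt_type = "nat \<times> real"

text \<open>The data at a vertex \<open>i\<close>: its type \<open>(n\<^sub>i, v\<^sub>i)\<close> and the costs
  \<open>j \<mapsto> \<zeta>\<^bsub>(i,j)\<^esub>\<close> of its potential children. Only the costs with \<open>1 \<le> j \<le> n\<^sub>i\<close> are ever
  used; the family is indexed by all \<open>j \<ge> 1\<close> so that the sample space does not depend on \<open>n\<^sub>i\<close>.\<close>

type_synonym node_data = "ewt_type \<times> (nat \<Rightarrow> real)"

type_synonym ewt_sample = "nat list \<Rightarrow> node_data"

definition Nf :: "nat list set" where
  "Nf = lists {1..}"

text \<open>\<open>(n - 1)\<close> for \<open>n \<sim> P\<close>; see \<open>pmf_Phat\<close> below.\<close>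

definition Phat :: "nat pmf \<Rightarrow> nat pmf" where
  "Phat P = map_pmf (\<lambda>n. n - 1) P"

text \<open>Law of \<open>(n, v)\<close> where \<open>n \<sim> D\<close> and \<open>v \<sim> Erlang(n + 1)\<close> given \<open>n\<close>. In the library,
  \<open>erlang_density n 1\<close> is the density \<open>x^n e^(-x) / n!\<close> of \<open>Erlang(n + 1)\<close>.\<close>

definition type_law :: "nat pmf \<Rightarrow> ewt_type measure" where
  "type_law D = measure_pmf D \<bind>
     (\<lambda>n. distr (density lborel (erlang_density n 1)) borel (\<lambda>v. (n, v)))"

text \<open>The uniform distribution on \<open>[0, v]\<close>; for \<open>v = 0\<close> this is the unit mass at \<open>0\<close>
  (negative \<open>v\<close> do not occur).\<close>

definition unif :: "real \<Rightarrow> real measure" where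
  "unif v = (if 0 < v then uniform_measure lborel {0..v} else return borel 0)"

definition node_space :: "node_data measure" where
  "node_space = borel \<Otimes>\<^sub>M PiM {1..} (\<lambda>_. borel)"

definition node_given :: "ewt_type \<Rightarrow> node_data measure" where
  "node_given t = distr (PiM {1..} (\<lambda>_. unif (snd t))) node_space (\<lambda>\<zeta>. (t, \<zeta>))"

definition node_law :: "nat pmf \<Rightarrow> node_data measure" where
  "node_law D = type_law D \<bind> node_given"

definition ewt :: "nat pmf \<Rightarrow> ewt_sample measure" where
  "ewt P = PiM Nf (\<lambda>i. if i = [] then node_law P else node_law (Phat P))"

text \<open>The law of the same family conditioned on \<open>(n\<^sub>o, v\<^sub>o) = t\<close>. By \<open>ewt_disintegration\<close>
  below, \<open>t \<mapsto> ewt_given P t\<close> is the conditional distribution given the type of the root; it is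
  defined for every \<open>t\<close>, not just up to null sets.\<close>

definition ewt_given :: "nat pmf \<Rightarrow> ewt_type \<Rightarrow> ewt_sample measure" where
  "ewt_given P t = PiM Nf (\<lambda>i. if i = [] then node_given t else node_law (Phat P))"

definition vtype :: "ewt_sample \<Rightarrow> nat list \<Rightarrow> ewt_type" where
  "vtype \<omega> i = fst (\<omega> i)"

definition cost :: "ewt_sample \<Rightarrow> nat list \<Rightarrow> nat \<Rightarrow> real" where
  "cost \<omega> i j = snd (\<omega> i) j"

text \<open>The edges \<open>{i, (i, j)}\<close>, \<open>1 \<le> j \<le> n\<^sub>i\<close>, of the backbone graph that are kept, as a symmetric
  relation. A path of kept edges from the root stays in the backbone tree, so the
  component of the root can be taken directly in this graph.\<close>

definition kept_edges :: "ewt_sample \<Rightarrow> (nat list \<times> nat list) set" where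
  "kept_edges \<omega> =
     {(i, i @ [j]) | i j. i \<in> Nf \<and> 1 \<le> j \<and> j \<le> fst (vtype \<omega> i)
        \<and> cost \<omega> i j < snd (vtype \<omega> (i @ [j]))}"

definition adj :: "ewt_sample \<Rightarrow> (nat list \<times> nat list) set" where
  "adj \<omega> = kept_edges \<omega> \<union> (kept_edges \<omega>)\<inverse>"

definition ewt_vertices :: "ewt_sample \<Rightarrow> nat list set" where
  "ewt_vertices \<omega> = {i. ([], i) \<in> (adj \<omega>)\<^sup>*}"

definition root_dist :: "ewt_sample \<Rightarrow> nat list \<Rightarrow> nat" where
  "root_dist \<omega> i = (LEAST l. ([], i) \<in> adj \<omega> ^^ l)"

definition Z :: "nat \<Rightarrow> ewt_type set \<Rightarrow> ewt_sample \<Rightarrow> nat" where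
  "Z l A \<omega> = card {i \<in> ewt_vertices \<omega>. root_dist \<omega> i = l \<and> vtype \<omega> i \<in> A}"

text \<open>\<open>\<Omega> = \<int>\<^sub>+ \<times> \<real>\<^sub>+\<close> with its Borel sets.\<close>

definition type_space :: "ewt_type measure" where
  "type_space = restrict_space borel (UNIV \<times> {0..})"


section \<open>Spectral quantities\<close>

definition g2 :: "nat pmf \<Rightarrow> real \<Rightarrow> real" where
  "g2 P x = exp (- x) * (\<Sum>k. pmf P (k + 2) * x ^ k / fact k)"

primrec G :: "nat pmf \<Rightarrow> nat \<Rightarrow> real \<Rightarrow> real" where
  "G P 0 = (\<lambda>x. 1)"
| "G P (Suc i) = (\<lambda>x. LINT y:{x..}|lborel. (LINT z:{y..}|lborel. g2 P z * G P i z))"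

definition L :: "nat pmf \<Rightarrow> real \<Rightarrow> real \<Rightarrow> real" where
  "L P \<beta> x = (\<Sum>i. G P i x * (- 1 / \<beta>) ^ i)"

definition beta0 :: "nat pmf \<Rightarrow> real" where
  "beta0 P = (GREATEST \<beta>. \<beta> > 0 \<and> L P \<beta> 0 = 0)"

definition f0 :: "nat pmf \<Rightarrow> real \<Rightarrow> real" where
  "f0 P x = L P (beta0 P) x / sqrt (LINT y:{0..}|lborel. g2 P y * (L P (beta0 P) y)\<^sup>2)"

definition mu :: "nat pmf \<Rightarrow> nat \<Rightarrow> real \<Rightarrow> real" where
  "mu P m x = (if x = 0 then Lim (at_right 0) (\<lambda>y. real m / y * f0 P y)
               else real m / x * f0 P x)"

text \<open>\<open>nu P j z\<close> is \<open>\<nu>(k - 1, z)\<close> with \<open>j = k - 1\<close>.\<close>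

definition nu :: "nat pmf \<Rightarrow> nat \<Rightarrow> real \<Rightarrow> real" where
  "nu P j z = pmf P (j + 1) * (exp (- z) * z ^ j / fact j) * f0 P z"

definition nubar :: "nat pmf \<Rightarrow> ewt_type set \<Rightarrow> real" where
  "nubar P A = (\<Sum>j. LINT z:{z. (j, z) \<in> A}|lborel. nu P j z)"


section \<open>The function U\<close>

definition mean_measure :: "nat pmf \<Rightarrow> nat \<Rightarrow> ewt_type \<Rightarrow> ewt_type measure" where
  "mean_measure P l t =
     measure_of (space type_space) (sets type_space)
       (\<lambda>A. \<integral>\<^sup>+\<omega>. of_nat (Z l A \<omega>) \<partial>ewt_given P t)"

definition covar :: "'a measure \<Rightarrow> ('a \<Rightarrow> real) \<Rightarrow> ('a \<Rightarrow> real) \<Rightarrow> real" where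
  "covar M X Y =
     (LINT \<omega>|M. (X \<omega> - (LINT \<omega>'|M. X \<omega>')) * (Y \<omega> - (LINT \<omega>'|M. Y \<omega>')))"

definition cov_rect :: "nat pmf \<Rightarrow> ewt_type \<Rightarrow> ewt_type set \<Rightarrow> ewt_type set \<Rightarrow> real" where
  "cov_rect P t A\<^sub>1 A\<^sub>2 = covar (ewt_given P t) (\<lambda>\<omega>. real (Z 1 A\<^sub>1 \<omega>)) (\<lambda>\<omega>. real (Z 1 A\<^sub>2 \<omega>))"

text \<open>The integral of \<open>f\<close> against the finite signed measure on \<open>M \<Otimes>\<^sub>M M\<close> whose value on each
  rectangle \<open>A\<^sub>1 \<times> A\<^sub>2\<close> is \<open>v A\<^sub>1 A\<^sub>2\<close>. A finite signed measure is a difference of two finite measures,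
  and any two such representations for which \<open>f\<close> is integrable give the same value, since the
  rectangles form a generator of the product \<open>\<sigma>\<close>-algebra that is stable under intersection.\<close>

definition signed_rect_integral ::
    "'a measure \<Rightarrow> ('a set \<Rightarrow> 'a set \<Rightarrow> real) \<Rightarrow> ('a \<times> 'a \<Rightarrow> real) \<Rightarrow> real" where
  "signed_rect_integral M v f = (THE r. \<exists>N\<^sub>1 N\<^sub>2.
     finite_measure N\<^sub>1 \<and> finite_measure N\<^sub>2 \<and>
     sets N\<^sub>1 = sets (M \<Otimes>\<^sub>M M) \<and> sets N\<^sub>2 = sets (M \<Otimes>\<^sub>M M) \<and>
     (\<forall>A\<^sub>1\<in>sets M. \<forall>A\<^sub>2\<in>sets M.
        v A\<^sub>1 A\<^sub>2 = measure N\<^sub>1 (A\<^sub>1 \<times> A\<^sub>2) - measure N\<^sub>2 (A\<^sub>1 \<times> A\<^sub>2)) \<and>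
     integrable N\<^sub>1 f \<and> integrable N\<^sub>2 f \<and>
     r = (LINT p|N\<^sub>1. f p) - (LINT p|N\<^sub>2. f p))"

definition U :: "nat pmf \<Rightarrow> nat \<Rightarrow> real \<Rightarrow> real" where
  "U P m x = (mu P m x)\<^sup>2 +
     (\<Sum>l. 1 / beta0 P ^ (2 * Suc l) *
        (LINT t|mean_measure P l (m, x).
           signed_rect_integral type_space (cov_rect P t)
             (\<lambda>(s\<^sub>1, s\<^sub>2). mu P (fst s\<^sub>1) (snd s\<^sub>1) * mu P (fst s\<^sub>2) (snd s\<^sub>2))))"


section \<open>Convergence in \<open>L\<^sup>2\<close>\<close>

definition tendsto_L2 :: "'a measure \<Rightarrow> (nat \<Rightarrow> 'a \<Rightarrow> real) \<Rightarrow> ('a \<Rightarrow> real) \<Rightarrow> bool" where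
  "tendsto_L2 M X Y \<longleftrightarrow>
     (\<forall>l. X l \<in> borel_measurable M \<and> integrable M (\<lambda>\<omega>. (X l \<omega>)\<^sup>2)) \<and>
     Y \<in> borel_measurable M \<and> integrable M (\<lambda>\<omega>. (Y \<omega>)\<^sup>2) \<and>
     (\<lambda>l. LINT \<omega>|M. (X l \<omega> - Y \<omega>)\<^sup>2) \<longlonglongrightarrow> 0"


section \<open>Basic facts about the laws\<close>

lemma pmf_Phat:
  assumes "pmf P 0 = 0"
  shows "pmf (Phat P) k = pmf P (k + 1)"
proof -
  have *: "(\<lambda>n::nat. n - 1) -` {k} = (if k = 0 then {0, 1} else {k + 1})"
    by auto
  have "measure (measure_pmf P) {0, Suc 0} = pmf P 1"
    using assms by (subst measure_measure_pmf_finite) auto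
  then show ?thesis
    unfolding Phat_def pmf_map * by (auto simp: measure_pmf_single)
qed

lemma sets_unif [simp]: "sets (unif v) = sets borel"
  by (simp add: unif_def)

lemma space_unif [simp]: "space (unif v) = UNIV"
  by (simp add: unif_def)

lemma prob_space_unif: "prob_space (unif v)"
  by (auto simp: unif_def intro!: prob_space_uniform_measure prob_space_return)

lemma unif_measurable_emeasure:
  assumes "A \<in> sets borel"
  shows "(\<lambda>v. emeasure (unif v) A) \<in> borel_measurable borel"
proof -
  have [measurable]: "A \<in> sets borel" by fact
  have "emeasure (unif v) A =
      (if 0 < v then (\<integral>\<^sup>+y. indicator A y * (if 0 \<le> y \<and> y \<le> v then 1 else 0) \<partial>lborel) / ennreal v
       else indicator A 0)" for v
  proof (cases "0 < v")
    case True
    have "emeasure lborel ({0..v} \<inter> A) =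
        (\<integral>\<^sup>+y. indicator A y * (if 0 \<le> y \<and> y \<le> v then 1 else 0) \<partial>lborel)"
      by (subst nn_integral_indicator[symmetric])
        (auto intro!: nn_integral_cong simp del: nn_integral_indicator simp: indicator_def)
    with True show ?thesis
      by (simp add: unif_def)
  qed (simp add: unif_def)
  then show ?thesis
    by simp
qed

lemma space_node_space: "space node_space = UNIV \<times> ({1..} \<rightarrow>\<^sub>E UNIV)"
  by (simp add: node_space_def space_pair_measure space_PiM)

lemma sets_node_given [simp]: "sets (node_given t) = sets node_space"
  by (simp add: node_given_def)

lemma measurable_pair_node_space:
  "(\<lambda>\<zeta>. (t, \<zeta>)) \<in> PiM {1..} (\<lambda>_. unif v) \<rightarrow>\<^sub>M node_space"
proof -
  have "sets (PiM {1..} (\<lambda>_::nat. unif v)) = sets (PiM {1..} (\<lambda>_. borel))"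
    by (intro sets_PiM_cong) auto
  then show ?thesis
    unfolding node_space_def by (subst measurable_cong_sets[OF _ refl]) auto
qed

lemma prob_space_node_given: "prob_space (node_given t)"
  unfolding node_given_def
  by (intro prob_space.prob_space_distr prob_space_PiM prob_space_unif measurable_pair_node_space)

lemma costs_measurable:
  "(\<lambda>v. PiM {1..} (\<lambda>_::nat. unif v)) \<in> borel \<rightarrow>\<^sub>M prob_algebra (PiM {1..} (\<lambda>_. borel))"
proof (rule measurable_prob_algebra_generated[OF sets_PiM Int_stable_prod_algebra prod_algebra_sets_into_space])
  fix v :: real
  show "prob_space (PiM {1..} (\<lambda>_::nat. unif v))"
    by (intro prob_space_PiM prob_space_unif)
  show "sets (PiM {1..} (\<lambda>_::nat. unif v)) = sets (PiM {1..} (\<lambda>_. borel))"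
    by (intro sets_PiM_cong) auto
next
  fix X assume "X \<in> prod_algebra {1::nat..} (\<lambda>_. borel :: real measure)"
  then obtain J A where X: "X = prod_emb {1..} (\<lambda>_. borel) J (Pi\<^sub>E J A)" "finite J" "J \<subseteq> {1..}"
    "\<And>j. j \<in> J \<Longrightarrow> A j \<in> sets (borel :: real measure)"
    by (rule prod_algebraE) blast
  have "emeasure (PiM {1..} (\<lambda>_. unif v)) X = (\<Prod>j\<in>J. emeasure (unif v) (A j))" for v
  proof -
    have "X = prod_emb {1..} (\<lambda>_. unif v) J (Pi\<^sub>E J A)"
      by (simp add: X(1) prod_emb_def)
    then show ?thesis
      using X by (simp add: emeasure_PiM_emb prob_space_unif)
  qed
  then show "(\<lambda>v. emeasure (PiM {1..} (\<lambda>_. unif v)) X) \<in> borel_measurable borel"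
    using X by (auto intro!: borel_measurable_prod_ennreal unif_measurable_emeasure)
qed

lemma node_given_measurable: "node_given \<in> borel \<rightarrow>\<^sub>M prob_algebra node_space"
proof -
  have "(\<lambda>t. distr (PiM {1..} (\<lambda>_::nat. unif (snd t))) node_space (Pair t))
      \<in> borel \<rightarrow>\<^sub>M prob_algebra node_space"
  proof (rule measurable_distr_prob_space2)
    show "(\<lambda>t :: ewt_type. PiM {1..} (\<lambda>_::nat. unif (snd t)))
        \<in> borel \<rightarrow>\<^sub>M prob_algebra (PiM {1..} (\<lambda>_. borel))"
      by (rule measurable_compose[OF _ costs_measurable]) (simp add: borel_prod[symmetric])
    show "(\<lambda>(t :: ewt_type, \<zeta>). (t, \<zeta>)) \<in> borel \<Otimes>\<^sub>M PiM {1..} (\<lambda>_::nat. borel) \<rightarrow>\<^sub>M node_space"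
      by (simp add: node_space_def)
  qed
  then show ?thesis
    by (simp add: node_given_def[abs_def])
qed

lemma type_law_in_prob_algebra: "type_law D \<in> space (prob_algebra borel)"
proof -
  have D: "measure_pmf D \<in> space (prob_algebra (count_space UNIV))"
    by (simp add: space_prob_algebra prob_space_measure_pmf)
  have 1: "distr (density lborel (erlang_density n 1)) borel (\<lambda>v. (n, v))
      \<in> space (prob_algebra borel)" for n :: nat
  proof -
    interpret prob_space "density lborel (erlang_density n 1)"
      by (rule prob_space_erlang_density) simp
    have "(\<lambda>v::real. (n, v)) \<in> borel \<rightarrow>\<^sub>M borel"
      unfolding borel_prod[symmetric] by simp
    then show ?thesis
      by (auto simp: space_prob_algebra intro!: prob_space_distr)
  qed
  have "(\<lambda>n. distr (density lborel (erlang_density n 1)) borel (\<lambda>v. (n, v)))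
      \<in> count_space UNIV \<rightarrow>\<^sub>M prob_algebra borel"
    using 1 by auto
  from measurable_bind_prob_space[OF measurable_const[OF D] this]
  have "(\<lambda>_::unit. type_law D) \<in> count_space UNIV \<rightarrow>\<^sub>M prob_algebra borel"
    unfolding type_law_def .
  from measurable_space[OF this, of "()"] show ?thesis
    by simp
qed

lemma node_law_in_prob_algebra: "node_law D \<in> space (prob_algebra node_space)"
proof -
  from measurable_bind_prob_space[OF measurable_const[OF type_law_in_prob_algebra] node_given_measurable]
  have "(\<lambda>_::unit. node_law D) \<in> count_space UNIV \<rightarrow>\<^sub>M prob_algebra node_space"
    unfolding node_law_def .
  from measurable_space[OF this, of "()"] show ?thesis
    by simp
qed

lemma prob_space_node_law: "prob_space (node_law D)"
  and sets_node_law [simp]: "sets (node_law D) = sets node_space"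
  using node_law_in_prob_algebra[of D] by (auto simp: space_prob_algebra)

lemma sets_ewt_given: "sets (ewt_given P t) = sets (PiM Nf (\<lambda>_. node_space))"
  unfolding ewt_given_def by (intro sets_PiM_cong) auto

lemma sets_ewt: "sets (ewt P) = sets (PiM Nf (\<lambda>_. node_space))"
  unfolding ewt_def by (intro sets_PiM_cong) auto

lemma prob_space_ewt_given: "prob_space (ewt_given P t)"
  unfolding ewt_given_def
  by (intro prob_space_PiM) (auto intro: prob_space_node_given prob_space_node_law)

lemma prob_space_ewt: "prob_space (ewt P)"
  unfolding ewt_def by (intro prob_space_PiM) (auto intro: prob_space_node_law)

lemma emeasure_node_PiM_emb:
  assumes J: "finite J" "J \<subseteq> Nf" and A: "\<And>i. i \<in> J \<Longrightarrow> A i \<in> sets node_space"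
    and K: "prob_space K" "sets K = sets node_space"
  shows "emeasure (PiM Nf (\<lambda>i. if i = [] then K else node_law (Phat P)))
      (prod_emb Nf (\<lambda>_. node_space) J (Pi\<^sub>E J A)) =
    (if [] \<in> J then emeasure K (A []) else 1) *
      (\<Prod>i\<in>J - {[]}. emeasure (node_law (Phat P)) (A i))"
proof -
  let ?K = "\<lambda>i. if i = [] then K else node_law (Phat P)"
  have sp: "space (?K i) = space node_space" for i
    by (rule sets_eq_imp_space_eq) (use K in auto)
  have "prod_emb Nf (\<lambda>_. node_space) J (Pi\<^sub>E J A) = prod_emb Nf ?K J (Pi\<^sub>E J A)"
    unfolding prod_emb_def sp ..
  also have "emeasure (PiM Nf ?K) \<dots> = (\<Prod>i\<in>J. emeasure (?K i) (A i))"
    using J A K by (intro emeasure_PiM_emb) (auto intro: prob_space_node_law)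
  also have "\<dots> = (if [] \<in> J then emeasure K (A []) else 1) *
      (\<Prod>i\<in>J - {[]}. emeasure (?K i) (A i))"
    using J(1) by (cases "[] \<in> J") (simp_all add: prod.remove[of J "[]"])
  also have "(\<Prod>i\<in>J - {[]}. emeasure (?K i) (A i)) =
      (\<Prod>i\<in>J - {[]}. emeasure (node_law (Phat P)) (A i))"
    by (intro prod.cong) auto
  finally show ?thesis .
qed

lemma node_given_measurable_emeasure:
  assumes "A \<in> sets node_space"
  shows "(\<lambda>t. emeasure (node_given t) A) \<in> borel_measurable borel"
  by (rule measurable_compose[OF measurable_prob_algebraD[OF node_given_measurable]
        measurable_emeasure_subprob_algebra[OF assms]])

lemma ewt_given_measurable:
  "ewt_given P \<in> borel \<rightarrow>\<^sub>M prob_algebra (PiM Nf (\<lambda>_. node_space))"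
proof (rule measurable_prob_algebra_generated[OF sets_PiM Int_stable_prod_algebra prod_algebra_sets_into_space])
  fix X assume "X \<in> prod_algebra Nf (\<lambda>_. node_space)"
  then obtain J A where X: "X = prod_emb Nf (\<lambda>_. node_space) J (Pi\<^sub>E J A)" "finite J" "J \<subseteq> Nf"
    "\<And>j. j \<in> J \<Longrightarrow> A j \<in> sets node_space"
    by (rule prod_algebraE) blast
  show "(\<lambda>t. emeasure (ewt_given P t) X) \<in> borel_measurable borel"
    unfolding ewt_given_def X(1)
    using X(2-4)
    by (cases "[] \<in> J")
      (auto simp: emeasure_node_PiM_emb prob_space_node_given
         intro!: borel_measurable_times_ennreal node_given_measurable_emeasure)
qed (simp_all add: prob_space_ewt_given sets_ewt_given)

lemma ewt_disintegration: "ewt P = type_law P \<bind> ewt_given P"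
proof (rule measure_eqI_PiM_infinite)
  have tl: "prob_space (type_law P)" "sets (type_law P) = sets borel"
    using type_law_in_prob_algebra[of P] by (auto simp: space_prob_algebra)
  have ne: "space (type_law P) \<noteq> {}"
    using sets_eq_imp_space_eq[OF tl(2)] by simp
  have meas: "node_given \<in> type_law P \<rightarrow>\<^sub>M subprob_algebra node_space"
    "ewt_given P \<in> type_law P \<rightarrow>\<^sub>M subprob_algebra (PiM Nf (\<lambda>_. node_space))"
    using measurable_prob_algebraD[OF node_given_measurable]
      measurable_prob_algebraD[OF ewt_given_measurable[of P]]
    by (simp_all add: measurable_cong_sets[OF tl(2) refl])
  show "sets (ewt P) = sets (PiM Nf (\<lambda>_. node_space))"
    by (rule sets_ewt)
  show "sets (type_law P \<bind> ewt_given P) = sets (PiM Nf (\<lambda>_. node_space))"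
    by (rule sets_bind) (simp_all add: ne sets_ewt_given)
  show "finite_measure (ewt P)"
    by (intro prob_space.finite_measure prob_space_ewt)
  fix A J assume J: "finite J" "J \<subseteq> Nf" and A: "\<And>i. i \<in> J \<Longrightarrow> A i \<in> sets node_space"
  let ?X = "prod_emb Nf (\<lambda>_. node_space) J (Pi\<^sub>E J A)"
  let ?c = "\<Prod>i\<in>J - {[]}. emeasure (node_law (Phat P)) (A i)"
  have X: "?X \<in> sets (PiM Nf (\<lambda>_. node_space))"
    using J A by (intro sets_PiM_I) auto
  have "emeasure (type_law P \<bind> ewt_given P) ?X =
      (\<integral>\<^sup>+t. (if [] \<in> J then emeasure (node_given t) (A []) else 1) * ?c \<partial>type_law P)"
    using J A unfolding emeasure_bind[OF ne meas(2) X] ewt_given_def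
    by (subst emeasure_node_PiM_emb) (auto intro: prob_space_node_given)
  also have "\<dots> = (if [] \<in> J then emeasure (node_law P) (A []) else 1) * ?c"
  proof (cases "[] \<in> J")
    case True
    then have m: "(\<lambda>t. emeasure (node_given t) (A [])) \<in> borel_measurable (type_law P)"
      using node_given_measurable_emeasure[OF A]
      by (simp add: measurable_cong_sets[OF tl(2) refl])
    show ?thesis
      using True by (simp add: nn_integral_multc[OF m] node_law_def emeasure_bind[OF ne meas(1) A])
  qed (simp add: prob_space.emeasure_space_1[OF tl(1)])
  also have "\<dots> = emeasure (ewt P) ?X"
    using J A unfolding ewt_def by (subst emeasure_node_PiM_emb) (auto intro: prob_space_node_law)
  finally show "emeasure (ewt P) ?X = emeasure (type_law P \<bind> ewt_given P) ?X" ..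
qed

end

theory Submission
  imports Defs
begin

text \<open>Write \<open>mu_type (m, x) = (m / x) f\<^sub>0(x)\<close> for \<open>\<mu>\<close>. The mean operator of the tree acts on functions of the
  form \<open>(m / x) f(x)\<close> through \<open>f \<mapsto> \<integral> min x z g\<^sub>2(z) f(z) dz\<close>, whose largest eigenvalue is \<open>\<beta>\<^sub>0\<close> with the
  positive eigenfunction \<open>f\<^sub>0\<close>. Since \<open>f\<^sub>0(x)\<close> is comparable with \<open>min 1 x\<close>, the kernel dominates a multiple of
  the product \<open>f\<^sub>0(x) f\<^sub>0(z)\<close>, so by Doeblin's argument it contracts, relative to \<open>\<beta>\<^sub>0\<close>, at a geometric rate on the
  functions annihilated by the left eigenfunctional; no spectral theory is needed. The sum of \<open>\<mu>\<close> over
  the \<open>l\<close>-th generation, divided by \<open>\<beta>\<^sub>0\<^sup>l\<close>, is a martingale with geometrically small increments in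
  \<open>L\<^sup>2\<close> because \<open>\<beta>\<^sub>0 > 1\<close>, and its second moments are the partial sums of \<open>U\<close>. The same estimate applied to
  the sum of \<open>1\<^sub>A - nubar A * \<mu>\<close> shows that \<open>W\<^sub>l(A)\<close> has the same limit as \<open>nubar A\<close> times the martingale.\<close>

section \<open>Type law and size-biasing\<close>

text \<open>A cost uniform on [0, x] is below z with probability min 1 (z/x), and x times this is
  min x z; the symmetry of that kernel is what makes the left eigenfunctional explicit. The series L
  solves the Volterra equation f(x) = 1 - s * int (z - x)^+ g2(z) f(z) dz with s = 1/beta.
  Subtracting its value at 0 gives the min-kernel equation up to the boundary value L(beta, 0), so
  zeros of L(beta, 0) yield eigenvalues, and the largest beta is the first zero in s, up to which
  positivity propagates from s = 0. The obstacle is that types are unbounded. Functionals are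
  therefore controlled by the weight (1 + n)^2, and one application of the mean operator turns such
  a bound into a multiple of mu. A second moment splits into the mean operator applied to the
  previous second moment, growing like beta^l, and a squared mean, growing like the square of the
  contracted rate. Divided by beta^(2 l), the former decays because beta > 1, the latter because of
  the contraction. Martingale increments fit the same estimate: they are generation sums of a
  functional whose conditional mean is zero.\<close>

lemma fst_ewt_type [measurable]: "fst \<in> (borel :: ewt_type measure) \<rightarrow>\<^sub>M count_space UNIV"
proof -
  have "fst \<in> (borel :: ewt_type measure) \<rightarrow>\<^sub>M borel"
    by (simp add: borel_prod[symmetric])
  then show ?thesis
    by (simp add: measurable_cong_sets[OF refl sets_borel_eq_count_space])
qed

lemma snd_ewt_type [measurable]: "snd \<in> borel_measurable (borel :: ewt_type measure)"
  by (simp add: borel_prod[symmetric])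

lemma Pair_ewt_type [measurable (raw)]:
  assumes "f \<in> M \<rightarrow>\<^sub>M count_space UNIV" "g \<in> borel_measurable M"
  shows "(\<lambda>x. (f x, g x)) \<in> M \<rightarrow>\<^sub>M (borel :: ewt_type measure)"
  unfolding borel_prod[symmetric] using assms(2) measurable_compose[OF assms(1), of "\<lambda>x. x" borel]
  by simp

text \<open>For x < 0 the series in \<open>g2\<close> may be negative, so the indicator is what
  makes this a density. \<open>f0\<close> is normalised in L^2 of this measure.\<close>

definition gmeas :: "nat pmf \<Rightarrow> real measure" where
  "gmeas P = density lborel (\<lambda>z. ennreal (indicator {0..} z * g2 P z))"

locale ewt_params =
  fixes P :: "nat pmf"
  assumes P0: "pmf P 0 = 0" and P1: "pmf P 1 < 1"
    and P_exp: "\<exists>\<theta>>0. integrable (measure_pmf P) (\<lambda>n. exp (\<theta> * real n))"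
begin

text \<open>(theta n)^k / k! is one term of the nonnegative series for exp (theta n), so the
  exponential moment dominates every power.\<close>

lemma integrable_power_P: "integrable (measure_pmf P) (\<lambda>n. real n ^ k)"
proof -
  obtain \<theta> where \<theta>: "\<theta> > 0" and i: "integrable (measure_pmf P) (\<lambda>n. exp (\<theta> * real n))"
    using P_exp by auto
  have "real n ^ k \<le> fact k / \<theta> ^ k * exp (\<theta> * real n)" for n
  proof -
    have "(\<theta> * real n) ^ k / fact k \<le> exp (\<theta> * real n)"
    proof -
      have s: "(\<lambda>j. (\<theta> * real n) ^ j /\<^sub>R fact j) sums exp (\<theta> * real n)"
        by (rule exp_converges)
      have "(\<Sum>j\<in>{k}. (\<theta> * real n) ^ j /\<^sub>R fact j) \<le> (\<Sum>j. (\<theta> * real n) ^ j /\<^sub>R fact j)"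
        using \<theta> by (intro sum_le_suminf sums_summable[OF s]) auto
      then show ?thesis using sums_unique[OF s] by (simp add: divide_inverse mult.commute)
    qed
    then show ?thesis using \<theta> by (simp add: field_simps)
  qed
  then show ?thesis
    by (intro Bochner_Integration.integrable_bound[OF integrable_mult_right[OF i, of "fact k / \<theta> ^ k"]])
       (use \<theta> in \<open>auto\<close>)
qed

lemma summable_g2: "summable (\<lambda>k. pmf P (k + 2) / fact k * x ^ k)"
proof (rule summable_comparison_test')
  show "summable (\<lambda>k. \<bar>x\<bar> ^ k /\<^sub>R fact k)" using exp_converges sums_summable by blast
  show "norm (pmf P (k + 2) / fact k * x ^ k) \<le> \<bar>x\<bar> ^ k /\<^sub>R fact k" for k
    using mult_right_mono[OF pmf_le_1[of P "k+2"], of "\<bar>x\<bar> ^ k / fact k"]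
    by (simp add: abs_mult power_abs divide_inverse mult.commute mult.left_commute)
qed

lemma g2_eq: "g2 P x = exp (- x) * (\<Sum>k. pmf P (k + 2) / fact k * x ^ k)"
  by (simp add: g2_def)

lemma isCont_g2: "isCont (g2 P) x"
  unfolding g2_eq[abs_def]
  by (intro continuous_intros isCont_powser_converges_everywhere summable_g2)

lemma continuous_on_g2: "continuous_on A (g2 P)"
  using isCont_g2 continuous_at_imp_continuous_on by blast

lemma g2_measurable [measurable]: "g2 P \<in> borel_measurable borel"
  by (intro borel_measurable_continuous_onI continuous_on_g2)

lemma g2_nonneg: "x \<ge> 0 \<Longrightarrow> g2 P x \<ge> 0"
  unfolding g2_eq by (intro mult_nonneg_nonneg suminf_nonneg summable_g2) auto

lemma g2_le_1: assumes "x \<ge> 0" shows "g2 P x \<le> 1"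
proof -
  have s: "(\<lambda>j. x ^ j /\<^sub>R fact j) sums exp x" by (rule exp_converges)
  have "(\<Sum>k. pmf P (k + 2) / fact k * x ^ k) \<le> (\<Sum>j. x ^ j /\<^sub>R fact j)"
  proof (intro suminf_le summable_g2 sums_summable[OF s])
    show "pmf P (k + 2) / fact k * x ^ k \<le> x ^ k /\<^sub>R fact k" for k
      using assms mult_right_mono[OF pmf_le_1[of P "k+2"], of "x ^ k / fact k"]
      by (simp add: divide_inverse mult.commute mult.left_commute)
  qed
  also have "\<dots> = exp x" using sums_unique[OF s] ..
  finally show ?thesis
    unfolding g2_eq using mult_left_mono[of _ "exp x" "exp (-x)"] by (simp add: exp_minus)
qed

text \<open>P has no mass at 0 and is not concentrated at 1, so some k >= 2 carries mass and
  contributes a positive term to the series.\<close>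

lemma g2_pos: assumes "x > 0" shows "g2 P x > 0"
proof -
  have "\<exists>k\<ge>2. pmf P k > 0"
  proof (rule ccontr)
    assume "\<not> ?thesis"
    then have "pmf P k = 0" if "k \<noteq> 1" for k
      using that P0 by (cases "k = 0") (force simp: not_less order_antisym)+
    then have "set_pmf P \<subseteq> {1}" by (metis set_pmf_iff singletonI subsetI)
    then have "measure (measure_pmf P) {1} = 1"
      by (simp add: measure_pmf.prob_eq_1 AE_measure_pmf_iff subset_iff)
    with P1 show False by (simp add: measure_pmf_single)
  qed
  then obtain k where k: "pmf P (k + 2) > 0" by (metis add.commute le_Suc_ex)
  have "(\<Sum>k. pmf P (k + 2) / fact k * x ^ k) > 0"
    using k assms by (intro suminf_pos2[of _ k] summable_g2) auto
  then show ?thesis unfolding g2_eq by simp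
qed

section \<open>Law of the type of a non-root vertex\<close>

definition TL :: "ewt_type measure" where "TL = type_law (Phat P)"

lemma sets_TL [simp, measurable_cong]: "sets TL = sets borel"
  and prob_TL: "prob_space TL"
  using type_law_in_prob_algebra[of "Phat P"] by (auto simp: TL_def space_prob_algebra)

lemma space_TL [simp]: "space TL = UNIV"
  using sets_eq_imp_space_eq[OF sets_TL] by simp

lemma nn_integral_TL:
  assumes [measurable]: "h \<in> borel_measurable borel"
  shows "(\<integral>\<^sup>+s. h s \<partial>TL) =
    (\<Sum>k. ennreal (pmf P (k + 1)) * (\<integral>\<^sup>+z. ennreal (erlang_density k 1 z) * h (k, z) \<partial>lborel))"
proof -
  have K: "(\<lambda>n. distr (density lborel (erlang_density n 1)) borel (\<lambda>v. (n, v)))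
      \<in> measure_pmf (Phat P) \<rightarrow>\<^sub>M subprob_algebra (borel :: ewt_type measure)"
  proof (simp add: measurable_pmf_measure1, intro funcsetI)
    fix n :: nat
    interpret prob_space "density lborel (erlang_density n 1)"
      by (rule prob_space_erlang_density) simp
    show "distr (density lborel (erlang_density n 1)) borel (\<lambda>v. (n, v))
      \<in> space (subprob_algebra (borel :: ewt_type measure))"
      by (auto simp: space_subprob_algebra intro!: prob_space_imp_subprob_space prob_space_distr)
  qed
  have "(\<integral>\<^sup>+s. h s \<partial>TL) =
      (\<integral>\<^sup>+n. (\<integral>\<^sup>+z. ennreal (erlang_density n 1 z) * h (n, z) \<partial>lborel) \<partial>measure_pmf (Phat P))"
    unfolding TL_def type_law_def
    by (subst nn_integral_bind[OF _ K]) (simp_all add: nn_integral_distr nn_integral_density)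
  also have "\<dots> = (\<Sum>k. ennreal (pmf P (k + 1)) * (\<integral>\<^sup>+z. ennreal (erlang_density k 1 z) * h (k, z) \<partial>lborel))"
    by (simp add: nn_integral_measure_pmf pmf_Phat[OF P0] nn_integral_count_space_nat)
  finally show ?thesis .
qed

text \<open>The second component of a type is an arbitrary real number; because of this lemma, later
  estimates on types need only be shown for v > 0.\<close>

lemma AE_TL_pos: "AE s in TL. snd s > 0"
proof -
  have "(\<integral>\<^sup>+s. indicator {s. snd s \<le> 0} s \<partial>TL) = (\<Sum>k. ennreal (pmf P (k + 1)) * 0)"
  proof (subst nn_integral_TL)
    show "indicator {s. snd s \<le> 0} \<in> borel_measurable (borel :: ewt_type measure)"
      by measurable
    have "(\<integral>\<^sup>+z. ennreal (erlang_density k 1 z) * indicator {s. snd s \<le> 0} (k, z) \<partial>lborel) = 0" for k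
    proof -
      have "AE z in lborel. z \<noteq> (0::real)" by (rule AE_lborel_singleton)
      then have "AE z in lborel. ennreal (erlang_density k 1 z) * indicator {s. snd s \<le> 0} (k, z) = 0"
        by eventually_elim (auto simp: erlang_density_def indicator_def)
      then show ?thesis by (subst nn_integral_0_iff_AE) (auto simp: indicator_def)
    qed
    then show "(\<Sum>k. ennreal (pmf P (k + 1)) * (\<integral>\<^sup>+z. ennreal (erlang_density k 1 z) * indicator {s. snd s \<le> 0} (k, z) \<partial>lborel))
       = (\<Sum>k. ennreal (pmf P (k + 1)) * 0)" by simp
  qed
  then have "emeasure TL {s. snd s \<le> 0} = 0"
    by (subst (asm) nn_integral_indicator) auto
  then show ?thesis
    by (intro AE_I[of _ _ "{s. snd s \<le> 0}"]) auto
qed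

section \<open>The measure g2(z) dz on the half line\<close>

lemma sets_gmeas [simp, measurable_cong]: "sets (gmeas P) = sets borel"
  and space_gmeas [simp]: "space (gmeas P) = UNIV"
  by (simp_all add: gmeas_def)

lemma nn_integral_gmeas:
  assumes [measurable]: "h \<in> borel_measurable borel"
  shows "(\<integral>\<^sup>+z. h z \<partial>gmeas P) = (\<integral>\<^sup>+z. ennreal (indicator {0..} z * g2 P z) * h z \<partial>lborel)"
  unfolding gmeas_def by (subst nn_integral_density) auto

lemma integral_gmeas:
  fixes h :: "real \<Rightarrow> real"
  assumes [measurable]: "h \<in> borel_measurable borel"
  shows "(\<integral>z. h z \<partial>gmeas P) = (LINT z:{0..}|lborel. g2 P z * h z)"
  unfolding gmeas_def set_lebesgue_integral_def
  by (subst integral_density) (auto simp: indicator_def g2_nonneg intro!: Bochner_Integration.integral_cong)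

lemma AE_gmeas_pos: "AE z in gmeas P. z > 0"
proof -
  have "AE z in lborel. z \<noteq> (0::real)" by (rule AE_lborel_singleton)
  then show ?thesis
    unfolding gmeas_def by (subst AE_density) (auto elim!: eventually_mono simp: indicator_def)
qed

text \<open>Size-biasing the offspring number turns the type law into \<open>z g\<^sub>2(z) dz\<close>.\<close>

lemma nn_integral_TL_size_biased:
  assumes [measurable]: "u \<in> borel_measurable borel"
  shows "(\<integral>\<^sup>+s. of_nat (fst s) * u (snd s) \<partial>TL) = (\<integral>\<^sup>+z. ennreal z * u z \<partial>gmeas P)"
proof -
  have "(\<integral>\<^sup>+s. of_nat (fst s) * u (snd s) \<partial>TL) =
    (\<Sum>k. ennreal (pmf P (k + 1)) * (\<integral>\<^sup>+z. ennreal (erlang_density k 1 z) * (of_nat k * u z) \<partial>lborel))"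
    by (subst nn_integral_TL) auto
  \<comment> \<open>The factor k kills the term k = 0. After the shift, (k + 1) / (k + 1)! = 1 / k!
    turns the Erlang weights into those of \<open>g2\<close>, with one factor z left over.\<close>
  also have "\<dots> = (\<Sum>k. ennreal (pmf P (k + 2)) * (\<integral>\<^sup>+z. ennreal (erlang_density (k+1) 1 z) * (of_nat (k+1) * u z) \<partial>lborel))"
    by (subst suminf_offset[of _ 1]) (auto simp: summableI)
  also have "\<dots> = (\<Sum>k. (\<integral>\<^sup>+z. ennreal (pmf P (k + 2)) * (ennreal (erlang_density (k+1) 1 z) * (of_nat (k+1) * u z)) \<partial>lborel))"
    by (subst nn_integral_cmult) auto
  also have "\<dots> = (\<integral>\<^sup>+z. (\<Sum>k. ennreal (pmf P (k + 2)) * (ennreal (erlang_density (k+1) 1 z) * (of_nat (k+1) * u z))) \<partial>lborel)"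
    by (subst nn_integral_suminf) auto
  also have "\<dots> = (\<integral>\<^sup>+z. ennreal (indicator {0..} z * g2 P z) * (ennreal z * u z) \<partial>lborel)"
  proof (intro nn_integral_cong)
    fix z :: real
    have e: "ennreal (pmf P (k + 2)) * (ennreal (erlang_density (k+1) 1 z) * (of_nat (k+1) * u z)) =
       ennreal (indicator {0..} z * z * exp (- z) * (pmf P (k + 2) / fact k * z ^ k)) * u z" for k
    proof -
      have "ennreal (pmf P (k + 2)) * (ennreal (erlang_density (k+1) 1 z) * (of_nat (k+1) * u z)) =
         ennreal (pmf P (k + 2) * (erlang_density (k+1) 1 z * real (k+1))) * u z"
        by (simp only: ennreal_of_nat_eq_real_of_nat) (simp add: ennreal_mult mult.assoc)
      also have "pmf P (k + 2) * (erlang_density (k+1) 1 z * real (k+1)) =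
         indicator {0..} z * z * exp (- z) * (pmf P (k + 2) / fact k * z ^ k)"
      proof -
        have "real (k + 1) / fact (k + 1) = 1 / fact k"
          by (simp add: fact_Suc del: of_nat_Suc)
        then have "x * (real (k + 1) / fact (k + 1)) = x * (1 / fact k)" for x :: real by simp
        from this[of "pmf P (k + 2) * z ^ (k + 1) * exp (- z)"] show ?thesis
          by (simp add: erlang_density_def indicator_def mult.assoc mult.left_commute mult.commute
              del: of_nat_Suc fact_Suc)
      qed
      finally show ?thesis .
    qed
    have "(\<Sum>k. ennreal (pmf P (k + 2)) * (ennreal (erlang_density (k+1) 1 z) * (of_nat (k+1) * u z)))
       = (\<Sum>k. ennreal (indicator {0..} z * z * exp (- z) * (pmf P (k + 2) / fact k * z ^ k))) * u z"
      unfolding e by (rule ennreal_suminf_multc)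
    also have "(\<Sum>k. ennreal (indicator {0..} z * z * exp (- z) * (pmf P (k + 2) / fact k * z ^ k)))
      = ennreal (\<Sum>k. indicator {0..} z * z * exp (- z) * (pmf P (k + 2) / fact k * z ^ k))"
      by (intro suminf_ennreal2 summable_mult summable_g2) (auto simp: indicator_def)
    also have "(\<Sum>k. indicator {0..} z * z * exp (- z) * (pmf P (k + 2) / fact k * z ^ k)) =
      indicator {0..} z * g2 P z * z"
      unfolding g2_eq by (subst suminf_mult[OF summable_g2]) simp
    also have "ennreal (indicator {0..} z * g2 P z * z) * u z = ennreal (indicator {0..} z * g2 P z) * (ennreal z * u z)"
      by (cases "z \<ge> 0") (auto simp: ennreal_mult g2_nonneg mult.assoc)
    finally show "(\<Sum>k. ennreal (pmf P (k + 2)) * (ennreal (erlang_density (k+1) 1 z) * (of_nat (k+1) * u z)))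
       = ennreal (indicator {0..} z * g2 P z) * (ennreal z * u z)" .
  qed
  also have "\<dots> = (\<integral>\<^sup>+z. ennreal z * u z \<partial>gmeas P)"
    by (subst nn_integral_gmeas) auto
  finally show ?thesis .
qed

text \<open>Given n = k the Erlang variable has mean k + 1, so the integral reduces to a third
  moment of P. The factor (1 + n)^2 will bound second moments of sums over children, and 1 + v pays
  for the factor max 1 v in \<open>keep_prob_upper\<close>.\<close>

lemma integrable_TL_weight: "integrable TL (\<lambda>s. (1 + snd s) * (1 + real (fst s))\<^sup>2)"
proof (rule integrableI_nonneg)
  show "AE s in TL. 0 \<le> (1 + snd s) * (1 + real (fst s))\<^sup>2"
    using AE_TL_pos by eventually_elim auto
  show "(\<lambda>s. (1 + snd s) * (1 + real (fst s))\<^sup>2) \<in> borel_measurable TL"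
    by measurable
  have s: "summable (\<lambda>k. pmf P (k+1) * (real (k + 2) * (1 + real k)\<^sup>2))"
  proof -
    have i: "integrable (measure_pmf P) (\<lambda>n. (real n + 1) * (real n)^2)"
      using integrable_power_P[of 2] integrable_power_P[of 3]
      by (simp add: algebra_simps power_numeral_reduce)
    then have "integrable (count_space UNIV) (\<lambda>n. pmf P n * ((real n + 1) * (real n)^2))"
      by (subst (asm) measure_pmf_eq_density) (simp add: integrable_density)
    then have "summable (\<lambda>n. pmf P n * ((real n + 1) * (real n)^2))"
      using integrable_count_space_nat_iff summable_norm_cancel by blast
    then have "summable (\<lambda>n. pmf P (Suc n) * ((real (Suc n) + 1) * (real (Suc n))^2))"
      by (subst summable_Suc_iff)
    then show ?thesis by (simp add: algebra_simps)
  qed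
  have m: "(\<integral>\<^sup>+z. ennreal (erlang_density k 1 z) * ennreal ((1 + z) * (1 + real k)\<^sup>2) \<partial>lborel)
      = ennreal (real (k + 2) * (1 + real k)\<^sup>2)" for k
  proof -
    have "(\<integral>\<^sup>+z. ennreal (erlang_density k 1 z) * ennreal ((1 + z) * (1 + real k)\<^sup>2) \<partial>lborel)
      = (\<integral>\<^sup>+z. ennreal ((1 + real k)\<^sup>2) * (ennreal (erlang_density k 1 z * z ^ 0) + ennreal (erlang_density k 1 z * z ^ 1)) \<partial>lborel)"
      by (intro nn_integral_cong)
        (auto simp: erlang_density_def algebra_simps simp flip: ennreal_mult ennreal_plus)
    also have "\<dots> = ennreal ((1 + real k)\<^sup>2) * (ennreal (fact (k + 0) / (fact k * 1 ^ 0)) + ennreal (fact (k + 1) / (fact k * 1 ^ 1)))"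
      by (subst nn_integral_cmult, simp, subst nn_integral_add, simp, simp, subst (1 2) nn_integral_erlang_ith_moment) simp_all
    also have "\<dots> = ennreal ((1 + real k)\<^sup>2) * (ennreal 1 + ennreal (real k + 1))"
    proof -
      have "fact (k + 1) / fact k = real k + 1" by (simp add: field_simps)
      then show ?thesis by (simp add: ac_simps)
    qed
    also have "\<dots> = ennreal ((1 + real k)\<^sup>2 * (1 + (real k + 1)))"
      by (simp add: ac_simps flip: ennreal_mult ennreal_plus del: ennreal_1)
    also have "(1 + real k)\<^sup>2 * (1 + (real k + 1)) = real (k + 2) * (1 + real k)\<^sup>2" by simp
    finally show ?thesis .
  qed
  have "(\<integral>\<^sup>+s. ennreal ((1 + snd s) * (1 + real (fst s))\<^sup>2) \<partial>TL)
    = (\<Sum>k. ennreal (pmf P (k+1)) * ennreal (real (k + 2) * (1 + real k)\<^sup>2))"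
    by (subst nn_integral_TL) (simp_all add: m[simplified])
  also have "\<dots> = ennreal (\<Sum>k. pmf P (k+1) * (real (k + 2) * (1 + real k)\<^sup>2))"
    using s by (subst suminf_ennreal2[symmetric]) (auto simp: ennreal_mult)
  also have "\<dots> < \<infinity>" by simp
  finally show "(\<integral>\<^sup>+s. ennreal ((1 + snd s) * (1 + real (fst s))\<^sup>2) \<partial>TL) < \<infinity>" .
qed

text \<open>Size-biasing with u = 1 identifies this moment with the mean offspring number of a
  non-root vertex.\<close>

lemma gmeas_first_moment: "(\<integral>\<^sup>+z. ennreal z \<partial>gmeas P) < \<infinity>"
proof -
  have "(\<integral>\<^sup>+z. ennreal z \<partial>gmeas P) = (\<integral>\<^sup>+s. of_nat (fst s) * 1 \<partial>TL)"
    using nn_integral_TL_size_biased[of "\<lambda>_. 1"] by simp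
  also have "\<dots> \<le> (\<integral>\<^sup>+s. ennreal ((1 + snd s) * (1 + real (fst s))\<^sup>2) \<partial>TL)"
  proof (intro nn_integral_mono_AE)
    show "AE s in TL. of_nat (fst s) * 1 \<le> ennreal ((1 + snd s) * (1 + real (fst s))\<^sup>2)"
      using AE_TL_pos
    proof eventually_elim
      case (elim s)
      have "real (fst s) \<le> 1 * (1 + real (fst s))\<^sup>2" by (simp add: power2_eq_square algebra_simps)
      also have "\<dots> \<le> (1 + snd s) * (1 + real (fst s))\<^sup>2" using elim by (intro mult_right_mono) auto
      finally show ?case by (simp add: ennreal_of_nat_eq_real_of_nat ennreal_leI)
    qed
  qed
  also have "\<dots> < \<infinity>"
    using integrable_TL_weight AE_TL_pos
    by (subst nn_integral_eq_integral) (auto elim!: eventually_mono)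
  finally show ?thesis .
qed

lemma integrable_gmeas_id: "integrable (gmeas P) (\<lambda>z. z)"
  using gmeas_first_moment AE_gmeas_pos
  by (intro integrableI_nonneg) (auto elim!: eventually_mono)

text \<open>On [0, 1] the density is at most 1, and beyond 1 the mass is at most the first
  moment.\<close>

lemma finite_gmeas: "finite_measure (gmeas P)"
proof
  have "emeasure (gmeas P) (space (gmeas P)) = (\<integral>\<^sup>+z. 1 \<partial>gmeas P)" by simp
  also have "\<dots> \<le> (\<integral>\<^sup>+z. indicator {0..1} z + ennreal z \<partial>gmeas P)"
  proof (intro nn_integral_mono_AE)
    show "AE z in gmeas P. 1 \<le> indicator {0..1} z + ennreal z"
      using AE_gmeas_pos by eventually_elim (auto simp: indicator_def)
  qed
  also have "\<dots> = emeasure (gmeas P) {0..1} + (\<integral>\<^sup>+z. ennreal z \<partial>gmeas P)"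
    by (subst nn_integral_add) auto
  also have "emeasure (gmeas P) {0..1} = (\<integral>\<^sup>+z. indicator {0..1} z \<partial>gmeas P)" by simp
  also have "\<dots> = (\<integral>\<^sup>+z. ennreal (indicator {0..} z * g2 P z) * indicator {0..1} z \<partial>lborel)"
    by (rule nn_integral_gmeas) simp
  also have "\<dots> \<le> (\<integral>\<^sup>+z. indicator {0..1::real} z \<partial>lborel)"
    by (intro nn_integral_mono) (auto simp: indicator_def g2_le_1 ennreal_le_1)
  also have "\<dots> = 1" by simp
  finally have "emeasure (gmeas P) (space (gmeas P)) \<le> 1 + (\<integral>\<^sup>+z. ennreal z \<partial>gmeas P)"
    by (simp add: add_mono)
  also have "\<dots> < \<infinity>" using gmeas_first_moment by simp
  finally show "emeasure (gmeas P) (space (gmeas P)) \<noteq> \<infinity>" by simp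
qed

sublocale gmeas: finite_measure "gmeas P" by (rule finite_gmeas)

text \<open>Since \<open>g2\<close> is positive on the open half line, null sets of
  \<open>gmeas P\<close> are Lebesgue null there.\<close>

lemma gmeas_positive:
  fixes h :: "real \<Rightarrow> real"
  assumes [measurable]: "h \<in> borel_measurable borel" and "AE z in gmeas P. h z = 0"
  shows "AE z in lborel. z > 0 \<longrightarrow> h z = 0"
proof -
  have "AE z in lborel. 0 < ennreal (indicator {0..} z * g2 P z) \<longrightarrow> h z = 0"
    using assms(2) unfolding gmeas_def by (subst (asm) AE_density) auto
  then show ?thesis by eventually_elim (auto simp: g2_pos)
qed

end

section \<open>The power series in the inverse eigenvalue\<close>

context ewt_params begin

lemma AE_gmeasI: "(\<And>z. 0 < z \<Longrightarrow> Q z) \<Longrightarrow> AE z in gmeas P. Q z"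
  using AE_gmeas_pos by (rule eventually_mono)

section \<open>Tails of the first moment and the iterated integrals\<close>

definition gbar :: real where "gbar = (\<integral>z. z \<partial>gmeas P)"

text \<open>For x >= 0 this is the integral of z g2(z) over [x, infinity). Written with an oriented
  integral from 0, it is differentiable at every real x.\<close>

definition gtail :: "real \<Rightarrow> real" where "gtail x = gbar - (LBINT z=0..x. z * g2 P z)"

lemma gbar_nonneg: "0 \<le> gbar"
  unfolding gbar_def by (intro integral_nonneg_AE AE_gmeasI) simp

lemma gtail_0: "gtail 0 = gbar"
  by (simp add: gtail_def zero_ereal_def[symmetric])

lemma DERIV_gtail: "DERIV gtail x :> - (x * g2 P x)"
proof -
  \<comment> \<open>This makes x an interior point of [-b, b], so that the derivative within the
    interval is a derivative at x, also for negative x.\<close>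
  define b where "b = \<bar>x\<bar> + 1"
  have "((\<lambda>u. LBINT y=ereal 0..ereal u. y * g2 P y) has_vector_derivative (x * g2 P x)) (at x within {-b..b})"
    by (rule interval_integral_FTC2) (auto simp: b_def intro!: continuous_intros continuous_on_g2)
  then have "((\<lambda>u. LBINT y=ereal 0..ereal u. y * g2 P y) has_vector_derivative (x * g2 P x)) (at x)"
    by (subst (asm) at_within_interior) (auto simp: b_def)
  then show ?thesis
    unfolding gtail_def[abs_def] zero_ereal_def[symmetric]
    by (auto intro!: derivative_eq_intros simp: has_real_derivative_iff_has_vector_derivative[symmetric])
qed

lemma set_integrable_g2_id: "set_integrable lborel {0..} (\<lambda>z. z * g2 P z)"
proof -
  have "integrable lborel (\<lambda>x. (indicator {0..} x * g2 P x) *\<^sub>R x)"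
    using integrable_gmeas_id unfolding gmeas_def
    by (subst (asm) integrable_density) (auto simp: indicator_def g2_nonneg)
  then show ?thesis
    unfolding set_integrable_def by (simp add: mult.commute mult.left_commute)
qed

lemma gtail_lim: "(gtail \<longlongrightarrow> 0) at_top"
proof -
  have "((\<lambda>b. LINT z:{0..b}|lborel. z * g2 P z) \<longlongrightarrow> (LINT z:{0..}|lborel. z * g2 P z)) at_top"
    by (intro tendsto_set_lebesgue_integral_at_top set_integrable_g2_id) auto
  also have "(LINT z:{0..}|lborel. z * g2 P z) = gbar"
    unfolding gbar_def by (subst integral_gmeas) (auto simp: mult.commute)
  finally have "((\<lambda>b. gbar - (LINT z:{0..b}|lborel. z * g2 P z)) \<longlongrightarrow> gbar - gbar) at_top"
    by (intro tendsto_diff tendsto_const)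
  moreover have "\<forall>\<^sub>F b in at_top. gbar - (LINT z:{0..b}|lborel. z * g2 P z) = gtail b"
    using eventually_ge_at_top[of 0]
    by eventually_elim (simp add: gtail_def zero_ereal_def interval_integral_Icc)
  ultimately show ?thesis by (auto dest: Lim_transform_eventually)
qed

lemma gtail_antimono:
  assumes "0 \<le> x" "x \<le> y" shows "gtail y \<le> gtail x"
  using assms(2)
proof (rule DERIV_nonpos_imp_nonincreasing)
  fix z assume "x \<le> z" "z \<le> y"
  with assms show "\<exists>d. DERIV gtail z :> d \<and> d \<le> 0"
    by (intro exI[of _ "- (z * g2 P z)"]) (auto intro: DERIV_gtail simp: g2_nonneg)
qed

lemma gtail_nonneg: assumes "0 \<le> x" shows "0 \<le> gtail x"
proof (rule tendsto_upperbound[OF gtail_lim])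
  show "\<forall>\<^sub>F y in at_top. gtail y \<le> gtail x"
    using assms by (intro eventually_mono[OF eventually_ge_at_top[of x]] gtail_antimono)
qed simp

lemma gtail_measurable [measurable]: "gtail \<in> borel_measurable borel"
  by (intro borel_measurable_continuous_onI continuous_at_imp_continuous_on ballI DERIV_isCont[OF DERIV_gtail])

text \<open>-gtail^(i+1) / (i+1)! is an antiderivative of the integrand and vanishes at infinity.
  This is the induction step behind the factorial in \<open>G_bounds\<close>.\<close>

lemma nn_integral_gtail_power:
  assumes "0 \<le> x"
  shows "(\<integral>\<^sup>+z. ennreal (indicator {x..} z * z * (gtail z ^ i / fact i)) \<partial>gmeas P)
    = ennreal (gtail x ^ Suc i / fact (Suc i))"
proof -
  have "(\<integral>\<^sup>+z. ennreal (indicator {x..} z * z * (gtail z ^ i / fact i)) \<partial>gmeas P)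
    = (\<integral>\<^sup>+z. ennreal (z * g2 P z * (gtail z ^ i / fact i)) * indicator {x..} z \<partial>lborel)"
  proof (subst nn_integral_gmeas, measurable, intro nn_integral_cong)
    fix z
    show "ennreal (indicator {0..} z * g2 P z) * ennreal (indicator {x..} z * z * (gtail z ^ i / fact i))
      = ennreal (z * g2 P z * (gtail z ^ i / fact i)) * indicator {x..} z"
    proof (cases "x \<le> z")
      case True
      then have "0 \<le> z" "0 \<le> z * (gtail z ^ i / fact i)"
        using assms gtail_nonneg[of z] by auto
      then show ?thesis
        using True g2_nonneg[of z] by (subst ennreal_mult[symmetric]) (auto simp: mult_ac)
    qed simp
  qed
  also have "\<dots> = ennreal (0 - (- (gtail x ^ Suc i / fact (Suc i))))"
  proof (rule nn_integral_FTC_atLeast)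
    fix z assume "x \<le> z"
    have "((\<lambda>z. gtail z ^ Suc i) has_real_derivative real (Suc i) * (- (z * g2 P z) * gtail z ^ i)) (at z)"
      using DERIV_power[OF DERIV_gtail[of z], of "Suc i"] by (simp add: mult_ac)
    then have "((\<lambda>z. - (gtail z ^ Suc i / fact (Suc i))) has_real_derivative
        - (real (Suc i) * (- (z * g2 P z) * gtail z ^ i) / fact (Suc i))) (at z)"
      by (intro DERIV_minus DERIV_cdivide)
    also have "- (real (Suc i) * (- (z * g2 P z) * gtail z ^ i) / fact (Suc i)) = z * g2 P z * (gtail z ^ i / fact i)"
      by (simp add: fact_Suc del: of_nat_Suc)
    finally show "((\<lambda>z. - (gtail z ^ Suc i / fact (Suc i))) has_real_derivative
        z * g2 P z * (gtail z ^ i / fact i)) (at z)" .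
    show "0 \<le> z * g2 P z * (gtail z ^ i / fact i)"
      using assms \<open>x \<le> z\<close> gtail_nonneg[of z] g2_nonneg[of z] by (intro mult_nonneg_nonneg divide_nonneg_nonneg) auto
  next
    show "((\<lambda>z. - (gtail z ^ Suc i / fact (Suc i))) \<longlongrightarrow> 0) at_top"
      using gtail_lim by (auto intro!: tendsto_eq_intros)
  qed measurable
  finally show ?thesis by simp
qed

text \<open>Tonelli: for fixed z the variable y runs through [x, z], an interval of length (z -
  x)^+. The passage through nonnegative integrals lets the outer integral be computed without first
  proving that the inner one is integrable in y.\<close>

lemma iterated_tail_integral:
  fixes \<phi> :: "real \<Rightarrow> real"
  assumes [measurable]: "\<phi> \<in> borel_measurable borel" and nn: "\<And>z. 0 \<le> z \<Longrightarrow> 0 \<le> \<phi> z"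
    and bd: "\<And>z. 0 \<le> z \<Longrightarrow> \<phi> z \<le> C" and x: "0 \<le> x"
  shows "(LINT y:{x..}|lborel. (LINT z:{y..}|lborel. g2 P z * \<phi> z)) = (\<integral>z. max 0 (z - x) * \<phi> z \<partial>gmeas P)"
proof -
  define I where "I y = (LINT z:{y..}|lborel. g2 P z * \<phi> z)" for y
  have I: "ennreal (I y) = (\<integral>\<^sup>+z. indicator {y..} z * ennreal (\<phi> z) \<partial>gmeas P)" and I0: "0 \<le> I y" if "0 \<le> y" for y
  proof -
    have *: "I y = (\<integral>z. indicator {y..} z * \<phi> z \<partial>gmeas P)"
      unfolding I_def using that by (subst integral_gmeas)
        (auto simp: set_lebesgue_integral_def indicator_def intro!: Bochner_Integration.integral_cong)
    have ae: "AE z in gmeas P. 0 \<le> indicator {y..} z * \<phi> z"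
      using AE_gmeas_pos by eventually_elim (auto simp: nn)
    have "integrable (gmeas P) (\<lambda>z. indicator {y..} z * \<phi> z)"
    proof (rule gmeas.integrable_const_bound)
      show "AE z in gmeas P. norm (indicator {y..} z * \<phi> z) \<le> C"
        using AE_gmeas_pos
      proof eventually_elim
        case (elim z)
        then show ?case
          using nn[of z] bd[of z] by (cases "y \<le> z") (simp_all add: indicator_def)
      qed
    qed measurable
    then have "ennreal (I y) = (\<integral>\<^sup>+z. ennreal (indicator {y..} z * \<phi> z) \<partial>gmeas P)"
      unfolding * using ae by (rule nn_integral_eq_integral[symmetric])
    also have "\<dots> = (\<integral>\<^sup>+z. indicator {y..} z * ennreal (\<phi> z) \<partial>gmeas P)"
      by (intro nn_integral_cong) (auto simp: indicator_def)
    finally show "ennreal (I y) = (\<integral>\<^sup>+z. indicator {y..} z * ennreal (\<phi> z) \<partial>gmeas P)" .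
    show "0 \<le> I y" unfolding * by (rule integral_nonneg_AE[OF ae])
  qed
  have [measurable]: "I \<in> borel_measurable borel"
    unfolding I_def[abs_def] set_lebesgue_integral_def
    by (intro lborel.borel_measurable_lebesgue_integral) (simp add: indicator_def)
  interpret pair_sigma_finite lborel "gmeas P" ..
  have "(LINT y:{x..}|lborel. I y) = enn2real (\<integral>\<^sup>+y. ennreal (indicator {x..} y * I y) \<partial>lborel)"
    unfolding set_lebesgue_integral_def
  proof (subst integral_eq_nn_integral)
    show "AE y in lborel. 0 \<le> indicat_real {x..} y *\<^sub>R I y"
      using x I0 by (intro AE_I2) (simp add: indicator_def)
  qed simp_all
  also have "(\<integral>\<^sup>+y. ennreal (indicator {x..} y * I y) \<partial>lborel)
     = (\<integral>\<^sup>+y. (\<integral>\<^sup>+z. indicator {x..} y * (indicator {y..} z * ennreal (\<phi> z)) \<partial>gmeas P) \<partial>lborel)"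
    using x I by (intro nn_integral_cong) (auto simp: indicator_def)
  also have "\<dots> = (\<integral>\<^sup>+z. (\<integral>\<^sup>+y. indicator {x..} y * (indicator {y..} z * ennreal (\<phi> z)) \<partial>lborel) \<partial>gmeas P)"
    by (subst Fubini') (auto simp: indicator_def)
  also have "\<dots> = (\<integral>\<^sup>+z. ennreal (max 0 (z - x) * \<phi> z) \<partial>gmeas P)"
  proof (intro nn_integral_cong_AE)
    show "AE z in gmeas P. (\<integral>\<^sup>+y. indicator {x..} y * (indicator {y..} z * ennreal (\<phi> z)) \<partial>lborel)
      = ennreal (max 0 (z - x) * \<phi> z)"
      using AE_gmeas_pos
    proof eventually_elim
      case (elim z)
      have "(\<integral>\<^sup>+y. indicator {x..} y * (indicator {y..} z * ennreal (\<phi> z)) \<partial>lborel)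
        = (\<integral>\<^sup>+y. ennreal (\<phi> z) * indicator {x..z} y \<partial>lborel)"
        by (intro nn_integral_cong) (auto simp: indicator_def)
      also have "\<dots> = ennreal (\<phi> z) * ennreal (max 0 (z - x))"
        by (subst nn_integral_cmult_indicator) (auto simp: max_def)
      also have "\<dots> = ennreal (max 0 (z - x) * \<phi> z)"
        by (subst ennreal_mult[symmetric]) (use elim nn[of z] in \<open>auto simp: mult.commute\<close>)
      finally show ?case .
    qed
  qed
  also have "enn2real \<dots> = (\<integral>z. max 0 (z - x) * \<phi> z \<partial>gmeas P)"
    by (intro integral_eq_nn_integral[symmetric] AE_gmeasI) (simp_all add: nn)
  finally show ?thesis unfolding I_def .
qed

lemma G_measurable [measurable]: "G P i \<in> borel_measurable borel"
proof (induction i)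
  case (Suc i)
  note [measurable] = Suc
  have [measurable]: "(\<lambda>y. LINT z:{y..}|lborel. g2 P z * G P i z) \<in> borel_measurable borel"
    unfolding set_lebesgue_integral_def
    by (intro lborel.borel_measurable_lebesgue_integral) (simp add: indicator_def)
  show ?case
    unfolding G.simps
    unfolding set_lebesgue_integral_def[of _ _ "\<lambda>y. LINT z:{y..}|lborel. g2 P z * G P i z"]
    by (intro lborel.borel_measurable_lebesgue_integral) (simp add: indicator_def)
qed simp

text \<open>Estimating (z - x)^+ by z on z >= x reduces the induction step to the explicit integral
  of gtail^i. The resulting factorial makes the power series below converge for every s.\<close>

lemma G_bounds:
  assumes "0 \<le> x" shows "0 \<le> G P i x" "G P i x \<le> gtail x ^ i / fact i"
  using assms
proof (induction i arbitrary: x)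
  case (Suc i)
  note nn = Suc.IH(1) and ub = Suc.IH(2)
  \<comment> \<open>\<open>iterated_tail_integral\<close> asks for a bound uniform in z, so gtail is
    replaced by its value at 0.\<close>
  have ub': "G P i z \<le> gbar ^ i / fact i" if "0 \<le> z" for z
  proof -
    have "gtail z ^ i \<le> gbar ^ i"
      using that gtail_antimono[of 0 z] gtail_nonneg[of z] by (intro power_mono) (auto simp: gtail_0)
    then show ?thesis using ub[OF that] by (smt (verit) divide_right_mono fact_ge_zero)
  qed
  have eq: "G P (Suc i) x = (\<integral>z. max 0 (z - x) * G P i z \<partial>gmeas P)" if "0 \<le> x" for x
    unfolding G.simps using that nn ub' by (intro iterated_tail_integral) auto
  { case 1
    show ?case unfolding eq[OF 1]
      by (intro integral_nonneg_AE AE_gmeasI) (simp add: nn)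
  next
    case 2
    have ae: "AE z in gmeas P. 0 \<le> max 0 (z - x) * G P i z"
      by (intro AE_gmeasI) (simp add: nn)
    have "G P (Suc i) x = enn2real (\<integral>\<^sup>+z. ennreal (max 0 (z - x) * G P i z) \<partial>gmeas P)"
      unfolding eq[OF 2] using ae by (intro integral_eq_nn_integral) auto
    also have "\<dots> \<le> enn2real (\<integral>\<^sup>+z. ennreal (indicator {x..} z * z * (gtail z ^ i / fact i)) \<partial>gmeas P)"
    proof (intro enn2real_mono nn_integral_mono_AE)
      show "AE z in gmeas P. ennreal (max 0 (z - x) * G P i z) \<le> ennreal (indicator {x..} z * z * (gtail z ^ i / fact i))"
        using AE_gmeas_pos
      proof eventually_elim
        case (elim z)
        then show ?case
        proof (cases "x \<le> z")
          case True
          with elim 2 have "(z - x) * G P i z \<le> z * (gtail z ^ i / fact i)"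
            using nn[of z] ub[of z] by (intro mult_mono) auto
          then show ?thesis using True by (intro ennreal_leI) simp
        qed simp
      qed
    qed (use nn_integral_gtail_power[OF 2, of i] in simp)
    also have "\<dots> = gtail x ^ Suc i / fact (Suc i)"
      unfolding nn_integral_gtail_power[OF 2] using gtail_nonneg[OF 2]
      by (simp del: fact_Suc power_Suc)
    finally show ?case .
  }
qed auto

lemma G_le: assumes "0 \<le> x" shows "G P i x \<le> gbar ^ i / fact i"
proof -
  have "gtail x ^ i \<le> gbar ^ i"
    using assms gtail_antimono[of 0 x] gtail_nonneg[of x] by (intro power_mono) (auto simp: gtail_0)
  then show ?thesis using G_bounds(2)[OF assms, of i] by (smt (verit) divide_right_mono fact_ge_zero)
qed

lemma G_Suc_eq: "0 \<le> x \<Longrightarrow> G P (Suc i) x = (\<integral>z. max 0 (z - x) * G P i z \<partial>gmeas P)"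
  unfolding G.simps by (intro iterated_tail_integral[where C = "gbar ^ i / fact i"] G_bounds(1) G_le) auto

text \<open>In the parameter s = 1 / beta the largest zero in beta becomes the smallest positive
  zero in s, and s = 0, where the function is constantly 1, becomes available as a starting
  point.\<close>

definition lam :: "real \<Rightarrow> real \<Rightarrow> real" where "lam s x = (\<Sum>i. G P i x * (- s) ^ i)"

lemma L_eq_lam: "L P \<beta> x = lam (1 / \<beta>) x"
  by (simp add: L_def lam_def)

lemma lam_measurable [measurable]: "lam s \<in> borel_measurable borel"
  unfolding lam_def[abs_def] by measurable

lemma lam_term_bound: "0 \<le> x \<Longrightarrow> norm (G P i x * (- s) ^ i) \<le> (gbar * \<bar>s\<bar>) ^ i /\<^sub>R fact i"
  using G_bounds(1)[of x i] G_le[of x i] mult_right_mono[of "G P i x" "gbar ^ i / fact i" "\<bar>s\<bar> ^ i"]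
  by (simp add: abs_mult power_abs power_mult_distrib divide_inverse mult_ac)

lemma summable_lam: "0 \<le> x \<Longrightarrow> summable (\<lambda>i. G P i x * (- s) ^ i)"
  by (rule summable_comparison_test'[OF sums_summable[OF exp_converges[of "gbar * \<bar>s\<bar>"]]])
    (use lam_term_bound in auto)

lemma lam_bound: assumes "0 \<le> x" shows "\<bar>lam s x\<bar> \<le> exp (gbar * \<bar>s\<bar>)"
proof -
  note e = exp_converges[of "gbar * \<bar>s\<bar>"]
  have "\<bar>lam s x\<bar> \<le> (\<Sum>i. (gbar * \<bar>s\<bar>) ^ i /\<^sub>R fact i)"
    unfolding lam_def using norm_suminf_le[OF lam_term_bound sums_summable[OF e]] assms by simp
  then show ?thesis using sums_unique[OF e] by simp
qed

lemma lam_0: "lam 0 x = 1"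
  unfolding lam_def by (subst suminf_finite[of "{0}"]) auto

text \<open>The constant does not depend on x; this uniformity is what allows positivity to be
  propagated in s for all x at once in \<open>lam_nonneg\<close>.\<close>

lemma lam_Lipschitz:
  assumes x: "0 \<le> x" and R: "1 \<le> R" and s: "\<bar>s\<bar> \<le> R" "\<bar>t\<bar> \<le> R"
  shows "\<bar>lam s x - lam t x\<bar> \<le> exp (2 * gbar * R) * \<bar>s - t\<bar>"
proof -
  have pw: "\<bar>(- s) ^ i - (- t) ^ i\<bar> \<le> (2 * R) ^ i * \<bar>s - t\<bar>" for i
  proof -
    have "\<bar>(- s) ^ i - (- t) ^ i\<bar> \<le> real i * R ^ i * \<bar>s - t\<bar>"
    proof (induction i)
      case (Suc i)
      have "(- s) ^ Suc i - (- t) ^ Suc i = (- s) * ((- s) ^ i - (- t) ^ i) + (t - s) * (- t) ^ i"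
        by (simp add: algebra_simps)
      also have "\<bar>\<dots>\<bar> \<le> \<bar>s\<bar> * \<bar>(- s) ^ i - (- t) ^ i\<bar> + \<bar>s - t\<bar> * \<bar>t\<bar> ^ i"
        by (rule order_trans[OF abs_triangle_ineq]) (simp add: abs_mult power_abs abs_minus_commute)
      also have "\<dots> \<le> R * (real i * R ^ i * \<bar>s - t\<bar>) + \<bar>s - t\<bar> * R ^ i"
        using s R Suc by (intro add_mono mult_mono power_mono) auto
      \<comment> \<open>1 <= R raises R^i to R^(i+1), so both summands carry the same power.\<close>
      also have "\<dots> \<le> R * (real i * R ^ i * \<bar>s - t\<bar>) + \<bar>s - t\<bar> * (R * R ^ i)"
        using R mult_right_mono[of 1 R "R ^ i"] by (intro add_left_mono mult_left_mono) auto
      finally show ?case by (simp add: algebra_simps)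
    qed simp
    \<comment> \<open>i <= 2^i absorbs the polynomial factor into a geometric one, which the
      factorial in \<open>G_le\<close> dominates.\<close>
    also have "\<dots> \<le> 2 ^ i * R ^ i * \<bar>s - t\<bar>"
      using R of_nat_less_two_power[of i] by (intro mult_right_mono) (auto simp: less_imp_le)
    finally show ?thesis by (simp add: power_mult_distrib)
  qed
  have e: "(\<lambda>i. (gbar * (2 * R)) ^ i /\<^sub>R fact i * \<bar>s - t\<bar>) sums (exp (gbar * (2 * R)) * \<bar>s - t\<bar>)"
    by (rule sums_mult2[OF exp_converges])
  have "lam s x - lam t x = (\<Sum>i. G P i x * (- s) ^ i - G P i x * (- t) ^ i)"
    unfolding lam_def by (rule suminf_diff[OF summable_lam summable_lam]) (rule x)+
  also have "\<bar>\<dots>\<bar> \<le> (\<Sum>i. (gbar * (2 * R)) ^ i /\<^sub>R fact i * \<bar>s - t\<bar>)"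
  proof -
    have "norm (G P i x * (- s) ^ i - G P i x * (- t) ^ i) \<le> (gbar * (2 * R)) ^ i /\<^sub>R fact i * \<bar>s - t\<bar>" for i
    proof -
      have "norm (G P i x * (- s) ^ i - G P i x * (- t) ^ i) = G P i x * \<bar>(- s) ^ i - (- t) ^ i\<bar>"
        using G_bounds(1)[OF x] by (simp add: right_diff_distrib[symmetric] abs_mult)
      also have "\<dots> \<le> (gbar ^ i / fact i) * ((2 * R) ^ i * \<bar>s - t\<bar>)"
        using pw G_le[OF x] G_bounds(1)[OF x] gbar_nonneg by (intro mult_mono) auto
      finally show ?thesis by (simp add: power_mult_distrib divide_inverse mult_ac)
    qed
    from norm_suminf_le[OF this sums_summable[OF e]] show ?thesis by simp
  qed
  also have "\<dots> = exp (gbar * (2 * R)) * \<bar>s - t\<bar>" using sums_unique[OF e] ..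
  finally show ?thesis by (simp add: mult_ac)
qed

lemma integrable_gmeas_bounded:
  fixes h k :: "real \<Rightarrow> real"
  assumes [measurable]: "h \<in> borel_measurable borel" "k \<in> borel_measurable borel"
    and "\<And>z. 0 < z \<Longrightarrow> \<bar>h z\<bar> \<le> C" and "\<And>z. 0 < z \<Longrightarrow> \<bar>k z\<bar> \<le> D * (1 + z)"
  shows "integrable (gmeas P) (\<lambda>z. k z * h z)"
proof (rule Bochner_Integration.integrable_bound)
  show "integrable (gmeas P) (\<lambda>z. D * (1 + z) * C)"
    by (intro integrable_mult_right integrable_mult_left Bochner_Integration.integrable_add integrable_gmeas_id) simp
  show "AE z in gmeas P. norm (k z * h z) \<le> norm (D * (1 + z) * C)"
    using AE_gmeas_pos
  proof eventually_elim
    case (elim z)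
    have "\<bar>k z * h z\<bar> \<le> (D * (1 + z)) * C"
      unfolding abs_mult using assms(3,4)[OF elim] by (intro mult_mono) auto
    then show ?case by simp
  qed
qed measurable

text \<open>Term by term, integration against (z - x)^+ raises the index of G by one and the factor
  -s restores the power; the constant 1 is the term i = 0. Formally this is f'' = -s g2 f with f = 1
  at infinity, so that lam s 0 = 0 is a Dirichlet condition at 0.\<close>

lemma lam_integral_eq:
  assumes x: "0 \<le> x" shows "lam s x = 1 - s * (\<integral>z. max 0 (z - x) * lam s z \<partial>gmeas P)"
proof -
  define f where "f i z = max 0 (z - x) * (G P i z * (- s) ^ i)" for i z
  have [measurable]: "f i \<in> borel_measurable borel" for i unfolding f_def by measurable
  let ?b = "\<lambda>i. (gbar * \<bar>s\<bar>) ^ i /\<^sub>R fact i"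
  have fb: "AE z in gmeas P. norm (f i z) \<le> ?b i * z" for i
    using AE_gmeas_pos
  proof eventually_elim
    case (elim z)
    have "norm (f i z) = max 0 (z - x) * norm (G P i z * (- s) ^ i)"
      by (simp add: f_def abs_mult)
    also have "\<dots> \<le> z * ?b i" using elim x lam_term_bound[of z i s] by (intro mult_mono) auto
    finally show ?case by (simp add: mult.commute)
  qed
  have int: "integrable (gmeas P) (f i)" for i
  proof (rule Bochner_Integration.integrable_bound)
    show "integrable (gmeas P) (\<lambda>z. ?b i * z)" by (intro integrable_mult_right integrable_gmeas_id)
    show "AE z in gmeas P. norm (f i z) \<le> norm (?b i * z)" using fb[of i] by eventually_elim auto
  qed measurable
  have "(\<integral>z. (\<Sum>i. f i z) \<partial>gmeas P) = (\<Sum>i. (\<integral>z. f i z \<partial>gmeas P))"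
  proof (rule integral_suminf[OF int])
    show "AE z in gmeas P. summable (\<lambda>i. norm (f i z))"
      using AE_gmeas_pos
    proof eventually_elim
      case (elim z)
      have "summable (\<lambda>i. norm (G P i z * (- s) ^ i))"
        by (rule summable_comparison_test'[OF sums_summable[OF exp_converges[of "gbar * \<bar>s\<bar>"]]])
          (use elim lam_term_bound[of z] in auto)
      then have "summable (\<lambda>i. max 0 (z - x) * norm (G P i z * (- s) ^ i))" by (rule summable_mult)
      then show ?case by (simp add: f_def abs_mult)
    qed
    show "summable (\<lambda>i. \<integral>z. norm (f i z) \<partial>gmeas P)"
    proof (rule summable_comparison_test')
      show "summable (\<lambda>i. ?b i * gbar)" by (intro summable_mult2 sums_summable[OF exp_converges])
      have "(\<integral>z. norm (f i z) \<partial>gmeas P) \<le> (\<integral>z. ?b i * z \<partial>gmeas P)" for i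
        by (intro integral_mono_AE integrable_norm int integrable_mult_right integrable_gmeas_id fb)
      then show "norm (\<integral>z. norm (f i z) \<partial>gmeas P) \<le> ?b i * gbar" for i by (simp add: gbar_def)
    qed
  qed
  also have "(\<integral>z. (\<Sum>i. f i z) \<partial>gmeas P) = (\<integral>z. max 0 (z - x) * lam s z \<partial>gmeas P)"
  proof (intro integral_cong_AE)
    show "AE z in gmeas P. (\<Sum>i. f i z) = max 0 (z - x) * lam s z"
      using AE_gmeas_pos by eventually_elim (simp add: f_def lam_def suminf_mult summable_lam)
  qed measurable
  also have "(\<Sum>i. (\<integral>z. f i z \<partial>gmeas P)) = (\<Sum>i. G P (Suc i) x * (- s) ^ i)"
    using x by (simp add: f_def G_Suc_eq mult.assoc[symmetric] del: G.simps)
  finally have "- s * (\<integral>z. max 0 (z - x) * lam s z \<partial>gmeas P) = - s * (\<Sum>i. G P (Suc i) x * (- s) ^ i)" by simp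
  also have "\<dots> = (\<Sum>i. G P (Suc i) x * (- s) ^ Suc i)"
  \<comment> \<open>Summability of the shifted series is obtained from that of \<open>lam\<close> by
    dividing by -s.\<close>
  proof (cases "s = 0")
    case False
    then have "summable (\<lambda>i. G P (Suc i) x * (- s) ^ Suc i * (1 / (- s)))"
      using summable_lam[OF x, of s] by (intro summable_mult2) (subst summable_Suc_iff)
    then have "summable (\<lambda>i. G P (Suc i) x * (- s) ^ i)" using False by (simp del: G.simps)
    from suminf_mult[OF this, of "- s"] show ?thesis by (simp add: mult_ac del: G.simps)
  qed simp
  also have "\<dots> = lam s x - 1"
    unfolding lam_def using summable_lam[OF x, of s] by (subst suminf_split_head) auto
  finally show ?thesis by simp
qed

lemma integrable_lam: "0 \<le> x \<Longrightarrow> integrable (gmeas P) (\<lambda>z. min x z * lam s z)"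
  "0 \<le> x \<Longrightarrow> integrable (gmeas P) (\<lambda>z. max 0 (z - x) * lam s z)"
  by (rule integrable_gmeas_bounded[of _ _ "exp (gbar * \<bar>s\<bar>)" 1]; use lam_bound in \<open>auto\<close>)+

text \<open>For z > 0 one has z = (z - x)^+ + min x z; compare the Volterra equations at x and at 0.
  If lam s 0 = 0, this is the eigenvalue equation with eigenvalue 1 / s.\<close>

lemma lam_eq_min:
  assumes x: "0 \<le> x" shows "lam s x = lam s 0 + s * (\<integral>z. min x z * lam s z \<partial>gmeas P)"
proof -
  have "(\<integral>z. max 0 (z - 0) * lam s z \<partial>gmeas P) =
    (\<integral>z. max 0 (z - x) * lam s z + min x z * lam s z \<partial>gmeas P)"
  proof (intro integral_cong_AE)
    show "AE z in gmeas P. max 0 (z - 0) * lam s z = max 0 (z - x) * lam s z + min x z * lam s z"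
      using AE_gmeas_pos by eventually_elim (auto simp: max_def min_def algebra_simps)
  qed measurable
  also have "\<dots> = (\<integral>z. max 0 (z - x) * lam s z \<partial>gmeas P) + (\<integral>z. min x z * lam s z \<partial>gmeas P)"
    by (intro Bochner_Integration.integral_add integrable_lam x)
  finally show ?thesis
    using lam_integral_eq[OF x, of s] lam_integral_eq[of 0 s] by (simp add: algebra_simps)
qed

end

section \<open>The principal eigenfunction\<close>

text \<open>The probability that a cost with law \<open>unif x\<close> is below \<open>z > 0\<close>, see \<open>emeasure_unif_keep_prob\<close>;
  \<open>decay\<close> is its order of magnitude in \<open>x\<close>.\<close>

definition keep_prob :: "real \<Rightarrow> real \<Rightarrow> real" where
  "keep_prob x z = (if 0 < x then min 1 (z / x) else 1)"

definition decay :: "real \<Rightarrow> real" where "decay x = 1 / max 1 x"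

lemma decay_bounds: "0 < decay x" "decay x \<le> 1"
  by (auto simp: decay_def max_def)

text \<open>This bound and the next separate the variables: x enters through \<open>decay x\<close>
  alone. The lower bound is the source of the minorization, the upper bound of all growth
  control.\<close>

lemma keep_prob_lower: "0 < z \<Longrightarrow> decay x * min 1 z \<le> keep_prob x z"
  by (auto simp: keep_prob_def decay_def min_def max_def field_simps intro: order_trans mult_mono)

lemma keep_prob_upper: "0 < z \<Longrightarrow> keep_prob x z \<le> decay x * max 1 z"
  by (auto simp: keep_prob_def decay_def min_def max_def field_simps)

lemma keep_prob_bounds: "0 < z \<Longrightarrow> 0 < keep_prob x z" "keep_prob x z \<le> 1"
  by (auto simp: keep_prob_def)

lemma keep_prob_measurable [measurable (raw)]:
  assumes [measurable]: "f \<in> borel_measurable M" "g \<in> borel_measurable M"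
  shows "(\<lambda>y. keep_prob (f y) (g y)) \<in> borel_measurable M"
  unfolding keep_prob_def by measurable

lemma keep_prob_mult: "0 < x \<Longrightarrow> x * keep_prob x z = min x z"
  by (auto simp: keep_prob_def min_def field_simps)

lemma decay_measurable [measurable]: "decay \<in> borel_measurable borel"
  unfolding decay_def[abs_def] by measurable

context ewt_params begin

section \<open>Positivity up to the first zero\<close>

lemma lam_mono:
  assumes "0 \<le> s" "\<And>z. 0 \<le> z \<Longrightarrow> 0 \<le> lam s z" "0 \<le> x" "x \<le> y"
  shows "lam s x \<le> lam s y"
proof -
  have "(\<integral>z. min x z * lam s z \<partial>gmeas P) \<le> (\<integral>z. min y z * lam s z \<partial>gmeas P)"
    using assms by (intro integral_mono_AE integrable_lam AE_gmeasI mult_right_mono) auto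
  then show ?thesis
    using assms lam_eq_min[of x s] lam_eq_min[of y s] mult_left_mono by fastforce
qed

lemma continuous_on_lam:
  assumes "0 \<le> x" shows "continuous_on A (\<lambda>s. lam s x)"
proof -
  have "isCont (\<lambda>s. lam s x) t" for t
  proof -
    define R where "R = \<bar>t\<bar> + 1"
    have "(exp (2 * gbar * R))-lipschitz_on {-R..R} (\<lambda>s. lam s x)"
      using lam_Lipschitz[OF assms, of R] by (intro lipschitz_onI) (auto simp: R_def dist_real_def)
    from lipschitz_on_continuous_on[OF this] show ?thesis
      by (rule continuous_on_interior) (auto simp: R_def)
  qed
  then show ?thesis by (intro continuous_at_imp_continuous_on) auto
qed

text \<open>As long as \<open>lam s 0\<close> stays positive it bounds \<open>lam s\<close> from below, and the Lipschitz
  dependence on \<open>s\<close> propagates nonnegativity by steps of fixed length.\<close>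

lemma lam_nonneg:
  assumes S: "0 \<le> S" and pos: "\<And>s. 0 \<le> s \<Longrightarrow> s \<le> S \<Longrightarrow> 0 < lam s 0" and x: "0 \<le> x"
  shows "0 \<le> lam S x"
proof -
  define C where "C = exp (2 * gbar * max 1 S)"
  have C: "C > 0" by (simp add: C_def)
  obtain s\<^sub>1 where s1: "s\<^sub>1 \<in> {0..S}" "\<And>s. s \<in> {0..S} \<Longrightarrow> lam s\<^sub>1 0 \<le> lam s 0"
    using continuous_attains_inf[OF _ _ continuous_on_lam[of 0 "{0..S}"]] S by auto
  \<comment> \<open>Over a step of length d the function moves by at most C * d, which is the
    minimum of lam s 0 over [0, S]. By monotonicity in x this minimum bounds lam s' x from below at
    the start of the step, so the end value is still nonnegative.\<close>
  define d where "d = lam s\<^sub>1 0 / C"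
  have d: "d > 0" using pos s1 C by (auto simp: d_def)
  have step: "\<forall>s\<in>{0..S}. s \<le> real n * d \<longrightarrow> (\<forall>x\<ge>0. 0 \<le> lam s x)" for n
  proof (induction n)
    case 0
    show ?case
    proof (intro ballI impI allI)
      fix s x :: real assume "s \<in> {0..S}" "s \<le> real 0 * d"
      then have "s = 0" by auto
      then show "0 \<le> lam s x" by (simp add: lam_0)
    qed
  next
    case (Suc n)
    show ?case
    proof (intro ballI impI allI)
      fix s x :: real assume s: "s \<in> {0..S}" "s \<le> real (Suc n) * d" and x: "0 \<le> x"
      define s' where "s' = max 0 (s - d)"
      have s': "s' \<in> {0..S}" "s' \<le> real n * d" "\<bar>s - s'\<bar> \<le> d"
        using s d by (auto simp: s'_def algebra_simps)
      have "lam s\<^sub>1 0 \<le> lam s' 0" using s1 s' by auto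
      also have "\<dots> \<le> lam s' x"
        using s' Suc x by (intro lam_mono) auto
      also have "lam s' x - lam s x \<le> C * d"
      proof -
        have "\<bar>lam s x - lam s' x\<bar> \<le> C * \<bar>s - s'\<bar>"
          unfolding C_def using s s' x by (intro lam_Lipschitz) auto
        also have "\<dots> \<le> C * d" using s' C by (intro mult_left_mono) auto
        finally show ?thesis by auto
      qed
      finally show "0 \<le> lam s x" using C by (simp add: d_def)
    qed
  qed
  obtain n where "S \<le> real n * d" using reals_Archimedean3[OF d] less_imp_le by blast
  with step[of n] S x show ?thesis by auto
qed

lemma gmeas_tail_pos: "0 < measure (gmeas P) {1..}"
proof (rule ccontr)
  assume "\<not> ?thesis"
  then have "measure (gmeas P) {1..} = 0" by (simp add: not_less order_antisym)
  then have "emeasure (gmeas P) {1..} = 0" by (simp add: gmeas.emeasure_eq_measure)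
  then have "AE z in gmeas P. indicat_real {1..} z = 0"
    by (intro AE_I[of _ _ "{1..}"]) (auto simp: indicator_def)
  then have "AE z in lborel. (0::real) < z \<longrightarrow> indicat_real {1..} z = 0"
    by (rule gmeas_positive[rotated]) measurable
  then have "AE z in lborel. z \<notin> {1..2::real}" by eventually_elim auto
  then have "{1..2::real} \<in> null_sets lborel" by (subst AE_iff_null_sets) auto
  then show False by (auto simp: null_sets_def)
qed

text \<open>Without a zero, lam s stays positive at 0 and is increasing in x for all s. The equation
  at x = 1, with only the mass c of [1, infinity) kept, then gives s * c * lam s 1 <= lam s 1, which
  bounds s.\<close>

lemma lam_zero_exists: "\<exists>s>0. lam s 0 = 0"
proof (rule ccontr)
  assume *: "\<not> ?thesis"
  have pos: "0 < lam s 0" if "0 \<le> s" for s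
  proof (rule ccontr)
    assume "\<not> ?thesis"
    then have "\<exists>t\<ge>0. t \<le> s \<and> lam t 0 = 0"
      using that by (intro IVT2' continuous_on_lam) (auto simp: lam_0)
    with * lam_0 show False by (metis less_eq_real_def zero_neq_one)
  qed
  have nn: "0 \<le> lam s x" if "0 \<le> s" "0 \<le> x" for s x
    using that by (intro lam_nonneg pos) auto
  let ?c = "measure (gmeas P) {1..}"
  have "s * ?c \<le> 1" if "0 < s" for s
  proof -
    have "?c * lam s 1 = (\<integral>z. indicator {1..} z * lam s 1 \<partial>gmeas P)" by simp
    also have "\<dots> \<le> (\<integral>z. min 1 z * lam s z \<partial>gmeas P)"
    proof (rule integral_mono_AE)
      show "AE z in gmeas P. indicator {1..} z * lam s 1 \<le> min 1 z * lam s z"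
        using that nn by (intro AE_gmeasI) (auto simp: indicator_def min_def intro!: lam_mono)
      show "integrable (gmeas P) (\<lambda>z. indicator {1..} z * lam s 1)"
        by (intro integrable_mult_left) (simp add: gmeas.emeasure_eq_measure)
    qed (simp add: integrable_lam)
    finally have "s * (?c * lam s 1) \<le> s * (\<integral>z. min 1 z * lam s z \<partial>gmeas P)"
      using that by (intro mult_left_mono) auto
    also have "\<dots> \<le> lam s 1" using lam_eq_min[of 1 s] pos[of s] that by simp
    finally have "(s * ?c) * lam s 1 \<le> 1 * lam s 1" by simp
    moreover have "0 < lam s 1"
      using pos[of s] lam_mono[of s 0 1] nn that by (meson less_eq_real_def less_le_trans zero_le_one)
    ultimately show ?thesis by simp
  qed
  \<comment> \<open>At this s the bound reads 2 <= 1.\<close>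
  from this[of "2 / ?c"] gmeas_tail_pos show False by simp
qed

text \<open>The zeros in an interval [0, s1] form a compact set. The value 1 at s = 0 keeps its
  least element positive and, by the intermediate value theorem, fixes the sign before it.\<close>

lemma least_zero: "\<exists>s\<^sub>0>0. lam s\<^sub>0 0 = 0 \<and> (\<forall>s. 0 \<le> s \<longrightarrow> s < s\<^sub>0 \<longrightarrow> 0 < lam s 0)"
proof -
  obtain s1 where s1: "s1 > 0" "lam s1 0 = 0" using lam_zero_exists by auto
  define K where "K = {s \<in> {0..s1}. lam s 0 = 0}"
  have "closed K" unfolding K_def
    by (rule continuous_closed_preimage_constant) (auto intro: continuous_on_lam)
  moreover have "bounded K" by (rule bounded_subset[OF bounded_closed_interval[of 0 s1]]) (auto simp: K_def)
  ultimately have "compact K" by (simp add: compact_eq_bounded_closed)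
  moreover have "K \<noteq> {}" using s1 by (auto simp: K_def)
  ultimately obtain s0 where s0: "s0 \<in> K" "\<And>s. s \<in> K \<Longrightarrow> s0 \<le> s"
    using compact_attains_inf[of K] by auto
  have p: "s0 > 0" using s0 lam_0[of 0] by (cases "s0 = 0") (auto simp: K_def)
  have "0 < lam s 0" if "0 \<le> s" "s < s0" for s
  proof (rule ccontr)
    assume "\<not> ?thesis"
    then have "\<exists>t\<ge>0. t \<le> s \<and> lam t 0 = 0"
      using that by (intro IVT2' continuous_on_lam) (auto simp: lam_0)
    then obtain t where "0 \<le> t" "t \<le> s" "lam t 0 = 0" by auto
    with s0 that show False by (force simp: K_def)
  qed
  with p s0 show ?thesis by (auto simp: K_def)
qed

text \<open>s \<mapsto> 1 / s reverses the order, so the least zero shows that the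
  \<open>GREATEST\<close> in \<open>beta0\<close> is attained.\<close>

lemma beta0_least: "0 < beta0 P \<and> lam (1 / beta0 P) 0 = 0 \<and> (\<forall>s. 0 \<le> s \<longrightarrow> s < 1 / beta0 P \<longrightarrow> 0 < lam s 0)"
proof -
  obtain s0 where s0: "s0 > 0" "lam s0 0 = 0" "\<And>s. 0 \<le> s \<Longrightarrow> s < s0 \<Longrightarrow> 0 < lam s 0"
    using least_zero by auto
  have "beta0 P = 1 / s0"
    unfolding beta0_def L_eq_lam
  proof (rule Greatest_equality)
    fix y :: real assume y: "0 < y \<and> lam (1 / y) 0 = 0"
    then have "\<not> 1 / y < s0" using s0(3)[of "1 / y"] by auto
    then show "y \<le> 1 / s0" using y s0 by (auto simp: field_simps not_less)
  qed (use s0 in auto)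
  then show ?thesis using s0 by auto
qed

section \<open>The eigenfunction at the largest eigenvalue\<close>

abbreviation "\<beta> \<equiv> beta0 P"

lemma beta_pos: "0 < \<beta>" using beta0_least by simp

definition eigf :: "real \<Rightarrow> real" where "eigf = lam (1 / \<beta>)"

lemma eigf_measurable [measurable]: "eigf \<in> borel_measurable borel"
  unfolding eigf_def by simp

text \<open>At s = 1 / beta itself lam s 0 vanishes and \<open>lam_nonneg\<close> does not apply;
  the inequality is carried over as a limit from the left.\<close>

lemma eigf_nonneg: assumes x: "0 \<le> x" shows "0 \<le> eigf x"
proof -
  have "((\<lambda>s. lam s x) \<longlongrightarrow> lam (1 / \<beta>) x) (at_left (1 / \<beta>))"
  proof (rule tendsto_within_subset[OF _ subset_UNIV])
    show "((\<lambda>s. lam s x) \<longlongrightarrow> lam (1 / \<beta>) x) (at (1 / \<beta>))"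
      using continuous_on_lam[OF x, of UNIV] by (simp add: continuous_on_def)
  qed
  moreover have "\<forall>\<^sub>F s in at_left (1 / \<beta>). 0 \<le> lam s x"
  proof (rule eventually_at_leftI[of 0])
    show "0 \<le> lam s x" if "s \<in> {0<..<1 / \<beta>}" for s
      using that beta0_least x by (intro lam_nonneg) auto
  qed (use beta_pos in simp)
  ultimately show ?thesis
    unfolding eigf_def by (rule tendsto_lowerbound) simp
qed

lemma eigf_le_1: assumes x: "0 \<le> x" shows "eigf x \<le> 1"
proof -
  have "0 \<le> (\<integral>z. max 0 (z - x) * eigf z \<partial>gmeas P)"
    by (intro integral_nonneg_AE AE_gmeasI) (simp add: eigf_nonneg)
  then show ?thesis
    using lam_integral_eq[OF x, of "1 / \<beta>"] beta_pos unfolding eigf_def by simp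
qed

lemma eigf_eq: "0 \<le> x \<Longrightarrow> eigf x = 1 / \<beta> * (\<integral>z. min x z * eigf z \<partial>gmeas P)"
  unfolding eigf_def by (subst lam_eq_min) (use beta0_least in auto)

text \<open>If it were null, the Volterra equation at 0 would give the value 1 there instead of
  0.\<close>

lemma eigf_not_null: "\<not> (AE z in gmeas P. eigf z = 0)"
proof
  assume "AE z in gmeas P. eigf z = 0"
  then have "(\<integral>z. max 0 (z - 0) * eigf z \<partial>gmeas P) = (\<integral>z. 0 \<partial>gmeas P)"
    by (intro integral_cong_AE) auto
  then show False
    using lam_integral_eq[of 0 "1 / \<beta>"] beta0_least unfolding eigf_def by simp
qed

lemma integral_pos_eigf:
  fixes h :: "real \<Rightarrow> real"
  assumes [measurable]: "h \<in> borel_measurable borel" and i: "integrable (gmeas P) h"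
    and nn: "\<And>z. 0 < z \<Longrightarrow> 0 \<le> h z" and z: "\<And>z. 0 < z \<Longrightarrow> h z = 0 \<Longrightarrow> eigf z = 0"
  shows "0 < (\<integral>z. h z \<partial>gmeas P)"
proof -
  have ae: "AE z in gmeas P. 0 \<le> h z" by (intro AE_gmeasI nn)
  have "(\<integral>z. h z \<partial>gmeas P) \<noteq> 0"
  proof
    assume "(\<integral>z. h z \<partial>gmeas P) = 0"
    then have "AE z in gmeas P. h z = 0" using integral_nonneg_eq_0_iff_AE[OF i ae] by simp
    then have "AE z in gmeas P. eigf z = 0" using AE_gmeas_pos by eventually_elim (rule z)
    with eigf_not_null show False ..
  qed
  moreover have "0 \<le> (\<integral>z. h z \<partial>gmeas P)" by (rule integral_nonneg_AE[OF ae])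
  ultimately show ?thesis by simp
qed

definition eigf_sq :: real where "eigf_sq = (\<integral>z. (eigf z)\<^sup>2 \<partial>gmeas P)"

lemma integrable_eigf_sq: "integrable (gmeas P) (\<lambda>z. (eigf z)\<^sup>2)"
  unfolding power2_eq_square
proof (rule integrable_gmeas_bounded[of _ _ 1 1])
  show "\<bar>eigf z\<bar> \<le> 1" "\<bar>eigf z\<bar> \<le> 1 * (1 + z)" if "0 < z" for z
    using that eigf_nonneg[of z] eigf_le_1[of z] by auto
qed measurable

lemma eigf_sq_pos: "0 < eigf_sq"
  unfolding eigf_sq_def by (intro integral_pos_eigf integrable_eigf_sq) auto

lemma f0_eq: "f0 P x = eigf x / sqrt eigf_sq"
  unfolding f0_def eigf_sq_def by (subst integral_gmeas) (simp_all add: eigf_def L_eq_lam)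

lemma f0_measurable [measurable]: "f0 P \<in> borel_measurable borel"
  unfolding f0_eq[abs_def] by measurable

lemma f0_nonneg: "0 \<le> x \<Longrightarrow> 0 \<le> f0 P x"
  using eigf_nonneg eigf_sq_pos by (simp add: f0_eq)

definition F0 :: real where "F0 = 1 / sqrt eigf_sq"

lemma F0_pos: "0 < F0" using eigf_sq_pos by (simp add: F0_def)

lemma f0_le: "0 \<le> x \<Longrightarrow> f0 P x \<le> F0"
  using eigf_le_1[of x] eigf_sq_pos by (simp add: f0_eq F0_def divide_right_mono)

lemma f0_int_eq: "0 \<le> x \<Longrightarrow> f0 P x = 1 / \<beta> * (\<integral>z. min x z * f0 P z \<partial>gmeas P)"
  unfolding f0_eq by (subst eigf_eq) simp_all

lemma f0_sq: "(\<integral>z. (f0 P z)\<^sup>2 \<partial>gmeas P) = 1"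
  using eigf_sq_pos by (simp add: f0_eq power_divide eigf_sq_def[symmetric])

lemma integrable_f0:
  assumes [measurable]: "k \<in> borel_measurable borel" and "\<And>z. 0 < z \<Longrightarrow> \<bar>k z\<bar> \<le> D * (1 + z)"
  shows "integrable (gmeas P) (\<lambda>z. k z * f0 P z)"
  by (rule integrable_gmeas_bounded[of _ _ F0 D]) (use assms f0_nonneg f0_le in auto)

lemma f0_min_pos: "0 < (\<integral>z. min 1 z * f0 P z \<partial>gmeas P)"
proof (rule integral_pos_eigf)
  show "integrable (gmeas P) (\<lambda>z. min 1 z * f0 P z)"
    by (rule integrable_f0[of _ 1]) auto
  show "eigf z = 0" if "0 < z" "min 1 z * f0 P z = 0" for z
    using that eigf_sq_pos by (auto simp: f0_eq min_def split: if_splits)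
qed (auto simp: f0_nonneg)

text \<open>\<open>f\<^sub>0(x) / x\<close>, extended continuously to \<open>x = 0\<close>.\<close>

definition ut :: "real \<Rightarrow> real" where "ut x = 1 / \<beta> * (\<integral>z. keep_prob x z * f0 P z \<partial>gmeas P)"

lemma integrable_keep_prob_f0: "integrable (gmeas P) (\<lambda>z. keep_prob x z * f0 P z)"
proof (rule integrable_f0)
  show "\<bar>keep_prob x z\<bar> \<le> 1 * (1 + z)" if "0 < z" for z
    using that keep_prob_bounds[of z x] keep_prob_bounds(2)[of x z] by auto
qed measurable

lemma ut_measurable [measurable]: "ut \<in> borel_measurable borel"
  unfolding ut_def[abs_def]
  by (intro borel_measurable_times borel_measurable_const gmeas.borel_measurable_lebesgue_integral) measurable

lemma mult_ut: assumes "0 < x" shows "x * ut x = f0 P x"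
proof -
  have "x * ut x = 1 / \<beta> * (\<integral>z. x * (keep_prob x z * f0 P z) \<partial>gmeas P)" by (simp add: ut_def)
  then show ?thesis
    using assms by (simp add: f0_int_eq mult.assoc[symmetric] keep_prob_mult)
qed

text \<open>Integrate the separated bounds of \<open>keep_prob\<close> against \<open>f0\<close>.
  Together with \<open>ut_upper\<close> this makes \<open>ut\<close> comparable with
  \<open>decay\<close>, that is, f0(x) = x * ut x comparable with min 1 x.\<close>

lemma ut_lower: "\<exists>c>0. \<forall>x. c * decay x \<le> ut x"
proof (intro exI conjI allI)
  let ?I = "\<integral>z. min 1 z * f0 P z \<partial>gmeas P"
  show "0 < 1 / \<beta> * ?I" using f0_min_pos beta_pos by simp
  fix x
  have "decay x * ?I = (\<integral>z. (decay x * min 1 z) * f0 P z \<partial>gmeas P)" by (simp add: mult.assoc)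
  also have "\<dots> \<le> (\<integral>z. keep_prob x z * f0 P z \<partial>gmeas P)"
  proof (intro integral_mono_AE integrable_keep_prob_f0 AE_gmeasI mult_right_mono keep_prob_lower f0_nonneg)
    show "integrable (gmeas P) (\<lambda>z. decay x * min 1 z * f0 P z)"
      by (rule integrable_f0[of _ "decay x"]) (use decay_bounds[of x] in \<open>auto simp: abs_mult\<close>)
  qed auto
  finally show "1 / \<beta> * ?I * decay x \<le> ut x"
    using beta_pos by (simp add: ut_def field_simps)
qed

lemma ut_upper: "\<exists>c>0. \<forall>x. ut x \<le> c * decay x"
proof (intro exI conjI allI)
  let ?I = "\<integral>z. max 1 z * f0 P z \<partial>gmeas P"
  have i: "integrable (gmeas P) (\<lambda>z. max 1 z * f0 P z)"
    by (rule integrable_f0[of _ 1]) auto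
  have "(\<integral>z. min 1 z * f0 P z \<partial>gmeas P) \<le> ?I"
    by (intro integral_mono_AE i AE_gmeasI mult_right_mono f0_nonneg integrable_f0[of _ 1]) auto
  with f0_min_pos show "0 < 1 / \<beta> * ?I" using beta_pos by simp
  fix x
  have "(\<integral>z. keep_prob x z * f0 P z \<partial>gmeas P) \<le> (\<integral>z. decay x * (max 1 z * f0 P z) \<partial>gmeas P)"
  proof (intro integral_mono_AE integrable_keep_prob_f0 AE_gmeasI)
    show "keep_prob x z * f0 P z \<le> decay x * (max 1 z * f0 P z)" if "0 < z" for z
      using mult_right_mono[OF keep_prob_upper[OF that, of x] f0_nonneg[of z]] that by (simp add: mult.assoc)
  qed (use i in auto)
  then show "ut x \<le> 1 / \<beta> * ?I * decay x"
    using beta_pos by (simp add: ut_def field_simps)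
qed

lemma gmeas_near_0: assumes "0 \<le> y" shows "measure (gmeas P) {..y} \<le> y"
proof -
  have "emeasure (gmeas P) {..y} = (\<integral>\<^sup>+z. indicator {..y} z \<partial>gmeas P)" by simp
  also have "\<dots> = (\<integral>\<^sup>+z. ennreal (indicator {0..} z * g2 P z) * indicator {..y} z \<partial>lborel)"
    by (rule nn_integral_gmeas) simp
  also have "\<dots> \<le> (\<integral>\<^sup>+z. indicator {0..y} z \<partial>lborel)"
    by (intro nn_integral_mono) (auto simp: indicator_def g2_le_1 ennreal_le_1)
  also have "\<dots> = ennreal y" using assms by simp
  finally show ?thesis using assms by (simp add: gmeas.emeasure_eq_measure)
qed

text \<open>The kernels at 0 and at y differ only for z < y, a set of measure at most y since the
  density is at most 1.\<close>

lemma ut_near_0: assumes y: "0 < y" shows "\<bar>ut y - ut 0\<bar> \<le> 1 / \<beta> * F0 * y"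
proof -
  have "ut 0 - ut y = 1 / \<beta> * (\<integral>z. keep_prob 0 z * f0 P z - keep_prob y z * f0 P z \<partial>gmeas P)"
    unfolding ut_def
    by (subst Bochner_Integration.integral_diff[OF integrable_keep_prob_f0 integrable_keep_prob_f0]) (simp add: algebra_simps)
  also have "\<bar>\<dots>\<bar> \<le> 1 / \<beta> * (\<integral>z. F0 * indicator {..y} z \<partial>gmeas P)"
  proof -
    have "norm (\<integral>z. keep_prob 0 z * f0 P z - keep_prob y z * f0 P z \<partial>gmeas P) \<le> (\<integral>z. F0 * indicator {..y} z \<partial>gmeas P)"
    proof (rule order_trans[OF integral_norm_bound integral_mono_AE])
      show "AE z in gmeas P. norm (keep_prob 0 z * f0 P z - keep_prob y z * f0 P z) \<le> F0 * indicator {..y} z"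
      proof (rule AE_gmeasI)
        fix z :: real assume z: "0 < z"
        have "keep_prob 0 z * f0 P z - keep_prob y z * f0 P z = (1 - keep_prob y z) * f0 P z"
          by (simp add: keep_prob_def algebra_simps)
        moreover have "0 \<le> 1 - keep_prob y z" "1 - keep_prob y z \<le> indicator {..y} z"
          using z y by (auto simp: keep_prob_def indicator_def min_def field_simps)
        moreover from this have "(1 - keep_prob y z) * f0 P z \<le> indicator {..y} z * F0"
          using z f0_nonneg f0_le by (intro mult_mono) auto
        ultimately show "norm (keep_prob 0 z * f0 P z - keep_prob y z * f0 P z) \<le> F0 * indicator {..y} z"
          using f0_nonneg[of z] z by (simp add: mult.commute)
      qed
      show "integrable (gmeas P) (\<lambda>z. F0 * indicator {..y} z)"
        by (intro integrable_mult_right) (simp add: gmeas.emeasure_eq_measure)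
    qed (intro integrable_norm Bochner_Integration.integrable_diff integrable_keep_prob_f0)
    then show ?thesis using beta_pos by (simp add: abs_mult divide_right_mono)
  qed
  also have "\<dots> = 1 / \<beta> * F0 * measure (gmeas P) {..y}" by simp
  also have "\<dots> \<le> 1 / \<beta> * F0 * y"
    using gmeas_near_0[of y] y F0_pos beta_pos by (intro mult_left_mono) auto
  finally show ?thesis by (simp add: abs_minus_commute)
qed

text \<open>The point is x = 0: the \<open>Lim\<close> in \<open>mu\<close> has the value of
  \<open>ut\<close> there because \<open>ut\<close> approaches it at a linear rate.\<close>

lemma mu_eq: assumes "0 \<le> x" shows "mu P m x = real m * ut x"
proof (cases "x = 0")
  case True
  have "((\<lambda>y. real m / y * f0 P y) \<longlongrightarrow> real m * ut 0) (at_right 0)"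
  proof -
    have "(ut \<longlongrightarrow> ut 0) (at_right 0)"
    proof (rule LIM_zero_cancel, rule Lim_null_comparison)
      show "\<forall>\<^sub>F y in at_right 0. norm (ut y - ut 0) \<le> 1 / \<beta> * F0 * y"
        using ut_near_0 by (auto intro!: eventually_at_right_less[THEN eventually_mono])
      show "((\<lambda>y. 1 / \<beta> * F0 * y) \<longlongrightarrow> 0) (at_right 0)"
        using beta_pos by (auto intro!: tendsto_eq_intros)
    qed
    then have "((\<lambda>y. real m * ut y) \<longlongrightarrow> real m * ut 0) (at_right 0)"
      by (intro tendsto_mult tendsto_const)
    moreover have "\<forall>\<^sub>F y in at_right 0. real m * ut y = real m / y * f0 P y"
      using eventually_at_right_less[of 0]
      by eventually_elim (simp add: mult_ut[symmetric])
    ultimately show ?thesis by (auto dest: Lim_transform_eventually)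
  qed
  then show ?thesis
    using True tendsto_Lim[OF trivial_limit_at_right_real] by (simp add: mu_def)
next
  case False
  with assms show ?thesis by (simp add: mu_def mult_ut[symmetric])
qed

lemma AE_TLI: "(\<And>s. 0 < snd s \<Longrightarrow> Q s) \<Longrightarrow> AE s in TL. Q s"
  using AE_TL_pos by (rule eventually_mono)

lemma integral_TL_size_biased:
  fixes u :: "real \<Rightarrow> real"
  assumes [measurable]: "u \<in> borel_measurable borel" and nn: "\<And>z. 0 < z \<Longrightarrow> 0 \<le> u z"
  shows "(\<integral>s. real (fst s) * u (snd s) \<partial>TL) = (\<integral>z. z * u z \<partial>gmeas P)"
proof -
  have "(\<integral>s. real (fst s) * u (snd s) \<partial>TL) = enn2real (\<integral>\<^sup>+s. ennreal (real (fst s) * u (snd s)) \<partial>TL)"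
    by (intro integral_eq_nn_integral AE_TLI) (simp_all add: nn)
  also have "(\<integral>\<^sup>+s. ennreal (real (fst s) * u (snd s)) \<partial>TL) = (\<integral>\<^sup>+s. of_nat (fst s) * ennreal (u (snd s)) \<partial>TL)"
    by (intro nn_integral_cong_AE AE_TLI) (simp add: ennreal_mult nn ennreal_of_nat_eq_real_of_nat)
  also have "\<dots> = (\<integral>\<^sup>+z. ennreal z * ennreal (u z) \<partial>gmeas P)"
    by (rule nn_integral_TL_size_biased) measurable
  also have "\<dots> = (\<integral>\<^sup>+z. ennreal (z * u z) \<partial>gmeas P)"
    by (intro nn_integral_cong_AE AE_gmeasI) (auto simp: ennreal_mult nn)
  also have "enn2real \<dots> = (\<integral>z. z * u z \<partial>gmeas P)"
    by (intro integral_eq_nn_integral[symmetric] AE_gmeasI) (auto simp: nn)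
  finally show ?thesis .
qed

lemma ut_pos: "0 < ut x"
proof -
  obtain c where "c > 0" "c * decay x \<le> ut x" using ut_lower by auto
  then show ?thesis using decay_bounds(1)[of x] by (smt (verit) mult_pos_pos)
qed

text \<open>Size-biasing replaces the offspring number by z, and z * ut z = f0 z, so the integral
  becomes the one that defines \<open>ut\<close>. It says that mu is an eigenfunction of the passage
  to the children.\<close>

lemma ut_eigen: "(\<integral>s. keep_prob x (snd s) * (real (fst s) * ut (snd s)) \<partial>TL) = \<beta> * ut x"
proof -
  have "(\<integral>s. keep_prob x (snd s) * (real (fst s) * ut (snd s)) \<partial>TL)
      = (\<integral>s. real (fst s) * (keep_prob x (snd s) * ut (snd s)) \<partial>TL)"
    by (simp add: mult_ac)
  also have "\<dots> = (\<integral>z. z * (keep_prob x z * ut z) \<partial>gmeas P)"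
    using keep_prob_bounds ut_pos by (intro integral_TL_size_biased) (auto simp: less_imp_le)
  also have "\<dots> = (\<integral>z. keep_prob x z * f0 P z \<partial>gmeas P)"
    by (intro integral_cong_AE AE_gmeasI) (auto simp: mult_ut[symmetric])
  finally show ?thesis using beta_pos by (simp add: ut_def)
qed

text \<open>The L^2 normalisation of \<open>f0\<close>, read through size-biasing, is the
  normalisation of the left eigenfunctional on mu.\<close>

lemma ut_normalized: "(\<integral>s. (snd s * ut (snd s)) * (real (fst s) * ut (snd s)) \<partial>TL) = 1"
proof -
  have "(\<integral>s. (snd s * ut (snd s)) * (real (fst s) * ut (snd s)) \<partial>TL)
      = (\<integral>s. real (fst s) * (snd s * ut (snd s) * ut (snd s)) \<partial>TL)"
    by (simp add: mult_ac)
  also have "\<dots> = (\<integral>z. z * (z * ut z * ut z) \<partial>gmeas P)"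
    using ut_pos by (intro integral_TL_size_biased) (auto simp: less_imp_le)
  also have "\<dots> = (\<integral>z. (f0 P z)\<^sup>2 \<partial>gmeas P)"
    by (intro integral_cong_AE AE_gmeasI) (auto simp: mult_ut[symmetric] power2_eq_square)
  finally show ?thesis by (simp add: f0_sq)
qed

lemma sets_type_space: "A \<in> sets type_space \<longleftrightarrow> A \<in> sets borel \<and> A \<subseteq> UNIV \<times> {0..}"
proof -
  have "UNIV \<times> {0..} \<in> sets (borel :: ewt_type measure)"
    by (intro borel_closed closed_Times) auto
  then show ?thesis unfolding type_space_def by (subst sets_restrict_space_iff) auto
qed

text \<open>Relative to the type law, \<nu> has density f0(z) = z * ut z, so \<open>nubar\<close> is
  the left eigenfunctional evaluated at an indicator.\<close>

lemma nubar_eq: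
  assumes A: "A \<in> sets type_space"
  shows "nubar P A = (\<integral>s. (snd s * ut (snd s)) * indicator A s \<partial>TL)"
proof -
  have A' [measurable]: "A \<in> sets borel" and Ann: "\<And>j z. (j, z) \<in> A \<Longrightarrow> 0 \<le> z"
    using A by (auto simp: sets_type_space)
  have [measurable]: "{z. (j, z) \<in> A} \<in> sets borel" for j by measurable
  define h where "h j z = indicator A (j, z) * (erlang_density j 1 z * f0 P z)" for j z
  have [measurable]: "h j \<in> borel_measurable borel" for j unfolding h_def by measurable
  have h0: "0 \<le> h j z" for j z
    using Ann[of j z] f0_nonneg[of z] by (auto simp: h_def indicator_def)
  \<comment> \<open>Each Erlang density has mass one, so every inner integral is at most F0 and the
    series over j converges by comparison with the weights of P.\<close>
  have hF: "h j z \<le> F0 * erlang_density j 1 z" for j z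
  proof (cases "(j, z) \<in> A")
    case True
    then show ?thesis
      using mult_left_mono[OF f0_le[OF Ann[OF True]], of "erlang_density j 1 z"] by (simp add: h_def mult.commute)
  qed (use F0_pos in \<open>simp add: h_def\<close>)
  have nnF: "(\<integral>\<^sup>+z. ennreal (h j z) \<partial>lborel) \<le> ennreal F0" for j
  proof -
    have "(\<integral>\<^sup>+z. ennreal (h j z) \<partial>lborel) \<le> (\<integral>\<^sup>+z. ennreal F0 * ennreal (erlang_density j 1 z * z ^ 0) \<partial>lborel)"
      using hF F0_pos by (intro nn_integral_mono) (simp flip: ennreal_mult add: ennreal_leI)
    also have "\<dots> = ennreal F0"
      by (subst nn_integral_cmult, simp, subst nn_integral_erlang_ith_moment) simp_all
    finally show ?thesis .
  qed
  define a where "a j = (\<integral>z. h j z \<partial>lborel)" for j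
  have ih: "integrable lborel (h j)" for j
    using nnF[of j] h0 by (intro integrableI_nonneg) (auto simp: less_top[symmetric] top_unique)
  have a: "ennreal (a j) = (\<integral>\<^sup>+z. ennreal (h j z) \<partial>lborel)" for j
    unfolding a_def using h0 by (intro nn_integral_eq_integral[symmetric] ih) auto
  have a0: "0 \<le> a j" for j unfolding a_def using h0 by (intro integral_nonneg_AE) auto
  have aF: "a j \<le> F0" for j using nnF[of j] F0_pos by (simp flip: a)
  have sm: "summable (\<lambda>j. pmf P (j + 1) * a j)"
  proof (rule summable_comparison_test')
    have "integrable (count_space UNIV) (pmf P)" by (rule integrable_pmf)
    then have "summable (pmf P)"
      using integrable_count_space_nat_iff summable_norm_cancel by blast
    then have "summable (\<lambda>j. pmf P (Suc j))" by (subst summable_Suc_iff)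
    then show "summable (\<lambda>j. pmf P (j + 1) * F0)" by (intro summable_mult2) simp
    show "norm (pmf P (j + 1) * a j) \<le> pmf P (j + 1) * F0" for j
      using a0 aF by (simp add: mult_left_mono)
  qed
  have "(\<integral>s. (snd s * ut (snd s)) * indicator A s \<partial>TL)
      = enn2real (\<integral>\<^sup>+s. ennreal ((snd s * ut (snd s)) * indicator A s) \<partial>TL)"
    using ut_pos by (intro integral_eq_nn_integral AE_TLI) (simp_all add: less_imp_le)
  also have "(\<integral>\<^sup>+s. ennreal ((snd s * ut (snd s)) * indicator A s) \<partial>TL)
      = (\<Sum>j. ennreal (pmf P (j + 1)) * (\<integral>\<^sup>+z. ennreal (erlang_density j 1 z) * ennreal ((z * ut z) * indicator A (j, z)) \<partial>lborel))"
    by (subst nn_integral_TL) simp_all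
  also have "\<dots> = (\<Sum>j. ennreal (pmf P (j + 1) * a j))"
  proof (intro suminf_cong)
    fix j
    have "(\<integral>\<^sup>+z. ennreal (erlang_density j 1 z) * ennreal ((z * ut z) * indicator A (j, z)) \<partial>lborel)
      = (\<integral>\<^sup>+z. ennreal (h j z) \<partial>lborel)"
    proof (intro nn_integral_cong_AE)
      have "AE z in lborel. z \<noteq> (0::real)" by (rule AE_lborel_singleton)
      then show "AE z in lborel. ennreal (erlang_density j 1 z) * ennreal ((z * ut z) * indicator A (j, z)) = ennreal (h j z)"
      proof eventually_elim
        case (elim z)
        then have "0 < z \<or> z < 0" by auto
        then show ?case
          by (auto simp: h_def mult_ut indicator_def erlang_density_def f0_nonneg simp flip: ennreal_mult)
      qed
    qed
    then show "ennreal (pmf P (j + 1)) * (\<integral>\<^sup>+z. ennreal (erlang_density j 1 z) * ennreal ((z * ut z) * indicator A (j, z)) \<partial>lborel)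
      = ennreal (pmf P (j + 1) * a j)"
      by (simp add: a[symmetric] ennreal_mult a0)
  qed
  also have "\<dots> = ennreal (\<Sum>j. pmf P (j + 1) * a j)"
    by (intro suminf_ennreal2 sm) (simp add: a0)
  also have "enn2real \<dots> = (\<Sum>j. pmf P (j + 1) * a j)"
    by (intro enn2real_ennreal suminf_nonneg sm) (simp add: a0)
  also have "\<dots> = nubar P A"
    unfolding nubar_def a_def
  proof (intro suminf_cong)
    fix j
    have "pmf P (j + 1) * (\<integral>z. h j z \<partial>lborel) = (\<integral>z. pmf P (j + 1) * h j z \<partial>lborel)" by simp
    also have "\<dots> = (LINT z:{z. (j, z) \<in> A}|lborel. nu P j z)"
      unfolding set_lebesgue_integral_def
      by (intro Bochner_Integration.integral_cong) (auto simp: h_def nu_def indicator_def erlang_density_def dest: Ann)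
    finally show "pmf P (j + 1) * (\<integral>z. h j z \<partial>lborel) = (LINT z:{z. (j, z) \<in> A}|lborel. nu P j z)" .
  qed
  finally show ?thesis ..
qed

end

section \<open>Recursive structure of the tree\<close>

definition sub :: "nat \<Rightarrow> ewt_sample \<Rightarrow> ewt_sample" where
  "sub j \<omega> = (\<lambda>i. \<omega> (j # i))"

text \<open>The recursion peels off the edge at the root, in line with the independence of the
  subtrees; \<open>alive_snoc\<close> recovers the edge at the far end, which is the form of
  \<open>kept_edges\<close>.\<close>

fun alive :: "ewt_sample \<Rightarrow> nat list \<Rightarrow> bool" where
  "alive \<omega> [] \<longleftrightarrow> True"
| "alive \<omega> (j # i) \<longleftrightarrow> 1 \<le> j \<and> j \<le> fst (vtype \<omega> []) \<and> cost \<omega> [] j < snd (vtype \<omega> [j]) \<and> alive (sub j \<omega>) i"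

lemma vtype_sub: "vtype (sub j \<omega>) i = vtype \<omega> (j # i)"
  and cost_sub: "cost (sub j \<omega>) i = cost \<omega> (j # i)"
  by (simp_all add: sub_def vtype_def cost_def fun_eq_iff)

lemma alive_Nf: "alive \<omega> i \<Longrightarrow> i \<in> Nf"
  by (induction \<omega> i rule: alive.induct) (auto simp: Nf_def)

lemma alive_snoc: "alive \<omega> (i @ [k]) \<longleftrightarrow> alive \<omega> i \<and> (i, i @ [k]) \<in> kept_edges \<omega>"
proof -
  have "alive \<omega> (i @ [k]) \<longleftrightarrow> alive \<omega> i \<and> 1 \<le> k \<and> k \<le> fst (vtype \<omega> i) \<and> cost \<omega> i k < snd (vtype \<omega> (i @ [k]))"
    by (induction i arbitrary: \<omega>) (auto simp: vtype_sub cost_sub)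
  then show ?thesis using alive_Nf[of \<omega> i] by (auto simp: kept_edges_def)
qed

text \<open>A kept edge joins a word to a one-letter extension of it, so a step from an alive vertex
  either extends it or returns to its parent, which is alive too. Hence symmetrising the edges adds
  no vertices, and distance from the root is word length.\<close>

lemma alive_adj:
  assumes "alive \<omega> i" "(i, i') \<in> adj \<omega>" shows "alive \<omega> i'" "length i' \<le> Suc (length i)"
proof -
  have "(i, i') \<in> kept_edges \<omega> \<or> (i', i) \<in> kept_edges \<omega>" using assms by (auto simp: adj_def)
  then have "alive \<omega> i' \<and> length i' \<le> Suc (length i)"
  proof
    assume e: "(i, i') \<in> kept_edges \<omega>"
    then obtain j where "i' = i @ [j]" by (auto simp: kept_edges_def)
    with e assms show ?thesis by (simp add: alive_snoc)
  next
    assume e: "(i', i) \<in> kept_edges \<omega>"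
    then obtain j where "i = i' @ [j]" by (auto simp: kept_edges_def)
    with e assms show ?thesis by (simp add: alive_snoc)
  qed
  then show "alive \<omega> i'" "length i' \<le> Suc (length i)" by auto
qed

lemma relpow_adj_alive: "([], i) \<in> adj \<omega> ^^ l \<Longrightarrow> alive \<omega> i \<and> length i \<le> l"
proof (induction l arbitrary: i)
  case (Suc l)
  then obtain i' where "([], i') \<in> adj \<omega> ^^ l" "(i', i) \<in> adj \<omega>" by auto
  with Suc.IH[of i'] alive_adj[of \<omega> i' i] show ?case by auto
qed simp

lemma alive_relpow_adj: "alive \<omega> i \<Longrightarrow> ([], i) \<in> adj \<omega> ^^ length i"
proof (induction i rule: rev_induct)
  case (snoc k i)
  then have "alive \<omega> i" "(i, i @ [k]) \<in> kept_edges \<omega>" by (simp_all add: alive_snoc)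
  with snoc.IH show ?case by (auto simp: adj_def)
qed simp

lemma ewt_vertices_alive: "ewt_vertices \<omega> = {i. alive \<omega> i}"
  unfolding ewt_vertices_def
  using relpow_adj_alive alive_relpow_adj by (fastforce simp: rtrancl_power)

lemma root_dist_alive: "alive \<omega> i \<Longrightarrow> root_dist \<omega> i = length i"
  unfolding root_dist_def using relpow_adj_alive alive_relpow_adj by (intro Least_equality) auto

text \<open>Its l-th iterate sums F over the subtrees rooted at generation l. The codomain is left
  open: real values serve for moments, \<open>ennreal\<close> values for the mean measures.\<close>

definition gen_step :: "(ewt_sample \<Rightarrow> 'a :: comm_monoid_add) \<Rightarrow> ewt_sample \<Rightarrow> 'a" where
  "gen_step F \<omega> = (\<Sum>j = 1..fst (vtype \<omega> []).
     if cost \<omega> [] j < snd (vtype \<omega> [j]) then F (sub j \<omega>) else 0)"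

abbreviation gen_sum :: "nat \<Rightarrow> (ewt_sample \<Rightarrow> 'a :: comm_monoid_add) \<Rightarrow> ewt_sample \<Rightarrow> 'a" where
  "gen_sum l F \<equiv> (gen_step ^^ l) F"

lemma gen_sum_Suc: "gen_sum (Suc l) F = gen_step (gen_sum l F)"
  by simp

text \<open>The vertices of generation l + 1 are grouped by their first letter, each group being
  generation l of a subtree.\<close>

lemma Z_eq_gen_sum: "of_nat (Z l A \<omega>) = gen_sum l (\<lambda>\<omega>. if vtype \<omega> [] \<in> A then 1 else 0 :: 'a :: semiring_1) \<omega>"
proof -
  define S where "S l \<omega> = {i. alive \<omega> i \<and> length i = l \<and> vtype \<omega> i \<in> A}" for l \<omega>
  define J where "J \<omega> = {j \<in> {1..fst (vtype \<omega> [])}. cost \<omega> [] j < snd (vtype \<omega> [j])}" for \<omega>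
  have S_Suc: "S (Suc l) \<omega> = (\<Union>j\<in>J \<omega>. (#) j ` S l (sub j \<omega>))" for l \<omega>
    by (auto simp: S_def J_def length_Suc_conv vtype_sub image_iff)
  have fin: "finite (S l \<omega>)" for l \<omega>
  proof (induction l arbitrary: \<omega>)
    case 0
    have "S 0 \<omega> \<subseteq> {[]}" by (auto simp: S_def)
    then show ?case by (rule finite_subset) simp
  qed (auto simp: S_Suc J_def)
  have "of_nat (card (S l \<omega>)) = gen_sum l (\<lambda>\<omega>. if vtype \<omega> [] \<in> A then 1 else 0 :: 'a) \<omega>" for l \<omega>
  proof (induction l arbitrary: \<omega>)
    case 0
    have "S 0 \<omega> = (if vtype \<omega> [] \<in> A then {[]} else {})" by (auto simp: S_def)
    then show ?case by simp
  next
    case (Suc l)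
    have "card (S (Suc l) \<omega>) = (\<Sum>j\<in>J \<omega>. card ((#) j ` S l (sub j \<omega>)))"
      unfolding S_Suc by (intro card_UN_disjoint) (auto simp: fin J_def)
    also have "\<dots> = (\<Sum>j\<in>J \<omega>. card (S l (sub j \<omega>)))"
      by (intro sum.cong card_image refl) simp
    finally have "of_nat (card (S (Suc l) \<omega>)) = (\<Sum>j\<in>J \<omega>. of_nat (card (S l (sub j \<omega>))) :: 'a)" by simp
    also have "\<dots> = (\<Sum>j\<in>J \<omega>. gen_sum l (\<lambda>\<omega>. if vtype \<omega> [] \<in> A then 1 else 0) (sub j \<omega>))"
      using Suc by simp
    also have "\<dots> = gen_sum (Suc l) (\<lambda>\<omega>. if vtype \<omega> [] \<in> A then 1 else 0) \<omega>"
      unfolding J_def gen_sum_Suc gen_step_def by (rule sum.inter_filter) simp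
    finally show ?case .
  qed
  moreover have "{i \<in> ewt_vertices \<omega>. root_dist \<omega> i = l \<and> vtype \<omega> i \<in> A} = S l \<omega>"
    by (auto simp: S_def ewt_vertices_alive root_dist_alive)
  ultimately show ?thesis by (simp add: Z_def)
qed

section \<open>Measurability on the space of vertex families\<close>

abbreviation tree_space :: "ewt_sample measure" where
  "tree_space \<equiv> PiM Nf (\<lambda>_. node_space)"

lemma Nil_Nf [simp]: "[] \<in> Nf" and Cons_Nf [simp]: "j # i \<in> Nf \<longleftrightarrow> 1 \<le> j \<and> i \<in> Nf"
  by (auto simp: Nf_def)

lemma vtype_measurable [measurable]: "i \<in> Nf \<Longrightarrow> (\<lambda>\<omega>. vtype \<omega> i) \<in> tree_space \<rightarrow>\<^sub>M borel"
  unfolding vtype_def node_space_def by measurable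

lemma cost_measurable:
  "i \<in> Nf \<Longrightarrow> 1 \<le> j \<Longrightarrow> (\<lambda>\<omega>. cost \<omega> i j) \<in> borel_measurable tree_space"
  unfolding cost_def node_space_def by measurable

lemma sub_measurable: assumes "1 \<le> j" shows "sub j \<in> tree_space \<rightarrow>\<^sub>M tree_space"
proof -
  have "(\<lambda>\<omega>. \<lambda>i\<in>Nf. \<omega> (j # i)) \<in> tree_space \<rightarrow>\<^sub>M tree_space"
    using assms by (intro measurable_restrict measurable_component_singleton) auto
  moreover have "sub j \<omega> = (\<lambda>i\<in>Nf. \<omega> (j # i))" if "\<omega> \<in> space tree_space" for \<omega>
    using that by (auto simp: space_PiM sub_def PiE_def extensional_def restrict_def fun_eq_iff)
  ultimately show ?thesis by (subst measurable_cong)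
qed

text \<open>Measurability of finite sums enters as a hypothesis so that one proof serves for real
  and for \<open>ennreal\<close> values.\<close>

lemma gen_step_measurable_gen:
  fixes F :: "ewt_sample \<Rightarrow> 'a :: {second_countable_topology, comm_monoid_add, topological_monoid_add}"
  assumes F: "F \<in> borel_measurable tree_space"
    and sum: "\<And>f :: nat \<Rightarrow> ewt_sample \<Rightarrow> 'a. \<And>n. (\<And>j. f j \<in> borel_measurable tree_space) \<Longrightarrow>
       (\<lambda>\<omega>. \<Sum>j = 1..n. f j \<omega>) \<in> borel_measurable tree_space"
  shows "gen_step F \<in> borel_measurable tree_space"
proof -
  have 1: "(\<lambda>\<omega>. if cost \<omega> [] j < snd (vtype \<omega> [j]) then F (sub j \<omega>) else 0) \<in> borel_measurable tree_space"
    if j: "1 \<le> j" for j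
  proof -
    note [measurable] = cost_measurable[of "[]" j, OF _ j, simplified] measurable_compose[OF sub_measurable[OF j] F]
    have [measurable]: "(\<lambda>\<omega>. vtype \<omega> [j]) \<in> tree_space \<rightarrow>\<^sub>M borel" using j by (intro vtype_measurable) simp
    show ?thesis by measurable
  qed
  \<comment> \<open>The condition 1 <= j is put into the summand to make it measurable for every j;
    the random number of summands is then a countably valued measurable index.\<close>
  define f where "f j \<omega> = (if 1 \<le> j \<and> cost \<omega> [] j < snd (vtype \<omega> [j]) then F (sub j \<omega>) else 0)" for j \<omega>
  have 2: "f j \<in> borel_measurable tree_space" for j
    using 1[of j] unfolding f_def by (cases "1 \<le> j") simp_all
  have [measurable]: "(\<lambda>\<omega>. vtype \<omega> []) \<in> tree_space \<rightarrow>\<^sub>M borel" by (intro vtype_measurable) simp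
  have "(\<lambda>\<omega>. \<Sum>j = 1..fst (vtype \<omega> []). f j \<omega>) \<in> borel_measurable tree_space"
    by (rule measurable_compose_countable[OF sum[OF 2]]) measurable
  also have "(\<lambda>\<omega>. \<Sum>j = 1..fst (vtype \<omega> []). f j \<omega>) = gen_step F"
    unfolding gen_step_def f_def by (intro ext sum.cong) auto
  finally show ?thesis .
qed

lemma gen_step_measurable [measurable]:
  fixes F :: "ewt_sample \<Rightarrow> real"
  shows "F \<in> borel_measurable tree_space \<Longrightarrow> gen_step F \<in> borel_measurable tree_space"
  by (rule gen_step_measurable_gen) auto

lemma gen_step_measurable_ennreal [measurable]:
  fixes F :: "ewt_sample \<Rightarrow> ennreal"
  shows "F \<in> borel_measurable tree_space \<Longrightarrow> gen_step F \<in> borel_measurable tree_space"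
  by (rule gen_step_measurable_gen) auto

lemma gen_sum_measurable [measurable]:
  fixes F :: "ewt_sample \<Rightarrow> real"
  shows "F \<in> borel_measurable tree_space \<Longrightarrow> gen_sum l F \<in> borel_measurable tree_space"
  by (induction l) (simp_all add: gen_step_measurable)

lemma gen_sum_measurable_ennreal [measurable]:
  fixes F :: "ewt_sample \<Rightarrow> ennreal"
  shows "F \<in> borel_measurable tree_space \<Longrightarrow> gen_sum l F \<in> borel_measurable tree_space"
  by (induction l) (simp_all add: gen_step_measurable_ennreal)

text \<open>Costs and subtrees come as two independent families; zipped, they form one i.i.d. family
  of pairs.\<close>

definition zipf :: "(nat \<Rightarrow> real) \<times> (nat \<Rightarrow> ewt_sample) \<Rightarrow> nat \<Rightarrow> real \<times> ewt_sample" where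
  "zipf p = (\<lambda>j\<in>{1..}. (fst p j, snd p j))"

text \<open>Grafting: the root carries type \<open>t\<close>; the pair \<open>y j\<close> is the cost towards child \<open>j\<close>
  together with the subtree rooted there.\<close>

definition graft :: "ewt_type \<Rightarrow> (nat \<Rightarrow> real \<times> ewt_sample) \<Rightarrow> ewt_sample" where
  "graft t y = (\<lambda>i\<in>Nf. case i of [] \<Rightarrow> (t, \<lambda>j\<in>{1..}. fst (y j)) | j # i' \<Rightarrow> snd (y j) i')"

lemma zipf_measurable:
  "zipf \<in> PiM {1..} (\<lambda>_. borel) \<Otimes>\<^sub>M PiM {1..} (\<lambda>_. tree_space) \<rightarrow>\<^sub>M PiM {1..} (\<lambda>_. borel \<Otimes>\<^sub>M tree_space)"
  unfolding zipf_def by (intro measurable_restrict) measurable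

lemma graft_measurable:
  "graft t \<in> PiM {1..} (\<lambda>_. borel \<Otimes>\<^sub>M tree_space) \<rightarrow>\<^sub>M tree_space"
  unfolding graft_def
proof (rule measurable_restrict)
  fix i assume i: "i \<in> Nf"
  show "(\<lambda>y. case i of [] \<Rightarrow> (t, \<lambda>j\<in>{1..}. fst (y j)) | j # i' \<Rightarrow> snd (y j) i')
    \<in> PiM {1..} (\<lambda>_. borel \<Otimes>\<^sub>M tree_space) \<rightarrow>\<^sub>M node_space"
  proof (cases i)
    case Nil
    have "(\<lambda>y. \<lambda>j\<in>{1..}. fst (y j)) \<in> PiM {1::nat..} (\<lambda>_. borel \<Otimes>\<^sub>M tree_space) \<rightarrow>\<^sub>M PiM {1..} (\<lambda>_. borel :: real measure)"
      by (intro measurable_restrict) measurable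
    then show ?thesis using Nil unfolding node_space_def by simp
  next
    case (Cons j i')
    then have [measurable]: "j \<in> {1..}" "i' \<in> Nf" using i by auto
    have "(\<lambda>y. snd (y j) i') \<in> PiM {1..} (\<lambda>_. borel \<Otimes>\<^sub>M tree_space) \<rightarrow>\<^sub>M node_space"
      by measurable
    then show ?thesis using Cons by simp
  qed
qed

lemma vtype_graft [simp]: "vtype (graft t y) [] = t"
  by (simp add: vtype_def graft_def)

lemma gen_step_graft:
  assumes "y \<in> space (PiM {1..} (\<lambda>_. borel \<Otimes>\<^sub>M tree_space))"
  shows "gen_step F (graft t y) = (\<Sum>j = 1..fst t.
    if fst (y j) < snd (vtype (snd (y j)) []) then F (snd (y j)) else 0)"
proof -
  have s: "sub j (graft t y) = snd (y j)" if "1 \<le> j" for j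
  proof -
    have "(\<lambda>y. y j) \<in> PiM {1..} (\<lambda>_. borel \<Otimes>\<^sub>M tree_space) \<rightarrow>\<^sub>M (borel :: real measure) \<Otimes>\<^sub>M tree_space"
      using that by (intro measurable_component_singleton) auto
    from measurable_space[OF measurable_compose[OF this measurable_snd] assms] have "snd (y j) \<in> space tree_space" .
    then show ?thesis
      using that by (auto simp: sub_def graft_def space_PiM PiE_def extensional_def fun_eq_iff)
  qed
  show ?thesis
    unfolding gen_step_def using s
    by (intro sum.cong) (auto simp: cost_def vtype_def graft_def)
qed

context ewt_params begin

abbreviation "NL \<equiv> node_law (Phat P)"

text \<open>The law of the data below a non-root vertex, relabelled so that this vertex becomes the
  root.\<close>

definition TreeQ :: "ewt_sample measure" where "TreeQ = PiM Nf (\<lambda>_. NL)"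

abbreviation "\<kappa> \<equiv> ewt_given P"

lemma sets_TreeQ [simp, measurable_cong]: "sets TreeQ = sets tree_space"
  unfolding TreeQ_def by (intro sets_PiM_cong) auto

lemma sets_kappa [simp, measurable_cong]: "sets (\<kappa> t) = sets tree_space"
  by (rule sets_ewt_given)

lemma space_TreeQ [simp]: "space TreeQ = space tree_space"
  and space_kappa [simp]: "space (\<kappa> t) = space tree_space"
  by (rule sets_eq_imp_space_eq; simp)+

lemma prob_TreeQ: "prob_space TreeQ"
  unfolding TreeQ_def by (intro prob_space_PiM prob_space_node_law)

text \<open>The root of the tree and a non-root vertex differ only in their offspring law. Once the
  type is given, the same kernel describes what lies below, which is what makes the moment
  recursions close.\<close>

lemma TreeQ_disintegration: "TreeQ = TL \<bind> \<kappa>"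
proof (rule measure_eqI_PiM_infinite)
  have ne: "space TL \<noteq> {}" by simp
  have meas: "node_given \<in> TL \<rightarrow>\<^sub>M subprob_algebra node_space"
    "\<kappa> \<in> TL \<rightarrow>\<^sub>M subprob_algebra tree_space"
    using measurable_prob_algebraD[OF node_given_measurable]
      measurable_prob_algebraD[OF ewt_given_measurable[of P]]
    by (simp_all add: measurable_cong_sets[OF sets_TL refl])
  have NL: "NL = TL \<bind> node_given" by (simp add: node_law_def TL_def)
  show "sets TreeQ = sets tree_space" by simp
  show "sets (TL \<bind> \<kappa>) = sets tree_space"
    by (rule sets_bind) (simp_all add: ne sets_ewt_given)
  show "finite_measure TreeQ" by (intro prob_space.finite_measure prob_TreeQ)
  fix A J assume J: "finite J" "J \<subseteq> Nf" and A: "\<And>i. i \<in> J \<Longrightarrow> A i \<in> sets node_space"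
  let ?X = "prod_emb Nf (\<lambda>_. node_space) J (Pi\<^sub>E J A)"
  let ?c = "\<Prod>i\<in>J - {[]}. emeasure NL (A i)"
  have X: "?X \<in> sets tree_space" using J A by (intro sets_PiM_I) auto
  have Q: "TreeQ = PiM Nf (\<lambda>i. if i = [] then NL else NL)" by (simp add: TreeQ_def)
  have "emeasure (TL \<bind> \<kappa>) ?X =
      (\<integral>\<^sup>+t. (if [] \<in> J then emeasure (node_given t) (A []) else 1) * ?c \<partial>TL)"
    using J A unfolding emeasure_bind[OF ne meas(2) X] ewt_given_def
    by (subst emeasure_node_PiM_emb) (auto intro: prob_space_node_given)
  also have "\<dots> = (if [] \<in> J then emeasure NL (A []) else 1) * ?c"
  proof (cases "[] \<in> J")
    case True
    then have m: "(\<lambda>t. emeasure (node_given t) (A [])) \<in> borel_measurable TL"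
      using node_given_measurable_emeasure[OF A] by (simp add: measurable_cong_sets[OF sets_TL refl])
    show ?thesis
      using True by (simp add: nn_integral_multc[OF m] NL emeasure_bind[OF ne meas(1) A])
  qed (use prob_space.emeasure_space_1[OF prob_TL] in simp)
  also have "\<dots> = emeasure TreeQ ?X"
    using J A unfolding Q by (subst emeasure_node_PiM_emb) (auto intro: prob_space_node_law)
  finally show "emeasure TreeQ ?X = emeasure (TL \<bind> \<kappa>) ?X" ..
qed

section \<open>Independence of the subtrees below a root of given type\<close>

definition ChildL :: "real \<Rightarrow> (real \<times> ewt_sample) measure" where
  "ChildL x = unif x \<Otimes>\<^sub>M TreeQ"

lemma sets_ChildL [simp, measurable_cong]: "sets (ChildL x) = sets (borel \<Otimes>\<^sub>M tree_space)"
  unfolding ChildL_def by (intro sets_pair_measure_cong) auto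

lemma space_ChildL [simp]: "space (ChildL x) = UNIV \<times> space tree_space"
  by (simp add: ChildL_def space_pair_measure)

lemma prob_ChildL: "prob_space (ChildL x)"
proof -
  interpret A: prob_space "unif x" by (rule prob_space_unif)
  interpret B: prob_space TreeQ by (rule prob_TreeQ)
  interpret pair_prob_space "unif x" TreeQ ..
  show ?thesis unfolding ChildL_def by unfold_locales
qed

lemma sets_PiM_ChildL [simp, measurable_cong]:
  "sets (PiM {1::nat..} (\<lambda>_. ChildL x)) = sets (PiM {1..} (\<lambda>_. borel \<Otimes>\<^sub>M tree_space))"
  by (intro sets_PiM_cong) auto

abbreviation "CostsTrees x \<equiv> PiM {1::nat..} (\<lambda>_. unif x) \<Otimes>\<^sub>M PiM {1::nat..} (\<lambda>_. TreeQ)"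

lemma sets_CostsTrees [measurable_cong]:
  "sets (CostsTrees x) = sets (PiM {1..} (\<lambda>_. borel) \<Otimes>\<^sub>M PiM {1..} (\<lambda>_. tree_space))"
  by (intro sets_pair_measure_cong sets_PiM_cong) auto

text \<open>Both laws are compared on cylinders: at fixed costs the trees give a product over J, and
  the costs are then integrated out one coordinate at a time.\<close>

lemma distr_zipf: "distr (CostsTrees x) (PiM {1..} (\<lambda>_. borel \<Otimes>\<^sub>M tree_space)) zipf = PiM {1..} (\<lambda>_. ChildL x)"
proof (rule measure_eqI_PiM_infinite[symmetric, where M = "\<lambda>_. ChildL x"])
  interpret U: product_prob_space "\<lambda>_::nat. unif x" "{1..}"
    by (intro product_prob_spaceI prob_space_unif)
  show "sets (PiM {1::nat..} (\<lambda>_. ChildL x)) = sets (PiM {1..} (\<lambda>_. ChildL x))" ..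
  show "sets (distr (CostsTrees x) (PiM {1..} (\<lambda>_. borel \<Otimes>\<^sub>M tree_space)) zipf) = sets (PiM {1::nat..} (\<lambda>_. ChildL x))"
    by (simp only: sets_distr sets_PiM_ChildL)
  show "finite_measure (PiM {1::nat..} (\<lambda>_. ChildL x))"
    by (intro prob_space.finite_measure prob_space_PiM prob_ChildL)
  fix A J assume J: "finite J" "J \<subseteq> {1::nat..}" and A: "\<And>j. j \<in> J \<Longrightarrow> A j \<in> sets (ChildL x)"
  let ?X = "prod_emb {1..} (\<lambda>_. ChildL x) J (Pi\<^sub>E J A)"
  have X: "?X \<in> sets (PiM {1..} (\<lambda>_. borel \<Otimes>\<^sub>M tree_space))"
    using J A by (subst sets_PiM_ChildL[of x, symmetric]) (intro sets_PiM_I, auto)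
  have zm: "zipf \<in> CostsTrees x \<rightarrow>\<^sub>M PiM {1..} (\<lambda>_. borel \<Otimes>\<^sub>M tree_space)"
    unfolding measurable_cong_sets[OF sets_CostsTrees refl] by (rule zipf_measurable)
  interpret T: prob_space "PiM {1::nat..} (\<lambda>_. TreeQ)" by (intro prob_space_PiM prob_TreeQ)
  have m1: "(\<lambda>z. emeasure TreeQ (Pair z -` A j)) \<in> borel_measurable (unif x)" if "j \<in> J" for j
  proof -
    interpret prob_space TreeQ by (rule prob_TreeQ)
    show ?thesis using A[OF that] unfolding ChildL_def by (rule measurable_emeasure_Pair)
  qed
  have "emeasure (distr (CostsTrees x) (PiM {1..} (\<lambda>_. borel \<Otimes>\<^sub>M tree_space)) zipf) ?X
    = emeasure (CostsTrees x) (zipf -` ?X \<inter> space (CostsTrees x))"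
    by (rule emeasure_distr[OF zm X])
  also have "\<dots> = (\<integral>\<^sup>+\<zeta>. emeasure (PiM {1..} (\<lambda>_. TreeQ)) (Pair \<zeta> -` (zipf -` ?X \<inter> space (CostsTrees x))) \<partial>PiM {1..} (\<lambda>_. unif x))"
    by (intro T.emeasure_pair_measure_alt measurable_sets[OF zm X])
  also have "\<dots> = (\<integral>\<^sup>+\<zeta>. (\<Prod>j\<in>J. emeasure TreeQ (Pair (\<zeta> j) -` A j)) \<partial>PiM {1..} (\<lambda>_. unif x))"
  proof (intro nn_integral_cong)
    fix \<zeta> assume \<zeta>: "\<zeta> \<in> space (PiM {1::nat..} (\<lambda>_. unif x))"
    have As: "A j \<subseteq> UNIV \<times> space tree_space" if "j \<in> J" for j
      using sets.sets_into_space[OF A[OF that]] by simp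
    have "Pair \<zeta> -` (zipf -` ?X \<inter> space (CostsTrees x))
      = prod_emb {1..} (\<lambda>_. TreeQ) J (Pi\<^sub>E J (\<lambda>j. Pair (\<zeta> j) -` A j))"
      using \<zeta> J(2) As
      by (auto simp: prod_emb_def zipf_def space_pair_measure space_PiM PiE_iff subset_iff)
    also have "emeasure (PiM {1..} (\<lambda>_. TreeQ)) \<dots> = (\<Prod>j\<in>J. emeasure TreeQ (Pair (\<zeta> j) -` A j))"
      using J A by (intro emeasure_PiM_emb prob_TreeQ) (auto simp: ChildL_def intro: sets_Pair1)
    finally show "emeasure (PiM {1..} (\<lambda>_. TreeQ)) (Pair \<zeta> -` (zipf -` ?X \<inter> space (CostsTrees x)))
      = (\<Prod>j\<in>J. emeasure TreeQ (Pair (\<zeta> j) -` A j))" .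
  qed
  \<comment> \<open>The integrand depends on the coordinates in J only, so the infinite product
    measure may be replaced by a finite one.\<close>
  also have "\<dots> = (\<integral>\<^sup>+\<zeta>. (\<Prod>j\<in>J. emeasure TreeQ (Pair (\<zeta> j) -` A j)) \<partial>PiM J (\<lambda>_. unif x))"
  proof -
    let ?g = "\<lambda>\<zeta>. \<Prod>j\<in>J. emeasure TreeQ (Pair (\<zeta> j) -` A j)"
    have "(\<integral>\<^sup>+\<zeta>. ?g \<zeta> \<partial>PiM J (\<lambda>_. unif x))
      = (\<integral>\<^sup>+\<zeta>. ?g \<zeta> \<partial>distr (PiM {1..} (\<lambda>_. unif x)) (PiM J (\<lambda>_. unif x)) (\<lambda>f. restrict f J))"
      by (simp only: U.distr_PiM_restrict_finite[OF J])
    also have "\<dots> = (\<integral>\<^sup>+\<zeta>. ?g (restrict \<zeta> J) \<partial>PiM {1..} (\<lambda>_. unif x))"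
      using m1 by (intro nn_integral_distr measurable_restrict_subset[OF J(2)] borel_measurable_prod_ennreal)
        (auto intro: measurable_compose[OF measurable_component_singleton])
    also have "\<dots> = (\<integral>\<^sup>+\<zeta>. ?g \<zeta> \<partial>PiM {1..} (\<lambda>_. unif x))"
      by (intro nn_integral_cong prod.cong) auto
    finally show ?thesis ..
  qed
  also have "\<dots> = (\<Prod>j\<in>J. \<integral>\<^sup>+z. emeasure TreeQ (Pair z -` A j) \<partial>unif x)"
    using m1 by (intro U.product_nn_integral_prod J) auto
  also have "\<dots> = (\<Prod>j\<in>J. emeasure (ChildL x) (A j))"
  proof (intro prod.cong refl)
    fix j assume j: "j \<in> J"
    interpret prob_space TreeQ by (rule prob_TreeQ)
    show "(\<integral>\<^sup>+z. emeasure TreeQ (Pair z -` A j) \<partial>unif x) = emeasure (ChildL x) (A j)"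
      using A[OF j] unfolding ChildL_def by (rule emeasure_pair_measure_alt[symmetric])
  qed
  also have "\<dots> = emeasure (PiM {1..} (\<lambda>_. ChildL x)) ?X"
    using J A by (intro emeasure_PiM_emb[symmetric] prob_ChildL) auto
  finally show "emeasure (PiM {1..} (\<lambda>_. ChildL x)) ?X =
    emeasure (distr (CostsTrees x) (PiM {1..} (\<lambda>_. borel \<Otimes>\<^sub>M tree_space)) zipf) ?X" ..
qed

text \<open>In a cylinder the condition at the root concerns the costs only, and conditions at words
  beginning with j concern the j-th subtree only, so the preimage is a rectangle.\<close>

lemma distr_graft_zipf: "distr (CostsTrees x) tree_space (\<lambda>p. graft (m, x) (zipf p)) = \<kappa> (m, x)"
proof (rule measure_eqI_PiM_infinite[symmetric, where M = "\<lambda>_. node_space"])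
  let ?N = "CostsTrees x" and ?\<Psi> = "\<lambda>p. graft (m, x) (zipf p)"
  show "sets (\<kappa> (m, x)) = sets tree_space" by simp
  show "sets (distr ?N tree_space ?\<Psi>) = sets tree_space" by simp
  show "finite_measure (\<kappa> (m, x))" by (intro prob_space.finite_measure prob_space_ewt_given)
  fix A J assume J: "finite J" "J \<subseteq> Nf" and A: "\<And>i. i \<in> J \<Longrightarrow> A i \<in> sets node_space"
  let ?X = "prod_emb Nf (\<lambda>_. node_space) J (Pi\<^sub>E J A)"
  have X: "?X \<in> sets tree_space" using J A by (intro sets_PiM_I) auto
  have zm: "?\<Psi> \<in> ?N \<rightarrow>\<^sub>M tree_space"
    unfolding measurable_cong_sets[OF sets_CostsTrees refl]
    by (rule measurable_compose[OF zipf_measurable graft_measurable])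
  interpret T: prob_space "PiM {1::nat..} (\<lambda>_. TreeQ)" by (intro prob_space_PiM prob_TreeQ)
  \<comment> \<open>J1 holds the first letters occurring in J, and K j the remainders after the
    letter j: a cylinder over J splits into one cylinder per subtree.\<close>
  define J1 where "J1 = {j. \<exists>i. j # i \<in> J}"
  define K where "K j = {i. j # i \<in> J}" for j
  have J1: "finite J1" "J1 \<subseteq> {1..}"
  proof -
    have "J1 \<subseteq> hd ` J" by (force simp: J1_def)
    then show "finite J1" using J(1) finite_surj by blast
    show "J1 \<subseteq> {1..}" using J(2) by (auto simp: J1_def)
  qed
  have K: "finite (K j)" "K j \<subseteq> Nf" for j
  proof -
    have "K j \<subseteq> tl ` J" by (force simp: K_def)
    then show "finite (K j)" using J(1) finite_surj by blast
    show "K j \<subseteq> Nf" using J(2) by (auto simp: K_def)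
  qed
  have JK: "J - {[]} = (\<lambda>(j, i). j # i) ` Sigma J1 K"
  proof (intro set_eqI iffI)
    fix i assume "i \<in> J - {[]}"
    then show "i \<in> (\<lambda>(j, i). j # i) ` Sigma J1 K"
      by (cases i) (auto simp: J1_def K_def image_iff)
  qed (auto simp: J1_def K_def)
  define E where "E j = prod_emb Nf (\<lambda>_. NL) (K j) (Pi\<^sub>E (K j) (\<lambda>i. A (j # i)))" for j
  have AN: "A (j # i) \<in> sets NL" if "i \<in> K j" for i j using A that by (simp add: K_def)
  have E: "E j \<in> sets TreeQ" for j
    unfolding E_def TreeQ_def using K AN by (intro sets_PiM_I) auto
  define R where "R = (if [] \<in> J then (\<lambda>\<zeta>. ((m, x), \<zeta>)) -` A [] \<inter> space (PiM {1::nat..} (\<lambda>_. unif x)) else space (PiM {1::nat..} (\<lambda>_. unif x)))"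
  have R: "R \<in> sets (PiM {1::nat..} (\<lambda>_. unif x))"
    using A[of "[]"] measurable_sets[OF measurable_pair_node_space, of "A []" "(m, x)" x] by (auto simp: R_def)
  let ?T = "prod_emb {1..} (\<lambda>_. TreeQ) J1 (Pi\<^sub>E J1 E)"
  have T: "?T \<in> sets (PiM {1..} (\<lambda>_. TreeQ))" using J1 E by (intro sets_PiM_I) auto
  have spNL: "space NL = space node_space" by (rule sets_eq_imp_space_eq) simp
  have eq: "?\<Psi> -` ?X \<inter> space ?N = R \<times> ?T"
  proof (intro set_eqI)
    fix p :: "(nat \<Rightarrow> real) \<times> (nat \<Rightarrow> ewt_sample)"
    obtain \<zeta> \<tau> where p: "p = (\<zeta>, \<tau>)" by (cases p)
    show "p \<in> ?\<Psi> -` ?X \<inter> space ?N \<longleftrightarrow> p \<in> R \<times> ?T"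
    proof (cases "p \<in> space ?N")
      case False
      have "R \<times> ?T \<subseteq> space ?N"
        unfolding space_pair_measure by (intro Sigma_mono sets.sets_into_space R T)
      with False show ?thesis by blast
    next
      case True
      have sp: "\<zeta> \<in> space (PiM {1::nat..} (\<lambda>_. unif x))" "\<tau> \<in> space (PiM {1..} (\<lambda>_. TreeQ))"
        using True by (auto simp: p space_pair_measure)
      have \<tau>: "\<tau> j \<in> space tree_space" if "1 \<le> j" for j
        using sp(2) that by (auto simp: space_PiM PiE_iff)
      have \<zeta>e: "(\<lambda>j\<in>{1..}. \<zeta> j) = \<zeta>" using sp(1) by (auto simp: space_PiM)
      have val: "?\<Psi> p [] = ((m, x), \<zeta>)" "\<And>j i. j # i \<in> Nf \<Longrightarrow> ?\<Psi> p (j # i) = \<tau> j i"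
        using \<zeta>e by (auto simp: graft_def zipf_def p cong: restrict_cong)
      have "p \<in> ?\<Psi> -` ?X \<longleftrightarrow> (\<forall>i\<in>J. ?\<Psi> p i \<in> A i)"
        using measurable_space[OF zm True] J(2)
        by (auto simp: prod_emb_def space_PiM PiE_iff subset_iff)
      also have "\<dots> \<longleftrightarrow> ([] \<in> J \<longrightarrow> ?\<Psi> p [] \<in> A []) \<and> (\<forall>i\<in>J - {[]}. ?\<Psi> p i \<in> A i)" by auto
      also have "(\<forall>i\<in>J - {[]}. ?\<Psi> p i \<in> A i) \<longleftrightarrow> (\<forall>j\<in>J1. \<forall>i\<in>K j. ?\<Psi> p (j # i) \<in> A (j # i))"
        unfolding JK by auto
      also have "\<dots> \<longleftrightarrow> (\<forall>j\<in>J1. \<forall>i\<in>K j. \<tau> j i \<in> A (j # i))"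
        using J1(2) K(2) by (intro ball_cong refl arg_cong2[where f = "(\<in>)"] val(2)) auto
      also have "\<dots> \<longleftrightarrow> (\<forall>j\<in>J1. \<tau> j \<in> E j)"
        using J1(2) K(2) \<tau> by (intro ball_cong refl) (auto simp: E_def prod_emb_def space_PiM PiE_iff spNL subset_iff)
      also have "\<dots> \<longleftrightarrow> \<tau> \<in> ?T"
        using J1(2) sp(2) by (auto simp: prod_emb_def space_PiM PiE_iff subset_iff)
      also have "([] \<in> J \<longrightarrow> ?\<Psi> p [] \<in> A []) \<longleftrightarrow> \<zeta> \<in> R"
        unfolding val using sp by (auto simp: R_def)
      finally show ?thesis using True by (simp add: p)
    qed
  qed
  have "emeasure (distr ?N tree_space ?\<Psi>) ?X = emeasure ?N (R \<times> ?T)"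
    unfolding eq[symmetric] by (rule emeasure_distr[OF zm X])
  also have "\<dots> = emeasure (PiM {1..} (\<lambda>_. unif x)) R * emeasure (PiM {1..} (\<lambda>_. TreeQ)) ?T"
    by (rule T.emeasure_pair_measure_Times[OF R T])
  also have "emeasure (PiM {1..} (\<lambda>_. unif x)) R = (if [] \<in> J then emeasure (node_given (m, x)) (A []) else 1)"
  proof (cases "[] \<in> J")
    case True
    then show ?thesis
      using A unfolding R_def node_given_def if_P[OF True] snd_conv
      by (intro emeasure_distr[OF measurable_pair_node_space, symmetric])
  next
    case False
    interpret prob_space "PiM {1::nat..} (\<lambda>_. unif x)" by (intro prob_space_PiM prob_space_unif)
    show ?thesis using False emeasure_space_1 by (simp add: R_def)
  qed
  also have "emeasure (PiM {1..} (\<lambda>_. TreeQ)) ?T = (\<Prod>j\<in>J1. emeasure TreeQ (E j))"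
    using J1 E by (intro emeasure_PiM_emb prob_TreeQ) auto
  also have "\<dots> = (\<Prod>j\<in>J1. \<Prod>i\<in>K j. emeasure NL (A (j # i)))"
    unfolding E_def TreeQ_def using K AN by (intro prod.cong refl emeasure_PiM_emb prob_space_node_law) auto
  also have "\<dots> = (\<Prod>(j, i)\<in>Sigma J1 K. emeasure NL (A (j # i)))"
    using J1 K by (subst prod.Sigma) auto
  also have "\<dots> = (\<Prod>i\<in>J - {[]}. emeasure NL (A i))"
    unfolding JK by (subst prod.reindex) (auto simp: inj_on_def intro!: prod.cong)
  also have "(if [] \<in> J then emeasure (node_given (m, x)) (A []) else 1) * \<dots> = emeasure (\<kappa> (m, x)) ?X"
    using J A unfolding ewt_given_def
    by (subst emeasure_node_PiM_emb) (auto intro: prob_space_node_given)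
  finally show "emeasure (\<kappa> (m, x)) ?X = emeasure (distr ?N tree_space ?\<Psi>) ?X" ..
qed

text \<open>Given the root type, the pairs (cost to a child, subtree below it) are i.i.d.\<close>

lemma kappa_eq_distr_graft: "\<kappa> (m, x) = distr (PiM {1..} (\<lambda>_. ChildL x)) tree_space (graft (m, x))"
  unfolding distr_zipf[symmetric] distr_graft_zipf[symmetric]
proof (subst distr_distr)
  show "graft (m, x) \<in> PiM {1..} (\<lambda>_. borel \<Otimes>\<^sub>M tree_space) \<rightarrow>\<^sub>M tree_space" by (rule graft_measurable)
  show "zipf \<in> CostsTrees x \<rightarrow>\<^sub>M PiM {1..} (\<lambda>_. borel \<Otimes>\<^sub>M tree_space)"
    unfolding measurable_cong_sets[OF sets_CostsTrees refl] by (rule zipf_measurable)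
qed (simp add: comp_def)

end

section \<open>Moments of one generation\<close>

definition kept_part :: "(ewt_sample \<Rightarrow> 'a :: zero) \<Rightarrow> real \<times> ewt_sample \<Rightarrow> 'a" where
  "kept_part g p = (if fst p < snd (vtype (snd p) []) then g (snd p) else 0)"

lemma kept_part_measurable [measurable]:
  fixes g :: "ewt_sample \<Rightarrow> 'a :: {topological_space, zero}"
  assumes [measurable]: "g \<in> borel_measurable tree_space"
  shows "kept_part g \<in> borel_measurable (borel \<Otimes>\<^sub>M tree_space)"
proof -
  have [measurable]: "(\<lambda>\<omega>. vtype \<omega> []) \<in> tree_space \<rightarrow>\<^sub>M borel" by (intro vtype_measurable) simp
  show ?thesis unfolding kept_part_def[abs_def] by measurable
qed

lemma emeasure_unif_keep_prob: assumes z: "0 < z" shows "emeasure (unif x) {..<z} = ennreal (keep_prob x z)"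
proof (cases "0 < x")
  case True
  have "{0..x} \<inter> {..<z} = (if z \<le> x then {0..<z} else {0..x})" using z by auto
  then have "emeasure lborel ({0..x} \<inter> {..<z}) = ennreal (min z x)"
    using True z by simp
  then show ?thesis
    using True z by (simp add: unif_def keep_prob_def divide_ennreal min_def field_simps)
qed (use z in \<open>simp add: unif_def keep_prob_def\<close>)

lemma abs_mult_le_squares: "\<bar>a * b\<bar> \<le> a\<^sup>2 + b\<^sup>2" for a b :: real
proof -
  have "0 \<le> (\<bar>a\<bar> - \<bar>b\<bar>)\<^sup>2" by simp
  then have "2 * (\<bar>a\<bar> * \<bar>b\<bar>) \<le> a\<^sup>2 + b\<^sup>2" by (simp add: power2_diff)
  moreover have "0 \<le> \<bar>a\<bar> * \<bar>b\<bar>" by simp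
  ultimately show ?thesis unfolding abs_mult by linarith
qed

context ewt_params begin

definition Kids :: "real \<Rightarrow> (nat \<Rightarrow> real \<times> ewt_sample) measure" where
  "Kids x = PiM {1..} (\<lambda>_. ChildL x)"

lemma sets_Kids [measurable_cong]: "sets (Kids x) = sets (PiM {1..} (\<lambda>_. borel \<Otimes>\<^sub>M tree_space))"
  unfolding Kids_def by (rule sets_PiM_ChildL)

lemma graft_measurable_Kids: "graft t \<in> Kids x \<rightarrow>\<^sub>M tree_space"
  unfolding measurable_cong_sets[OF sets_Kids refl] by (rule graft_measurable)

lemma kappa_graft: "\<kappa> t = distr (Kids (snd t)) tree_space (graft t)"
  using kappa_eq_distr_graft[of "fst t" "snd t"] by (simp only: prod.collapse Kids_def)

lemma AE_kappa_root: "AE \<omega> in \<kappa> t. vtype \<omega> [] = t"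
proof -
  have [measurable]: "(\<lambda>\<omega>. vtype \<omega> []) \<in> tree_space \<rightarrow>\<^sub>M borel" by (intro vtype_measurable) simp
  have "(\<lambda>\<omega>. vtype \<omega> []) -` {t} \<inter> space tree_space \<in> sets tree_space" by measurable
  also have "(\<lambda>\<omega>. vtype \<omega> []) -` {t} \<inter> space tree_space = {\<omega> \<in> space tree_space. vtype \<omega> [] = t}"
    by auto
  finally show ?thesis
    unfolding kappa_graft by (subst AE_distr_iff[OF graft_measurable_Kids]) simp_all
qed

lemma gen_step_graft_Kids:
  "y \<in> space (Kids x) \<Longrightarrow> gen_step g (graft t y) = (\<Sum>j = 1..fst t. kept_part g (y j))"
  unfolding kept_part_def sets_eq_imp_space_eq[OF sets_Kids] by (rule gen_step_graft)

lemma Kids_component: "1 \<le> j \<Longrightarrow> distr (Kids x) (ChildL x) (\<lambda>y. y j) = ChildL x"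
  unfolding Kids_def by (intro distr_PiM_component prob_ChildL) simp

lemma Kids_component_measurable: "1 \<le> j \<Longrightarrow> (\<lambda>y. y j) \<in> Kids x \<rightarrow>\<^sub>M ChildL x"
  unfolding Kids_def by (intro measurable_component_singleton) simp

lemma integral_Kids_component:
  fixes f :: "real \<times> ewt_sample \<Rightarrow> real"
  assumes "1 \<le> j" "integrable (ChildL x) f"
  shows "integrable (Kids x) (\<lambda>y. f (y j))" "(\<integral>y. f (y j) \<partial>Kids x) = (\<integral>p. f p \<partial>ChildL x)"
proof -
  have f: "f \<in> borel_measurable (ChildL x)" using assms by auto
  show "integrable (Kids x) (\<lambda>y. f (y j))"
    using assms integrable_distr[OF Kids_component_measurable[of j x], of f] Kids_component[of j x] by simp
  show "(\<integral>y. f (y j) \<partial>Kids x) = (\<integral>p. f p \<partial>ChildL x)"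
    using integral_distr[OF Kids_component_measurable[of j x] f] assms Kids_component[of j x] by simp
qed

lemma nn_integral_Kids_component:
  assumes "1 \<le> j" "f \<in> borel_measurable (borel \<Otimes>\<^sub>M tree_space)"
  shows "(\<integral>\<^sup>+y. f (y j) \<partial>Kids x) = (\<integral>\<^sup>+p. f p \<partial>ChildL x)"
  using nn_integral_distr[OF Kids_component_measurable[of j x], of f] assms Kids_component[of j x] by simp

text \<open>Independence of two children, read off from the projection to two coordinates, where the
  product measure is finite.\<close>

lemma integral_Kids_two:
  fixes f g :: "real \<times> ewt_sample \<Rightarrow> real"
  assumes j: "1 \<le> j" "1 \<le> k" "j \<noteq> k" and f: "integrable (ChildL x) f" and g: "integrable (ChildL x) g"
  shows "integrable (Kids x) (\<lambda>y. f (y j) * g (y k))"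
    "(\<integral>y. f (y j) * g (y k) \<partial>Kids x) = (\<integral>p. f p \<partial>ChildL x) * (\<integral>p. g p \<partial>ChildL x)"
proof -
  interpret U: product_prob_space "\<lambda>_::nat. ChildL x" "{1..}"
    by (intro product_prob_spaceI prob_ChildL)
  let ?J = "{j, k}" and ?h = "\<lambda>i. if i = j then f else g"
  let ?F = "\<lambda>y. \<Prod>i\<in>?J. ?h i (y i)"
  have J: "finite ?J" "?J \<subseteq> {1..}" using j by auto
  have h: "integrable (ChildL x) (?h i)" for i using f g by simp
  have r: "(\<lambda>y. restrict y ?J) \<in> Kids x \<rightarrow>\<^sub>M PiM ?J (\<lambda>_. ChildL x)"
    unfolding Kids_def by (rule measurable_restrict_subset[OF J(2)])
  have d: "distr (Kids x) (PiM ?J (\<lambda>_. ChildL x)) (\<lambda>y. restrict y ?J) = PiM ?J (\<lambda>_. ChildL x)"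
    unfolding Kids_def by (rule U.distr_PiM_restrict_finite[OF J])
  have i: "integrable (PiM ?J (\<lambda>_. ChildL x)) ?F"
    by (intro U.product_integrable_prod J h)
  have m: "?F \<in> borel_measurable (PiM ?J (\<lambda>_. ChildL x))" using i by auto
  have e: "?F (restrict y ?J) = f (y j) * g (y k)" for y using j by simp
  have "integrable (distr (Kids x) (PiM ?J (\<lambda>_. ChildL x)) (\<lambda>y. restrict y ?J)) ?F"
    unfolding d by (rule i)
  then have "integrable (Kids x) (\<lambda>y. ?F (restrict y ?J))" by (rule integrable_distr[OF r])
  then show "integrable (Kids x) (\<lambda>y. f (y j) * g (y k))" unfolding e .
  have "(\<integral>y. f (y j) * g (y k) \<partial>Kids x) = (\<integral>y. ?F y \<partial>distr (Kids x) (PiM ?J (\<lambda>_. ChildL x)) (\<lambda>y. restrict y ?J))"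
    unfolding integral_distr[OF r m] e ..
  also have "\<dots> = (\<Prod>i\<in>?J. \<integral>p. ?h i p \<partial>ChildL x)"
    unfolding d by (intro U.product_integral_prod J h)
  also have "\<dots> = (\<integral>p. f p \<partial>ChildL x) * (\<integral>p. g p \<partial>ChildL x)" using j by simp
  finally show "(\<integral>y. f (y j) * g (y k) \<partial>Kids x) = (\<integral>p. f p \<partial>ChildL x) * (\<integral>p. g p \<partial>ChildL x)" .
qed

lemma kappa_measurable: "\<kappa> \<in> TL \<rightarrow>\<^sub>M subprob_algebra tree_space"
  using measurable_prob_algebraD[OF ewt_given_measurable[of P]]
  by (simp add: measurable_cong_sets[OF sets_TL refl])

lemma nn_kappa_measurable [measurable]:
  assumes "g \<in> borel_measurable tree_space"
  shows "(\<lambda>s. \<integral>\<^sup>+\<omega>. g \<omega> \<partial>\<kappa> s) \<in> borel_measurable borel"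
  by (rule measurable_compose[OF measurable_prob_algebraD[OF ewt_given_measurable]
        nn_integral_measurable_subprob_algebra[OF assms]])

text \<open>The cost is integrated out first, which leaves the probability that it lies below the v
  of the child; then the subtree is disintegrated over its root type.\<close>

lemma nn_integral_kept_part:
  assumes [measurable]: "g \<in> borel_measurable tree_space"
  shows "(\<integral>\<^sup>+p. kept_part g p \<partial>ChildL x) = (\<integral>\<^sup>+s. ennreal (keep_prob x (snd s)) * (\<integral>\<^sup>+\<omega>. g \<omega> \<partial>\<kappa> s) \<partial>TL)"
proof -
  interpret A: prob_space "unif x" by (rule prob_space_unif)
  interpret B: prob_space TreeQ by (rule prob_TreeQ)
  interpret pair_sigma_finite "unif x" TreeQ ..
  have [measurable_cong]: "sets (unif x) = sets borel" by simp
  have [measurable]: "(\<lambda>\<omega>. vtype \<omega> []) \<in> tree_space \<rightarrow>\<^sub>M borel" by (intro vtype_measurable) simp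
  have [measurable]: "(\<lambda>v. emeasure (unif x) {..<v}) \<in> borel_measurable borel"
  proof -
    have "(\<lambda>v. \<integral>\<^sup>+z. indicator {..<v} z \<partial>unif x) \<in> borel_measurable borel"
      by (intro A.borel_measurable_nn_integral)
        (simp add: indicator_def measurable_split_conv, measurable)
    then show ?thesis by simp
  qed
  define w where "w s = emeasure (unif x) {..<snd s}" for s :: ewt_type
  have w [measurable]: "w \<in> borel_measurable borel" unfolding w_def by measurable
  have "(\<integral>\<^sup>+p. kept_part g p \<partial>ChildL x) = (\<integral>\<^sup>+\<tau>. (\<integral>\<^sup>+\<zeta>. kept_part g (\<zeta>, \<tau>) \<partial>unif x) \<partial>TreeQ)"
    unfolding ChildL_def by (rule nn_integral_snd[symmetric]) measurable
  also have "\<dots> = (\<integral>\<^sup>+\<tau>. g \<tau> * w (vtype \<tau> []) \<partial>TreeQ)"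
  proof (intro nn_integral_cong)
    fix \<tau>
    have "(\<integral>\<^sup>+\<zeta>. kept_part g (\<zeta>, \<tau>) \<partial>unif x) = (\<integral>\<^sup>+\<zeta>. g \<tau> * indicator {..<snd (vtype \<tau> [])} \<zeta> \<partial>unif x)"
      by (intro nn_integral_cong) (auto simp: kept_part_def indicator_def)
    then show "(\<integral>\<^sup>+\<zeta>. kept_part g (\<zeta>, \<tau>) \<partial>unif x) = g \<tau> * w (vtype \<tau> [])"
      by (simp add: nn_integral_cmult_indicator w_def)
  qed
  also have "\<dots> = (\<integral>\<^sup>+s. (\<integral>\<^sup>+\<tau>. g \<tau> * w (vtype \<tau> []) \<partial>\<kappa> s) \<partial>TL)"
    unfolding TreeQ_disintegration by (rule nn_integral_bind[OF _ kappa_measurable]) measurable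
  also have "\<dots> = (\<integral>\<^sup>+s. ennreal (keep_prob x (snd s)) * (\<integral>\<^sup>+\<omega>. g \<omega> \<partial>\<kappa> s) \<partial>TL)"
  proof (intro nn_integral_cong_AE AE_TLI)
    fix s :: ewt_type assume s: "0 < snd s"
    have "(\<integral>\<^sup>+\<tau>. g \<tau> * w (vtype \<tau> []) \<partial>\<kappa> s) = (\<integral>\<^sup>+\<tau>. g \<tau> * w s \<partial>\<kappa> s)"
      using AE_kappa_root[of s] by (intro nn_integral_cong_AE) (auto elim!: eventually_mono)
    also have "\<dots> = (\<integral>\<^sup>+\<omega>. g \<omega> \<partial>\<kappa> s) * w s"
      by (rule nn_integral_multc) measurable
    finally show "(\<integral>\<^sup>+\<tau>. g \<tau> * w (vtype \<tau> []) \<partial>\<kappa> s) = ennreal (keep_prob x (snd s)) * (\<integral>\<^sup>+\<omega>. g \<omega> \<partial>\<kappa> s)"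
      by (simp add: w_def emeasure_unif_keep_prob[OF s] mult.commute)
  qed
  finally show ?thesis .
qed

section \<open>Weighted bounds, uniform in the root type\<close>

definition Em :: "(ewt_sample \<Rightarrow> real) \<Rightarrow> ewt_type \<Rightarrow> real" where
  "Em g s = (\<integral>\<omega>. g \<omega> \<partial>\<kappa> s)"

lemma Em_measurable [measurable]:
  assumes "g \<in> borel_measurable tree_space" shows "Em g \<in> borel_measurable borel"
  unfolding Em_def[abs_def]
  by (rule measurable_compose[OF measurable_prob_algebraD[OF ewt_given_measurable]
        integral_measurable_subprob_algebra[OF assms]])

text \<open>A sum over n children has a second moment of order n^2, so this weight is reproduced by
  \<open>gen_step\<close>, see \<open>L2_wt_gen_step\<close>.\<close>

definition wt :: "ewt_type \<Rightarrow> real" where "wt s = (1 + real (fst s))\<^sup>2"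

lemma wt_ge_1: "1 \<le> wt s" and wt_nonneg: "0 \<le> wt s"
  by (simp_all add: wt_def power2_eq_square algebra_simps)

lemma wt_measurable [measurable]: "wt \<in> borel_measurable borel"
  unfolding wt_def[abs_def] by measurable

lemma integrable_wt_snd: "integrable TL (\<lambda>s. (1 + snd s) * wt s)"
  using integrable_TL_weight by (simp add: wt_def)

lemma integrable_TL_bound:
  assumes [measurable]: "h \<in> borel_measurable borel" and "\<And>s. 0 < snd s \<Longrightarrow> \<bar>h s\<bar> \<le> C * ((1 + snd s) * wt s)"
  shows "integrable TL h"
proof (rule Bochner_Integration.integrable_bound)
  show "integrable TL (\<lambda>s. C * ((1 + snd s) * wt s))" by (intro integrable_mult_right integrable_wt_snd)
  show "AE s in TL. norm (h s) \<le> norm (C * ((1 + snd s) * wt s))"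
    by (intro AE_TLI) (metis assms(2) abs_ge_self order_trans real_norm_def)
qed measurable

lemma integrable_TL_wt_bound:
  assumes "h \<in> borel_measurable borel" and h: "\<And>s. 0 < snd s \<Longrightarrow> \<bar>h s\<bar> \<le> C * wt s"
  shows "integrable TL h"
proof (rule integrable_TL_bound[of _ C])
  fix s :: ewt_type assume s: "0 < snd s"
  have "0 \<le> C * wt s" using h[OF s] by linarith
  then have "C * wt s * 1 \<le> C * wt s * (1 + snd s)" using s by (intro mult_left_mono) auto
  with h[OF s] show "\<bar>h s\<bar> \<le> C * ((1 + snd s) * wt s)" by (simp add: mult_ac)
qed fact

definition wtbar :: real where "wtbar = (\<integral>s. wt s \<partial>TL)"

lemma integrable_wt: "integrable TL wt"
  by (rule integrable_TL_wt_bound[of _ 1]) (simp_all add: wt_nonneg)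

lemma wtbar_nonneg: "0 \<le> wtbar"
  unfolding wtbar_def by (simp add: wt_nonneg)

definition child_mean :: "(ewt_type \<Rightarrow> real) \<Rightarrow> real \<Rightarrow> real" where
  "child_mean h x = (\<integral>s. keep_prob x (snd s) * h s \<partial>TL)"

lemma integrable_child_mean:
  assumes [measurable]: "h \<in> borel_measurable borel" and h: "\<And>s. 0 < snd s \<Longrightarrow> \<bar>h s\<bar> \<le> C * wt s"
  shows "integrable TL (\<lambda>s. keep_prob x (snd s) * h s)"
proof (rule integrable_TL_wt_bound[of _ C])
  fix s :: ewt_type assume s: "0 < snd s"
  have "\<bar>keep_prob x (snd s) * h s\<bar> \<le> 1 * \<bar>h s\<bar>"
    using keep_prob_bounds(1)[OF s, of x] keep_prob_bounds(2)[of x "snd s"] unfolding abs_mult by (intro mult_right_mono) auto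
  with h[OF s] show "\<bar>keep_prob x (snd s) * h s\<bar> \<le> C * wt s" by simp
qed measurable

text \<open>The bound is asked at every type, not almost everywhere, because the conditional laws
  are studied for each fixed (m, x).\<close>

definition L1_wt :: "(ewt_sample \<Rightarrow> real) \<Rightarrow> real \<Rightarrow> bool" where
  "L1_wt g C \<longleftrightarrow> g \<in> borel_measurable tree_space \<and> 0 \<le> C \<and>
     (\<forall>s. (\<integral>\<^sup>+\<omega>. ennreal \<bar>g \<omega>\<bar> \<partial>\<kappa> s) \<le> ennreal (C * wt s))"

lemma L1_wtI: "g \<in> borel_measurable tree_space \<Longrightarrow> 0 \<le> C \<Longrightarrow>
    (\<And>s. (\<integral>\<^sup>+\<omega>. ennreal \<bar>g \<omega>\<bar> \<partial>\<kappa> s) \<le> ennreal (C * wt s)) \<Longrightarrow> L1_wt g C"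
  unfolding L1_wt_def by blast

lemma L1_wtD: "L1_wt g C \<Longrightarrow> (\<integral>\<^sup>+\<omega>. ennreal \<bar>g \<omega>\<bar> \<partial>\<kappa> s) \<le> ennreal (C * wt s)"
  and L1_wt_nonneg: "L1_wt g C \<Longrightarrow> 0 \<le> C"
  unfolding L1_wt_def by blast+

lemma L1_wt_measurable: "L1_wt g C \<Longrightarrow> g \<in> borel_measurable tree_space"
  by (simp add: L1_wt_def)

lemma L1_wt_integrable: assumes "L1_wt g C" shows "integrable (\<kappa> s) g"
proof (rule integrableI_bounded)
  show "g \<in> borel_measurable (\<kappa> s)" using L1_wt_measurable[OF assms] by measurable
  have "(\<integral>\<^sup>+\<omega>. ennreal (norm (g \<omega>)) \<partial>\<kappa> s) \<le> ennreal (C * wt s)" using L1_wtD[OF assms] by simp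
  then show "(\<integral>\<^sup>+\<omega>. ennreal (norm (g \<omega>)) \<partial>\<kappa> s) < \<infinity>"
    by (rule order.strict_trans1) simp
qed

lemma L1_wt_Em_bound: assumes "L1_wt g C" shows "\<bar>Em g s\<bar> \<le> C * wt s"
proof -
  have "\<bar>Em g s\<bar> \<le> (\<integral>\<omega>. \<bar>g \<omega>\<bar> \<partial>\<kappa> s)" unfolding Em_def using integral_norm_bound[of "\<kappa> s" g] by simp
  also have "ennreal \<dots> = (\<integral>\<^sup>+\<omega>. ennreal \<bar>g \<omega>\<bar> \<partial>\<kappa> s)"
    by (intro nn_integral_eq_integral[symmetric] integrable_abs L1_wt_integrable[OF assms]) simp
  then have "ennreal (\<integral>\<omega>. \<bar>g \<omega>\<bar> \<partial>\<kappa> s) \<le> ennreal (C * wt s)" using L1_wtD[OF assms] by simp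
  then have "(\<integral>\<omega>. \<bar>g \<omega>\<bar> \<partial>\<kappa> s) \<le> C * wt s"
    using L1_wt_nonneg[OF assms] wt_nonneg[of s] by (subst (asm) ennreal_le_iff) auto
  finally show ?thesis .
qed

lemma L1_wt_mono:
  assumes "L1_wt g C" "f \<in> borel_measurable tree_space" "\<And>\<omega>. \<bar>f \<omega>\<bar> \<le> \<bar>g \<omega>\<bar>"
  shows "L1_wt f C"
proof -
  have "(\<integral>\<^sup>+\<omega>. ennreal \<bar>f \<omega>\<bar> \<partial>\<kappa> s) \<le> (\<integral>\<^sup>+\<omega>. ennreal \<bar>g \<omega>\<bar> \<partial>\<kappa> s)" for s
    using assms(3) by (intro nn_integral_mono ennreal_leI)
  from order_trans[OF this L1_wtD[OF assms(1)]] show ?thesis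
    by (rule L1_wtI[OF assms(2) L1_wt_nonneg[OF assms(1)]])
qed

lemma integral_kept_part_nonneg:
  assumes g: "L1_wt g C" and nn: "\<And>\<omega>. 0 \<le> g \<omega>"
  shows "integrable (ChildL x) (kept_part g)" "(\<integral>p. kept_part g p \<partial>ChildL x) = child_mean (Em g) x"
proof -
  note [measurable] = L1_wt_measurable[OF g]
  have e: "ennreal (Em g s) = (\<integral>\<^sup>+\<omega>. ennreal (g \<omega>) \<partial>\<kappa> s)" for s
    unfolding Em_def by (intro nn_integral_eq_integral[symmetric] L1_wt_integrable[OF g]) (simp add: nn)
  have E0: "0 \<le> Em g s" for s unfolding Em_def by (simp add: nn)
  have i: "integrable TL (\<lambda>s. keep_prob x (snd s) * Em g s)"
    by (rule integrable_child_mean[of _ C]) (measurable, rule L1_wt_Em_bound[OF g])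
  have ae: "AE s in TL. 0 \<le> keep_prob x (snd s) * Em g s"
    by (intro AE_TLI mult_nonneg_nonneg E0) (use keep_prob_bounds in \<open>auto simp: less_imp_le\<close>)
  have h: "ennreal (kept_part g p) = kept_part (\<lambda>\<omega>. ennreal (g \<omega>)) p" for p by (simp add: kept_part_def)
  have "(\<integral>\<^sup>+p. ennreal (kept_part g p) \<partial>ChildL x) = (\<integral>\<^sup>+s. ennreal (keep_prob x (snd s)) * ennreal (Em g s) \<partial>TL)"
    unfolding h e by (rule nn_integral_kept_part) measurable
  also have "\<dots> = (\<integral>\<^sup>+s. ennreal (keep_prob x (snd s) * Em g s) \<partial>TL)"
  proof (intro nn_integral_cong_AE AE_TLI)
    fix s :: ewt_type assume "0 < snd s"
    then show "ennreal (keep_prob x (snd s)) * ennreal (Em g s) = ennreal (keep_prob x (snd s) * Em g s)"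
      using keep_prob_bounds(1)[of "snd s" x] E0 by (simp add: ennreal_mult)
  qed
  also have "\<dots> = ennreal (child_mean (Em g) x)"
    unfolding child_mean_def by (rule nn_integral_eq_integral[OF i ae])
  finally have n: "(\<integral>\<^sup>+p. ennreal (kept_part g p) \<partial>ChildL x) = ennreal (child_mean (Em g) x)" .
  have S0: "0 \<le> child_mean (Em g) x" unfolding child_mean_def by (rule integral_nonneg_AE[OF ae])
  have h0: "0 \<le> kept_part g p" for p by (simp add: kept_part_def nn)
  show "integrable (ChildL x) (kept_part g)"
    by (intro integrableI_nonneg) (simp_all add: h0 n)
  show "(\<integral>p. kept_part g p \<partial>ChildL x) = child_mean (Em g) x"
    by (subst integral_eq_nn_integral) (simp_all add: h0 n S0)
qed

lemma integral_kept_part: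
  assumes g: "L1_wt g C"
  shows "integrable (ChildL x) (kept_part g)" "(\<integral>p. kept_part g p \<partial>ChildL x) = child_mean (Em g) x"
proof -
  note [measurable] = L1_wt_measurable[OF g]
  define a b where "a \<omega> = max 0 (g \<omega>)" and "b \<omega> = max 0 (- g \<omega>)" for \<omega>
  have [measurable]: "a \<in> borel_measurable tree_space" "b \<in> borel_measurable tree_space"
    unfolding a_def b_def by measurable
  have a: "L1_wt a C" and b: "L1_wt b C"
    by (rule L1_wt_mono[OF g]; simp add: a_def b_def)+
  have gab: "g = (\<lambda>\<omega>. a \<omega> - b \<omega>)" by (auto simp: a_def b_def)
  have h: "kept_part g = (\<lambda>p. kept_part a p - kept_part b p)" unfolding gab by (auto simp: kept_part_def)
  have ab0: "\<And>\<omega>. 0 \<le> a \<omega>" "\<And>\<omega>. 0 \<le> b \<omega>" by (auto simp: a_def b_def)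
  note ia = integral_kept_part_nonneg[OF a ab0(1)] and ib = integral_kept_part_nonneg[OF b ab0(2)]
  show "integrable (ChildL x) (kept_part g)" unfolding h using ia(1) ib(1) by simp
  have "Em g s = Em a s - Em b s" for s
    unfolding Em_def gab by (intro Bochner_Integration.integral_diff L1_wt_integrable[OF a] L1_wt_integrable[OF b])
  then have "child_mean (Em g) x = (\<integral>s. keep_prob x (snd s) * Em a s - keep_prob x (snd s) * Em b s \<partial>TL)"
    by (simp add: child_mean_def right_diff_distrib)
  also have "\<dots> = child_mean (Em a) x - child_mean (Em b) x"
    unfolding child_mean_def
    by (intro Bochner_Integration.integral_diff integrable_child_mean[of _ C] Em_measurable L1_wt_Em_bound a b) auto
  finally show "(\<integral>p. kept_part g p \<partial>ChildL x) = child_mean (Em g) x"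
    unfolding h using ia ib by simp
qed

definition L2_wt :: "(ewt_sample \<Rightarrow> real) \<Rightarrow> real \<Rightarrow> bool" where
  "L2_wt g C \<longleftrightarrow> g \<in> borel_measurable tree_space \<and> L1_wt (\<lambda>\<omega>. (g \<omega>)\<^sup>2) C"

lemma L2_wt_measurable: "L2_wt g C \<Longrightarrow> g \<in> borel_measurable tree_space"
  by (simp add: L2_wt_def)

lemma L2_wt_sq: "L2_wt g C \<Longrightarrow> L1_wt (\<lambda>\<omega>. (g \<omega>)\<^sup>2) C"
  by (simp add: L2_wt_def)

lemma L1_wt_add:
  assumes "L1_wt f C" "L1_wt g D" shows "L1_wt (\<lambda>\<omega>. f \<omega> + g \<omega>) (C + D)"
proof -
  note [measurable] = L1_wt_measurable[OF assms(1)] L1_wt_measurable[OF assms(2)]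
  have "(\<integral>\<^sup>+\<omega>. ennreal \<bar>f \<omega> + g \<omega>\<bar> \<partial>\<kappa> s) \<le> ennreal ((C + D) * wt s)" for s
  proof -
    have "(\<integral>\<^sup>+\<omega>. ennreal \<bar>f \<omega> + g \<omega>\<bar> \<partial>\<kappa> s) \<le> (\<integral>\<^sup>+\<omega>. ennreal \<bar>f \<omega>\<bar> + ennreal \<bar>g \<omega>\<bar> \<partial>\<kappa> s)"
      by (intro nn_integral_mono) (simp flip: ennreal_plus add: ennreal_leI)
    also have "\<dots> = (\<integral>\<^sup>+\<omega>. ennreal \<bar>f \<omega>\<bar> \<partial>\<kappa> s) + (\<integral>\<^sup>+\<omega>. ennreal \<bar>g \<omega>\<bar> \<partial>\<kappa> s)"
      by (rule nn_integral_add) measurable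
    also have "\<dots> \<le> ennreal (C * wt s) + ennreal (D * wt s)"
      by (intro add_mono L1_wtD assms)
    also have "\<dots> = ennreal ((C + D) * wt s)"
      using L1_wt_nonneg[OF assms(1)] L1_wt_nonneg[OF assms(2)] wt_nonneg[of s]
      by (subst ennreal_plus[symmetric]) (auto simp: algebra_simps)
    finally show ?thesis .
  qed
  then show ?thesis using L1_wt_nonneg[OF assms(1)] L1_wt_nonneg[OF assms(2)] by (intro L1_wtI) auto
qed

lemma L1_wt_const: assumes "0 \<le> c" shows "L1_wt (\<lambda>_. c) c"
proof -
  have "ennreal c \<le> ennreal (c * wt s)" for s
    using mult_left_mono[OF wt_ge_1[of s] assms] by (intro ennreal_leI) simp
  with assms show ?thesis
    using prob_space.emeasure_space_1[OF prob_space_ewt_given[of P]] by (intro L1_wtI) simp_all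
qed

text \<open>|g| <= 1 + g^2, and the constant 1 is allowed because the weight is at least 1.\<close>

lemma L2_wt_L1_wt: assumes "L2_wt g C" shows "L1_wt g (1 + C)"
proof (rule L1_wt_mono[OF L1_wt_add[OF L1_wt_const[of 1] L2_wt_sq[OF assms]]])
  show "g \<in> borel_measurable tree_space" by (rule L2_wt_measurable[OF assms])
  fix \<omega>
  have "0 \<le> (\<bar>g \<omega>\<bar> - 1/2)\<^sup>2" by simp
  then have "\<bar>g \<omega>\<bar> \<le> 1 + (g \<omega>)\<^sup>2" by (simp add: power2_eq_square algebra_simps)
  then show "\<bar>g \<omega>\<bar> \<le> \<bar>1 + (g \<omega>)\<^sup>2\<bar>" by simp
qed simp

lemma L2_wt_mult: assumes "L2_wt f C" "L2_wt g D" shows "L1_wt (\<lambda>\<omega>. f \<omega> * g \<omega>) (C + D)"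
proof (rule L1_wt_mono[OF L1_wt_add[OF L2_wt_sq[OF assms(1)] L2_wt_sq[OF assms(2)]]])
  show "(\<lambda>\<omega>. f \<omega> * g \<omega>) \<in> borel_measurable tree_space"
    using L2_wt_measurable[OF assms(1)] L2_wt_measurable[OF assms(2)] by measurable
  show "\<bar>f \<omega> * g \<omega>\<bar> \<le> \<bar>(f \<omega>)\<^sup>2 + (g \<omega>)\<^sup>2\<bar>" for \<omega>
    using abs_mult_le_squares[of "f \<omega>" "g \<omega>"] by simp
qed

lemma L2_wt_diff: assumes "L2_wt f C" "L2_wt g D" shows "L2_wt (\<lambda>\<omega>. f \<omega> - g \<omega>) (2 * C + 2 * D)"
proof -
  note [measurable] = L2_wt_measurable[OF assms(1)] L2_wt_measurable[OF assms(2)]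
  have l: "L1_wt (\<lambda>\<omega>. ((f \<omega>)\<^sup>2 + (g \<omega>)\<^sup>2) + ((f \<omega>)\<^sup>2 + (g \<omega>)\<^sup>2)) ((C + D) + (C + D))"
    by (intro L1_wt_add L2_wt_sq assms)
  have "L1_wt (\<lambda>\<omega>. (f \<omega> - g \<omega>)\<^sup>2) ((C + D) + (C + D))"
  proof (rule L1_wt_mono[OF l])
    fix \<omega>
    have "(f \<omega> - g \<omega>)\<^sup>2 \<le> ((f \<omega>)\<^sup>2 + (g \<omega>)\<^sup>2) + ((f \<omega>)\<^sup>2 + (g \<omega>)\<^sup>2)"
      using zero_le_power2[of "f \<omega> + g \<omega>"] by (simp add: power2_eq_square algebra_simps)
    then show "\<bar>(f \<omega> - g \<omega>)\<^sup>2\<bar> \<le> \<bar>((f \<omega>)\<^sup>2 + (g \<omega>)\<^sup>2) + ((f \<omega>)\<^sup>2 + (g \<omega>)\<^sup>2)\<bar>" by simp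
  qed measurable
  then show ?thesis by (simp add: L2_wt_def algebra_simps)
qed

lemma L2_wt_cmult: assumes "L2_wt f C" shows "L2_wt (\<lambda>\<omega>. c * f \<omega>) (c\<^sup>2 * C)"
proof -
  note [measurable] = L2_wt_measurable[OF assms]
  have "(\<integral>\<^sup>+\<omega>. ennreal \<bar>(c * f \<omega>)\<^sup>2\<bar> \<partial>\<kappa> s) \<le> ennreal (c\<^sup>2 * C * wt s)" for s
  proof -
    have "(\<integral>\<^sup>+\<omega>. ennreal \<bar>(c * f \<omega>)\<^sup>2\<bar> \<partial>\<kappa> s) = (\<integral>\<^sup>+\<omega>. ennreal (c\<^sup>2) * ennreal \<bar>(f \<omega>)\<^sup>2\<bar> \<partial>\<kappa> s)"
      by (simp add: power_mult_distrib ennreal_mult)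
    also have "\<dots> = ennreal (c\<^sup>2) * (\<integral>\<^sup>+\<omega>. ennreal \<bar>(f \<omega>)\<^sup>2\<bar> \<partial>\<kappa> s)"
      by (rule nn_integral_cmult) measurable
    also have "\<dots> \<le> ennreal (c\<^sup>2) * ennreal (C * wt s)"
      by (intro mult_left_mono L1_wtD[OF L2_wt_sq[OF assms]]) simp
    also have "\<dots> = ennreal (c\<^sup>2 * C * wt s)"
      using L1_wt_nonneg[OF L2_wt_sq[OF assms]] wt_nonneg[of s]
      by (subst ennreal_mult[symmetric]) (auto simp: mult.assoc)
    finally show ?thesis .
  qed
  then show ?thesis
    unfolding L2_wt_def using L1_wt_nonneg[OF L2_wt_sq[OF assms]] by (intro conjI L1_wtI) auto
qed

lemma kept_part_mult: "kept_part f p * kept_part g p = kept_part (\<lambda>\<omega>. f \<omega> * g \<omega>) p" for f g :: "ewt_sample \<Rightarrow> real"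
  by (simp add: kept_part_def)

text \<open>The square of a sum of m terms is at most m times the sum of their squares, and each
  square has mean at most C * wtbar. The total m^2 * C * wtbar is again bounded by the
  weight.\<close>

lemma L2_wt_gen_step: assumes g: "L2_wt g C" shows "L2_wt (gen_step g) (C * wtbar)"
proof -
  note [measurable] = L2_wt_measurable[OF g]
  have C: "0 \<le> C" by (rule L1_wt_nonneg[OF L2_wt_sq[OF g]])
  have child_mean: "child_mean (Em (\<lambda>\<omega>. (g \<omega>)\<^sup>2)) x \<le> C * wtbar" for x
  proof -
    have "child_mean (Em (\<lambda>\<omega>. (g \<omega>)\<^sup>2)) x \<le> (\<integral>s. C * wt s \<partial>TL)"
      unfolding child_mean_def
    proof (intro integral_mono_AE integrable_child_mean[of _ C] AE_TLI)
      show "Em (\<lambda>\<omega>. (g \<omega>)\<^sup>2) \<in> borel_measurable borel" by measurable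
      show "\<bar>Em (\<lambda>\<omega>. (g \<omega>)\<^sup>2) s\<bar> \<le> C * wt s" for s by (rule L1_wt_Em_bound[OF L2_wt_sq[OF g]])
      show "integrable TL (\<lambda>s. C * wt s)" by (intro integrable_mult_right integrable_wt)
      fix s :: ewt_type assume s: "0 < snd s"
      have "0 \<le> Em (\<lambda>\<omega>. (g \<omega>)\<^sup>2) s" by (simp add: Em_def)
      then have "keep_prob x (snd s) * Em (\<lambda>\<omega>. (g \<omega>)\<^sup>2) s \<le> 1 * Em (\<lambda>\<omega>. (g \<omega>)\<^sup>2) s"
        by (intro mult_right_mono keep_prob_bounds)
      with L1_wt_Em_bound[OF L2_wt_sq[OF g], of s] show "keep_prob x (snd s) * Em (\<lambda>\<omega>. (g \<omega>)\<^sup>2) s \<le> C * wt s" by simp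
    qed
    then show ?thesis by (simp add: wtbar_def)
  qed
  have "(\<integral>\<^sup>+\<omega>. ennreal ((gen_step g \<omega>)\<^sup>2) \<partial>\<kappa> t) \<le> ennreal (C * wtbar * wt t)" for t
  proof -
    let ?m = "fst t" and ?x = "snd t"
    have i: "integrable (ChildL ?x) (kept_part (\<lambda>\<omega>. (g \<omega>)\<^sup>2))" "(\<integral>p. kept_part (\<lambda>\<omega>. (g \<omega>)\<^sup>2) p \<partial>ChildL ?x) = child_mean (Em (\<lambda>\<omega>. (g \<omega>)\<^sup>2)) ?x"
      using integral_kept_part[OF L2_wt_sq[OF g]] by auto
    have n: "(\<integral>\<^sup>+p. ennreal (kept_part (\<lambda>\<omega>. (g \<omega>)\<^sup>2) p) \<partial>ChildL ?x) = ennreal (child_mean (Em (\<lambda>\<omega>. (g \<omega>)\<^sup>2)) ?x)"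
      using nn_integral_eq_integral[OF i(1)] i(2) by (simp add: kept_part_def)
    have "(\<integral>\<^sup>+\<omega>. ennreal ((gen_step g \<omega>)\<^sup>2) \<partial>\<kappa> t) = (\<integral>\<^sup>+y. ennreal ((\<Sum>j = 1..?m. kept_part g (y j))\<^sup>2) \<partial>Kids ?x)"
      unfolding kappa_graft
      by (subst nn_integral_distr[OF graft_measurable_Kids]) (measurable, simp add: gen_step_graft_Kids cong: nn_integral_cong)
    also have "\<dots> \<le> (\<integral>\<^sup>+y. (\<Sum>j = 1..?m. ennreal (real ?m) * ennreal (kept_part (\<lambda>\<omega>. (g \<omega>)\<^sup>2) (y j))) \<partial>Kids ?x)"
    proof (intro nn_integral_mono)
      fix y :: "nat \<Rightarrow> real \<times> ewt_sample"
      have "(\<Sum>j = 1..?m. kept_part g (y j))\<^sup>2 \<le> (\<Sum>j = 1..?m. (kept_part g (y j))\<^sup>2) * real ?m"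
        using sum_squared_le_sum_of_squares[of "\<lambda>j. kept_part g (y j)" "{1..?m}"] by simp
      also have "\<dots> = (\<Sum>j = 1..?m. real ?m * kept_part (\<lambda>\<omega>. (g \<omega>)\<^sup>2) (y j))"
        by (simp add: sum_distrib_right sum_distrib_left power2_eq_square kept_part_mult mult.commute)
      finally have "ennreal ((\<Sum>j = 1..?m. kept_part g (y j))\<^sup>2) \<le> ennreal (\<Sum>j = 1..?m. real ?m * kept_part (\<lambda>\<omega>. (g \<omega>)\<^sup>2) (y j))"
        by (rule ennreal_leI)
      also have "\<dots> = (\<Sum>j = 1..?m. ennreal (real ?m * kept_part (\<lambda>\<omega>. (g \<omega>)\<^sup>2) (y j)))"
        by (intro sum_ennreal[symmetric]) (simp add: kept_part_def)
      also have "\<dots> = (\<Sum>j = 1..?m. ennreal (real ?m) * ennreal (kept_part (\<lambda>\<omega>. (g \<omega>)\<^sup>2) (y j)))"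
        by (intro sum.cong refl ennreal_mult) (auto simp: kept_part_def)
      finally show "ennreal ((\<Sum>j = 1..?m. kept_part g (y j))\<^sup>2) \<le> (\<Sum>j = 1..?m. ennreal (real ?m) * ennreal (kept_part (\<lambda>\<omega>. (g \<omega>)\<^sup>2) (y j)))" .
    qed
    also have "\<dots> = (\<Sum>j = 1..?m. (\<integral>\<^sup>+y. ennreal (real ?m) * ennreal (kept_part (\<lambda>\<omega>. (g \<omega>)\<^sup>2) (y j)) \<partial>Kids ?x))"
      by (rule nn_integral_sum) simp
    also have "\<dots> = (\<Sum>j = 1..?m. ennreal (real ?m) * ennreal (child_mean (Em (\<lambda>\<omega>. (g \<omega>)\<^sup>2)) ?x))"
      unfolding n[symmetric]
      by (intro sum.cong refl, subst nn_integral_Kids_component[symmetric], auto intro!: nn_integral_cmult)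
    also have "\<dots> \<le> ennreal (real ?m) * (ennreal (real ?m) * ennreal (C * wtbar))"
      using child_mean[of ?x] by (simp add: ennreal_of_nat_eq_real_of_nat) (intro mult_left_mono ennreal_leI, auto)
    also have "\<dots> = ennreal (real ?m * (real ?m * (C * wtbar)))"
      using C wtbar_nonneg by (simp add: ennreal_mult)
    also have "\<dots> \<le> ennreal (C * wtbar * wt t)"
    proof (rule ennreal_leI)
      have "real ?m * real ?m \<le> wt t" by (simp add: wt_def power2_eq_square algebra_simps)
      from mult_left_mono[OF this, of "C * wtbar"] C wtbar_nonneg
      show "real ?m * (real ?m * (C * wtbar)) \<le> C * wtbar * wt t" by (simp add: mult_ac)
    qed
    finally show ?thesis .
  qed
  then show ?thesis unfolding L2_wt_def using C wtbar_nonneg by (intro conjI L1_wtI) simp_all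
qed

lemma L2_wt_gen_sum: "L2_wt g C \<Longrightarrow> \<exists>D. L2_wt (gen_sum l g) D"
  by (induction l) (auto dest: L2_wt_gen_step)

lemma Em_gen_step_Kids:
  assumes [measurable]: "F \<in> borel_measurable tree_space"
    and "\<And>y. y \<in> space (Kids (snd t)) \<Longrightarrow> F (graft t y) = f y"
  shows "Em F t = (\<integral>y. f y \<partial>Kids (snd t))"
  unfolding Em_def kappa_graft using assms
  by (subst integral_distr[OF graft_measurable_Kids]) (auto cong: Bochner_Integration.integral_cong)

lemma Em_gen_step:
  assumes g: "L2_wt g C" shows "Em (gen_step g) t = real (fst t) * child_mean (Em g) (snd t)"
proof -
  note [measurable] = L2_wt_measurable[OF g]
  note h = integral_kept_part[OF L2_wt_L1_wt[OF g], of "snd t"]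
  have "Em (gen_step g) t = (\<integral>y. (\<Sum>j = 1..fst t. kept_part g (y j)) \<partial>Kids (snd t))"
    by (rule Em_gen_step_Kids) (measurable, rule gen_step_graft_Kids)
  also have "\<dots> = (\<Sum>j = 1..fst t. \<integral>y. kept_part g (y j) \<partial>Kids (snd t))"
    by (intro Bochner_Integration.integral_sum integral_Kids_component h) auto
  also have "\<dots> = (\<Sum>j = 1..fst t. child_mean (Em g) (snd t))"
    using integral_Kids_component(2)[OF _ h(1)] h(2) by (intro sum.cong) auto
  finally show ?thesis by simp
qed

text \<open>Of the m^2 pairs of children, m are diagonal and involve a single child; the others
  factor by independence.\<close>

lemma Em_gen_step_mult:
  assumes f: "L2_wt f C" and g: "L2_wt g D"
  shows "Em (\<lambda>\<omega>. gen_step f \<omega> * gen_step g \<omega>) t = real (fst t) * child_mean (Em (\<lambda>\<omega>. f \<omega> * g \<omega>)) (snd t)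
    + real (fst t) * (real (fst t) - 1) * (child_mean (Em f) (snd t) * child_mean (Em g) (snd t))"
proof -
  note [measurable] = L2_wt_measurable[OF f] L2_wt_measurable[OF g]
  let ?m = "fst t" and ?x = "snd t"
  note hf = integral_kept_part[OF L2_wt_L1_wt[OF f], of ?x] and hg = integral_kept_part[OF L2_wt_L1_wt[OF g], of ?x]
    and hfg = integral_kept_part[OF L2_wt_mult[OF f g], of ?x]
  define \<alpha> where "\<alpha> = child_mean (Em (\<lambda>\<omega>. f \<omega> * g \<omega>)) ?x"
  define \<gamma> where "\<gamma> = child_mean (Em f) ?x * child_mean (Em g) ?x"
  have *: "integrable (Kids ?x) (\<lambda>y. kept_part f (y j) * kept_part g (y k)) \<and>
      (\<integral>y. kept_part f (y j) * kept_part g (y k) \<partial>Kids ?x) = (if j = k then \<alpha> else \<gamma>)"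
    if "j \<in> {1..?m}" "k \<in> {1..?m}" for j k
  proof (cases "j = k")
    case True
    then show ?thesis
      using that integral_Kids_component[OF _ hfg(1), of j] hfg(2) by (simp add: kept_part_mult \<alpha>_def)
  next
    case False
    then show ?thesis
      using that integral_Kids_two[OF _ _ False hf(1) hg(1)] hf(2) hg(2) by (simp add: \<gamma>_def)
  qed
  have "Em (\<lambda>\<omega>. gen_step f \<omega> * gen_step g \<omega>) t =
      (\<integral>y. (\<Sum>j = 1..?m. \<Sum>k = 1..?m. kept_part f (y j) * kept_part g (y k)) \<partial>Kids ?x)"
    by (rule Em_gen_step_Kids) (measurable, simp add: gen_step_graft_Kids sum_product)
  also have "\<dots> = (\<Sum>j = 1..?m. \<integral>y. (\<Sum>k = 1..?m. kept_part f (y j) * kept_part g (y k)) \<partial>Kids ?x)"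
    by (intro Bochner_Integration.integral_sum Bochner_Integration.integrable_sum) (use * in auto)
  also have "\<dots> = (\<Sum>j = 1..?m. \<Sum>k = 1..?m. \<integral>y. kept_part f (y j) * kept_part g (y k) \<partial>Kids ?x)"
    by (intro sum.cong refl Bochner_Integration.integral_sum) (use * in auto)
  \<comment> \<open>The diagonal is counted as a correction to the constant \<gamma>.\<close>
  also have "\<dots> = (\<Sum>j = 1..?m. \<Sum>k = 1..?m. (\<alpha> - \<gamma>) * (if j = k then 1 else 0) + \<gamma>)"
    by (intro sum.cong refl) (use * in auto)
  also have "\<dots> = (\<Sum>j = 1..?m. (\<alpha> - \<gamma>) + real ?m * \<gamma>)"
    by (intro sum.cong refl) (simp add: sum.distrib sum_distrib_left[symmetric])
  also have "\<dots> = real ?m * \<alpha> + real ?m * (real ?m - 1) * \<gamma>"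
    by (simp add: algebra_simps)
  finally show ?thesis by (simp add: \<alpha>_def \<gamma>_def)
qed

lemma Em_square_le:
  assumes g: "L2_wt g C" shows "(Em g s)\<^sup>2 \<le> Em (\<lambda>\<omega>. (g \<omega>)\<^sup>2) s"
proof -
  interpret prob_space "\<kappa> s" by (rule prob_space_ewt_given)
  have "variance g = Em (\<lambda>\<omega>. (g \<omega>)\<^sup>2) s - (Em g s)\<^sup>2"
    unfolding Em_def by (rule variance_eq[OF L1_wt_integrable[OF L2_wt_L1_wt[OF g]] L1_wt_integrable[OF L2_wt_sq[OF g]]])
  with variance_positive[of g] show ?thesis by simp
qed

lemma Em_root:
  assumes h: "h \<in> borel_measurable borel" shows "Em (\<lambda>\<omega>. h (vtype \<omega> [])) s = h s"
proof -
  interpret prob_space "\<kappa> s" by (rule prob_space_ewt_given)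
  have [measurable]: "(\<lambda>\<omega>. vtype \<omega> []) \<in> tree_space \<rightarrow>\<^sub>M borel" by (intro vtype_measurable) simp
  have "Em (\<lambda>\<omega>. h (vtype \<omega> [])) s = (\<integral>\<omega>. h s \<partial>\<kappa> s)"
    unfolding Em_def using h AE_kappa_root[of s] by (intro integral_cong_AE) auto
  then show ?thesis using prob_space by simp
qed

lemma root_measurable [measurable]:
  "h \<in> borel_measurable borel \<Longrightarrow> (\<lambda>\<omega>. h (vtype \<omega> [])) \<in> borel_measurable tree_space"
  by (rule measurable_compose[OF vtype_measurable]) auto

lemma L2_wt_root:
  assumes [measurable]: "h \<in> borel_measurable borel" and h: "\<And>s. \<bar>h s\<bar> \<le> C * (1 + real (fst s))"
  shows "L2_wt (\<lambda>\<omega>. h (vtype \<omega> [])) (C\<^sup>2)"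
proof -
  have "(\<integral>\<^sup>+\<omega>. ennreal \<bar>(h (vtype \<omega> []))\<^sup>2\<bar> \<partial>\<kappa> s) \<le> ennreal (C\<^sup>2 * wt s)" for s
  proof -
    interpret prob_space "\<kappa> s" by (rule prob_space_ewt_given)
    have "(\<integral>\<^sup>+\<omega>. ennreal \<bar>(h (vtype \<omega> []))\<^sup>2\<bar> \<partial>\<kappa> s) = (\<integral>\<^sup>+\<omega>. ennreal \<bar>(h s)\<^sup>2\<bar> \<partial>\<kappa> s)"
      using AE_kappa_root[of s] by (intro nn_integral_cong_AE) auto
    also have "\<dots> = ennreal ((h s)\<^sup>2)" using emeasure_space_1 by simp
    also have "\<dots> \<le> ennreal (C\<^sup>2 * wt s)"
      unfolding wt_def power_mult_distrib[symmetric]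
      using h[of s] by (intro ennreal_leI) (metis abs_ge_zero abs_le_square_iff abs_of_nonneg order_trans)
    finally show ?thesis .
  qed
  then show ?thesis unfolding L2_wt_def by (intro conjI L1_wtI) simp_all
qed

end

section \<open>Geometric convergence in the mean square\<close>

text \<open>From |X| <= X^2 / q^l + q^l, second moments of order q^(2 l) give first moments of order
  q^l. The sum of the |X l| then has finite expectation and is almost surely finite.\<close>

lemma summable_of_L2_geometric:
  fixes X :: "nat \<Rightarrow> 'a \<Rightarrow> real"
  assumes "prob_space M" and X [measurable]: "\<And>l. X l \<in> borel_measurable M"
    and i: "\<And>l. integrable M (\<lambda>\<omega>. (X l \<omega>)\<^sup>2)"
    and b: "\<And>l. (\<integral>\<omega>. (X l \<omega>)\<^sup>2 \<partial>M) \<le> K * q ^ (2 * l)" and q: "0 < q" "q < 1"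
  shows "AE \<omega> in M. summable (\<lambda>l. X l \<omega>)"
proof -
  interpret prob_space M by fact
  have le: "(\<integral>\<^sup>+\<omega>. ennreal \<bar>X l \<omega>\<bar> \<partial>M) \<le> ennreal ((K + 1) * q ^ l)" for l
  proof -
    have "(\<integral>\<^sup>+\<omega>. ennreal \<bar>X l \<omega>\<bar> \<partial>M) \<le> (\<integral>\<^sup>+\<omega>. ennreal ((X l \<omega>)\<^sup>2 / q ^ l + q ^ l) \<partial>M)"
    proof (intro nn_integral_mono ennreal_leI)
      fix \<omega>
      have "\<bar>X l \<omega> * q ^ l\<bar> \<le> (X l \<omega>)\<^sup>2 + (q ^ l)\<^sup>2" by (rule abs_mult_le_squares)
      then show "\<bar>X l \<omega>\<bar> \<le> (X l \<omega>)\<^sup>2 / q ^ l + q ^ l"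
        using q by (simp add: field_simps abs_mult power2_eq_square)
    qed
    also have "\<dots> = ennreal (\<integral>\<omega>. (X l \<omega>)\<^sup>2 / q ^ l + q ^ l \<partial>M)"
      using q i by (intro nn_integral_eq_integral) auto
    also have "(\<integral>\<omega>. (X l \<omega>)\<^sup>2 / q ^ l + q ^ l \<partial>M) = (\<integral>\<omega>. (X l \<omega>)\<^sup>2 \<partial>M) / q ^ l + q ^ l"
      using i by (simp add: prob_space)
    also have "\<dots> \<le> (K * q ^ (2 * l)) / q ^ l + q ^ l"
      using q b by (intro add_right_mono divide_right_mono) auto
    also have "\<dots> = (K + 1) * q ^ l"
    proof -
      have "q ^ (2 * l) = q ^ l * q ^ l" by (simp add: mult_2 power_add)
      then show ?thesis using q by (simp add: distrib_right)
    qed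
    finally show ?thesis by (simp add: ennreal_leI)
  qed
  have "0 \<le> K" using order_trans[OF integral_nonneg_AE b[of 0]] by simp
  then have geo: "(\<Sum>l. ennreal ((K + 1) * q ^ l)) = ennreal (\<Sum>l. (K + 1) * q ^ l)"
    using q by (intro suminf_ennreal2 summable_mult summable_geometric) auto
  then have fin: "(\<integral>\<^sup>+\<omega>. (\<Sum>l. ennreal \<bar>X l \<omega>\<bar>) \<partial>M) < \<infinity>"
  proof (subst nn_integral_suminf)
    have "(\<Sum>l. \<integral>\<^sup>+\<omega>. ennreal \<bar>X l \<omega>\<bar> \<partial>M) \<le> (\<Sum>l. ennreal ((K + 1) * q ^ l))"
      by (rule suminf_le[OF le summableI summableI])
    also have "\<dots> < \<infinity>" unfolding geo by simp
    finally show "(\<Sum>l. \<integral>\<^sup>+\<omega>. ennreal \<bar>X l \<omega>\<bar> \<partial>M) < \<infinity>" .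
  qed simp
  have "AE \<omega> in M. (\<Sum>l. ennreal \<bar>X l \<omega>\<bar>) \<noteq> \<infinity>"
    by (rule nn_integral_PInf_AE) (use fin in auto)
  then show ?thesis
  proof eventually_elim
    case (elim \<omega>)
    then have "summable (\<lambda>l. \<bar>X l \<omega>\<bar>)" by (intro summable_suminf_not_top) (auto simp: top_unique)
    then show ?case by (rule summable_rabs_cancel)
  qed
qed

lemma L2_geometric_null:
  fixes X :: "nat \<Rightarrow> 'a \<Rightarrow> real"
  assumes "prob_space M" "\<And>l. X l \<in> borel_measurable M" "\<And>l. integrable M (\<lambda>\<omega>. (X l \<omega>)\<^sup>2)"
    and b: "\<And>l. (\<integral>\<omega>. (X l \<omega>)\<^sup>2 \<partial>M) \<le> K * q ^ (2 * l)" and q: "0 < q" "q < 1"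
  shows "AE \<omega> in M. (\<lambda>l. X l \<omega>) \<longlonglongrightarrow> 0" "(\<lambda>l. \<integral>\<omega>. (X l \<omega>)\<^sup>2 \<partial>M) \<longlonglongrightarrow> 0"
proof -
  show "AE \<omega> in M. (\<lambda>l. X l \<omega>) \<longlonglongrightarrow> 0"
    using summable_of_L2_geometric[OF assms] by eventually_elim (rule summable_LIMSEQ_zero)
  have "(\<lambda>l. K * (q\<^sup>2) ^ l) \<longlonglongrightarrow> K * 0"
    using q by (intro tendsto_mult tendsto_const LIMSEQ_realpow_zero) (auto simp: power_less_one_iff)
  then have l: "(\<lambda>l. K * q ^ (2 * l)) \<longlonglongrightarrow> 0" by (simp add: power_mult)
  show "(\<lambda>l. \<integral>\<omega>. (X l \<omega>)\<^sup>2 \<partial>M) \<longlonglongrightarrow> 0"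
    by (rule tendsto_sandwich[OF _ _ tendsto_const l]) (use b in \<open>auto intro!: always_eventually\<close>)
qed

text \<open>With \<open>q\<^sup>l\<close> as weights, Cauchy-Schwarz bounds the square of the tail \<open>\<Sum>j\<ge>n. X j\<close> by
  \<open>\<Sum>j. X (n + j)\<^sup>2 / q\<^sup>j\<close> up to a constant.\<close>

lemma L2_geometric_limit:
  fixes Y :: "nat \<Rightarrow> 'a \<Rightarrow> real"
  assumes M: "prob_space M" and Y [measurable]: "\<And>l. Y l \<in> borel_measurable M"
    and i: "\<And>l. integrable M (\<lambda>\<omega>. (Y l \<omega>)\<^sup>2)"
    and b: "\<And>l. (\<integral>\<omega>. (Y (Suc l) \<omega> - Y l \<omega>)\<^sup>2 \<partial>M) \<le> K * q ^ (2 * l)" and q: "0 < q" "q < 1"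
  obtains W where "W \<in> borel_measurable M" "integrable M (\<lambda>\<omega>. (W \<omega>)\<^sup>2)"
    "AE \<omega> in M. (\<lambda>l. Y l \<omega>) \<longlonglongrightarrow> W \<omega>" "(\<lambda>l. \<integral>\<omega>. (Y l \<omega> - W \<omega>)\<^sup>2 \<partial>M) \<longlonglongrightarrow> 0"
proof -
  define X where "X l \<omega> = Y (Suc l) \<omega> - Y l \<omega>" for l \<omega>
  have [measurable]: "X l \<in> borel_measurable M" for l unfolding X_def by measurable
  have sq2: "(a - b)\<^sup>2 \<le> 2 * a\<^sup>2 + 2 * b\<^sup>2" for a b :: real
    using zero_le_power2[of "a + b"] by (simp add: power2_eq_square algebra_simps)
  have iX: "integrable M (\<lambda>\<omega>. (X l \<omega>)\<^sup>2)" for l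
    by (rule Bochner_Integration.integrable_bound[of _ "\<lambda>\<omega>. 2 * (Y (Suc l) \<omega>)\<^sup>2 + 2 * (Y l \<omega>)\<^sup>2"])
      (use i sq2 in \<open>auto simp: X_def\<close>)
  \<comment> \<open>\<open>lim\<close> has a value at every point, so W is defined and measurable
    everywhere; the convergence to it holds almost surely.\<close>
  define W where "W \<omega> = lim (\<lambda>l. Y l \<omega>)" for \<omega>
  have W [measurable]: "W \<in> borel_measurable M"
    unfolding W_def by (rule borel_measurable_lim_metric) simp
  have "AE \<omega> in M. summable (\<lambda>l. X l \<omega>)"
    by (rule summable_of_L2_geometric[OF M _ iX b[folded X_def] q]) measurable
  then have lim: "AE \<omega> in M. (\<lambda>l. Y l \<omega>) \<longlonglongrightarrow> W \<omega>"
  proof eventually_elim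
    case (elim \<omega>)
    have "(\<lambda>n. Y 0 \<omega> + (\<Sum>l<n. X l \<omega>)) \<longlonglongrightarrow> Y 0 \<omega> + (\<Sum>l. X l \<omega>)"
      by (intro tendsto_add tendsto_const summable_LIMSEQ elim)
    moreover have "Y 0 \<omega> + (\<Sum>l<n. X l \<omega>) = Y n \<omega>" for n
      unfolding X_def by (subst sum_lessThan_telescope) simp
    ultimately show ?case unfolding W_def by (simp add: convergent_LIMSEQ_iff[symmetric] convergentI)
  qed
  have tail: "(\<integral>\<^sup>+\<omega>. ennreal ((W \<omega> - Y n \<omega>)\<^sup>2) \<partial>M) \<le> ennreal (K / (1 - q)\<^sup>2 * q ^ (2 * n))" for n
  proof -
    have "AE \<omega> in M. ennreal ((W \<omega> - Y n \<omega>)\<^sup>2) \<le> ennreal (1 / (1 - q)) * (\<Sum>j. ennreal ((X (n + j) \<omega>)\<^sup>2 / q ^ j))"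
      using lim
    proof eventually_elim
      case (elim \<omega>)
      let ?R = "ennreal (1 / (1 - q)) * (\<Sum>j. ennreal ((X (n + j) \<omega>)\<^sup>2 / q ^ j))"
      have *: "ennreal ((Y (N + n) \<omega> - Y n \<omega>)\<^sup>2) \<le> ?R" for N
      proof -
        have "Y (N + n) \<omega> - Y n \<omega> = (\<Sum>j<N. sqrt (q ^ j) * (X (n + j) \<omega> / sqrt (q ^ j)))"
          using q sum_lessThan_telescope[of "\<lambda>j. Y (n + j) \<omega>" N] by (simp add: X_def add.commute)
        then have "(Y (N + n) \<omega> - Y n \<omega>)\<^sup>2 \<le> (\<Sum>j<N. (sqrt (q ^ j))\<^sup>2) * (\<Sum>j<N. (X (n + j) \<omega> / sqrt (q ^ j))\<^sup>2)"
          using Cauchy_Schwarz_ineq_sum[of "\<lambda>j. sqrt (q ^ j)" "\<lambda>j. X (n + j) \<omega> / sqrt (q ^ j)" "{..<N}"] by simp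
        also have "\<dots> = (\<Sum>j<N. q ^ j) * (\<Sum>j<N. (X (n + j) \<omega>)\<^sup>2 / q ^ j)"
          using q by (simp add: power_divide)
        also have "\<dots> \<le> (1 / (1 - q)) * (\<Sum>j<N. (X (n + j) \<omega>)\<^sup>2 / q ^ j)"
        proof (intro mult_right_mono sum_nonneg)
          have "(\<Sum>j<N. q ^ j) \<le> (\<Sum>j. q ^ j)"
            using q by (intro sum_le_suminf summable_geometric) auto
          then show "(\<Sum>j<N. q ^ j) \<le> 1 / (1 - q)" using q by (simp add: suminf_geometric)
        qed (use q in auto)
        finally have "ennreal ((Y (N + n) \<omega> - Y n \<omega>)\<^sup>2) \<le> ennreal (1 / (1 - q)) * ennreal (\<Sum>j<N. (X (n + j) \<omega>)\<^sup>2 / q ^ j)"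
          using q by (subst ennreal_mult[symmetric]) (auto intro!: ennreal_leI sum_nonneg)
        also have "ennreal (\<Sum>j<N. (X (n + j) \<omega>)\<^sup>2 / q ^ j) = (\<Sum>j<N. ennreal ((X (n + j) \<omega>)\<^sup>2 / q ^ j))"
          using q by (intro sum_ennreal[symmetric]) auto
        also have "\<dots> \<le> (\<Sum>j. ennreal ((X (n + j) \<omega>)\<^sup>2 / q ^ j))"
          by (intro sum_le_suminf summableI) auto
        finally show ?thesis by (simp add: mult_left_mono)
      qed
      \<comment> \<open>The bound ?R does not depend on N, so it survives the limit.\<close>
      have "(\<lambda>N. ennreal ((Y (N + n) \<omega> - Y n \<omega>)\<^sup>2)) \<longlonglongrightarrow> ennreal ((W \<omega> - Y n \<omega>)\<^sup>2)"
        using LIMSEQ_ignore_initial_segment[OF elim, of n]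
        by (intro tendsto_ennrealI tendsto_power tendsto_diff tendsto_const)
      then show ?case by (rule LIMSEQ_le_const2) (use * in auto)
    qed
    then have "(\<integral>\<^sup>+\<omega>. ennreal ((W \<omega> - Y n \<omega>)\<^sup>2) \<partial>M)
      \<le> (\<integral>\<^sup>+\<omega>. ennreal (1 / (1 - q)) * (\<Sum>j. ennreal ((X (n + j) \<omega>)\<^sup>2 / q ^ j)) \<partial>M)"
      by (rule nn_integral_mono_AE)
    also have "\<dots> = ennreal (1 / (1 - q)) * (\<Sum>j. \<integral>\<^sup>+\<omega>. ennreal ((X (n + j) \<omega>)\<^sup>2 / q ^ j) \<partial>M)"
      by (subst nn_integral_cmult, measurable, subst nn_integral_suminf) auto
    also have "\<dots> \<le> ennreal (1 / (1 - q)) * (\<Sum>j. ennreal (K * q ^ (2 * n) * q ^ j))"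
    proof (intro mult_left_mono suminf_le summableI)
      fix j
      have "(\<integral>\<^sup>+\<omega>. ennreal ((X (n + j) \<omega>)\<^sup>2 / q ^ j) \<partial>M) = ennreal (\<integral>\<omega>. (X (n + j) \<omega>)\<^sup>2 / q ^ j \<partial>M)"
        using iX q by (intro nn_integral_eq_integral) auto
      also have "(\<integral>\<omega>. (X (n + j) \<omega>)\<^sup>2 / q ^ j \<partial>M) \<le> K * q ^ (2 * (n + j)) / q ^ j"
        using b[folded X_def, of "n + j"] q by (simp add: divide_right_mono)
      also have "\<dots> = K * q ^ (2 * n) * q ^ j"
        using q by (simp add: field_simps power_add[symmetric] mult_2)
      finally show "(\<integral>\<^sup>+\<omega>. ennreal ((X (n + j) \<omega>)\<^sup>2 / q ^ j) \<partial>M) \<le> ennreal (K * q ^ (2 * n) * q ^ j)"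
        by (simp add: ennreal_leI)
    qed simp
    also have "(\<Sum>j. ennreal (K * q ^ (2 * n) * q ^ j)) = ennreal (\<Sum>j. K * q ^ (2 * n) * q ^ j)"
    proof (intro suminf_ennreal2 summable_mult summable_geometric)
      have "0 \<le> K" using order_trans[OF integral_nonneg_AE b[of 0]] by simp
      then show "0 \<le> K * q ^ (2 * n) * q ^ j" for j using q by simp
    qed (use q in auto)
    also have "(\<Sum>j. K * q ^ (2 * n) * q ^ j) = K * q ^ (2 * n) * (1 / (1 - q))"
      using q by (subst suminf_mult) (auto simp: suminf_geometric summable_geometric)
    also have "ennreal (1 / (1 - q)) * ennreal (K * q ^ (2 * n) * (1 / (1 - q))) = ennreal (K / (1 - q)\<^sup>2 * q ^ (2 * n))"
      using q by (subst ennreal_mult'[symmetric]) (auto simp: power2_eq_square)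
    finally show ?thesis .
  qed
  have iD: "integrable M (\<lambda>\<omega>. (Y n \<omega> - W \<omega>)\<^sup>2)" for n
    by (rule integrableI_nonneg)
      (use le_less_trans[OF tail[of n]] in \<open>auto simp: power2_commute[of "Y n _"]\<close>)
  have bD: "(\<integral>\<omega>. (Y n \<omega> - W \<omega>)\<^sup>2 \<partial>M) \<le> K / (1 - q)\<^sup>2 * q ^ (2 * n)" for n
  proof -
    have "0 \<le> K" using order_trans[OF integral_nonneg_AE b[of 0]] by simp
    moreover have "ennreal (\<integral>\<omega>. (Y n \<omega> - W \<omega>)\<^sup>2 \<partial>M) \<le> ennreal (K / (1 - q)\<^sup>2 * q ^ (2 * n))"
      using tail[of n] nn_integral_eq_integral[OF iD[of n]] by (simp add: power2_commute[of "W _"])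
    ultimately show ?thesis using q by (subst (asm) ennreal_le_iff) auto
  qed
  have iW: "integrable M (\<lambda>\<omega>. (W \<omega>)\<^sup>2)"
  proof (rule Bochner_Integration.integrable_bound[of _ "\<lambda>\<omega>. 2 * (Y 0 \<omega>)\<^sup>2 + 2 * (Y 0 \<omega> - W \<omega>)\<^sup>2"])
    show "AE \<omega> in M. norm ((W \<omega>)\<^sup>2) \<le> norm (2 * (Y 0 \<omega>)\<^sup>2 + 2 * (Y 0 \<omega> - W \<omega>)\<^sup>2)"
    proof (rule AE_I2)
      fix \<omega>
      show "norm ((W \<omega>)\<^sup>2) \<le> norm (2 * (Y 0 \<omega>)\<^sup>2 + 2 * (Y 0 \<omega> - W \<omega>)\<^sup>2)"
        using sq2[of "Y 0 \<omega>" "Y 0 \<omega> - W \<omega>"] by simp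
    qed
  qed (use i iD in auto)
  show thesis
    by (rule that[OF W iW lim L2_geometric_null(2)[OF M _ iD bD q]]) measurable
qed

text \<open>The \<epsilon>-weighted bound on f * (Y - W) plays the role of Cauchy-Schwarz and makes
  its integral vanish in the limit. The case f = 1 gives the means; f = W gives the second moments
  through Y^2 = (Y - W)^2 + 2 W (Y - W) + W^2.\<close>

lemma L2_limit_moments:
  fixes Y :: "nat \<Rightarrow> 'a \<Rightarrow> real"
  assumes M: "prob_space M" and [measurable]: "\<And>l. Y l \<in> borel_measurable M" "W \<in> borel_measurable M"
    and i: "\<And>l. integrable M (\<lambda>\<omega>. (Y l \<omega>)\<^sup>2)" and iW: "integrable M (\<lambda>\<omega>. (W \<omega>)\<^sup>2)"
    and lim: "(\<lambda>l. \<integral>\<omega>. (Y l \<omega> - W \<omega>)\<^sup>2 \<partial>M) \<longlonglongrightarrow> 0"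
  shows "(\<lambda>l. \<integral>\<omega>. Y l \<omega> \<partial>M) \<longlonglongrightarrow> (\<integral>\<omega>. W \<omega> \<partial>M)"
    "(\<lambda>l. \<integral>\<omega>. (Y l \<omega>)\<^sup>2 \<partial>M) \<longlonglongrightarrow> (\<integral>\<omega>. (W \<omega>)\<^sup>2 \<partial>M)"
proof -
  interpret prob_space M by (rule M)
  note sqi = square_integrable_imp_integrable
  have CS: "\<bar>\<integral>\<omega>. f \<omega> * (Y l \<omega> - W \<omega>) \<partial>M\<bar> \<le> \<epsilon> * (\<integral>\<omega>. (f \<omega>)\<^sup>2 \<partial>M) + (\<integral>\<omega>. (Y l \<omega> - W \<omega>)\<^sup>2 \<partial>M) / \<epsilon>"
    and iCS: "integrable M (\<lambda>\<omega>. f \<omega> * (Y l \<omega> - W \<omega>))" and iD: "integrable M (\<lambda>\<omega>. (Y l \<omega> - W \<omega>)\<^sup>2)"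
    if [measurable]: "f \<in> borel_measurable M" and f: "integrable M (\<lambda>\<omega>. (f \<omega>)\<^sup>2)" and e: "0 < \<epsilon>" for f \<epsilon> l
  proof -
    show iD: "integrable M (\<lambda>\<omega>. (Y l \<omega> - W \<omega>)\<^sup>2)"
    proof (rule Bochner_Integration.integrable_bound[of _ "\<lambda>\<omega>. 2 * (Y l \<omega>)\<^sup>2 + 2 * (W \<omega>)\<^sup>2"])
      have "(a - b)\<^sup>2 \<le> 2 * a\<^sup>2 + 2 * b\<^sup>2" for a b :: real
        using zero_le_power2[of "a + b"] by (simp add: power2_eq_square algebra_simps)
      then show "AE \<omega> in M. norm ((Y l \<omega> - W \<omega>)\<^sup>2) \<le> norm (2 * (Y l \<omega>)\<^sup>2 + 2 * (W \<omega>)\<^sup>2)" by simp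
    qed (use i iW in auto)
    have p: "\<bar>f \<omega> * (Y l \<omega> - W \<omega>)\<bar> \<le> \<epsilon> * (f \<omega>)\<^sup>2 + (Y l \<omega> - W \<omega>)\<^sup>2 / \<epsilon>" for \<omega>
    proof -
      have "\<bar>(sqrt \<epsilon> * f \<omega>) * ((Y l \<omega> - W \<omega>) / sqrt \<epsilon>)\<bar> \<le> (sqrt \<epsilon> * f \<omega>)\<^sup>2 + ((Y l \<omega> - W \<omega>) / sqrt \<epsilon>)\<^sup>2"
        by (rule abs_mult_le_squares)
      then show ?thesis using e by (simp add: power_mult_distrib power_divide)
    qed
    have ib: "integrable M (\<lambda>\<omega>. \<epsilon> * (f \<omega>)\<^sup>2 + (Y l \<omega> - W \<omega>)\<^sup>2 / \<epsilon>)" using f iD by simp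
    show ic: "integrable M (\<lambda>\<omega>. f \<omega> * (Y l \<omega> - W \<omega>))"
      by (rule Bochner_Integration.integrable_bound[OF ib]) (use p e in \<open>auto intro: order_trans\<close>)
    have "\<bar>\<integral>\<omega>. f \<omega> * (Y l \<omega> - W \<omega>) \<partial>M\<bar> \<le> (\<integral>\<omega>. \<bar>f \<omega> * (Y l \<omega> - W \<omega>)\<bar> \<partial>M)"
      using integral_norm_bound[of M "\<lambda>\<omega>. f \<omega> * (Y l \<omega> - W \<omega>)"] by simp
    also have "\<dots> \<le> (\<integral>\<omega>. \<epsilon> * (f \<omega>)\<^sup>2 + (Y l \<omega> - W \<omega>)\<^sup>2 / \<epsilon> \<partial>M)"
      using p by (intro integral_mono integrable_abs ic ib) auto
    also have "\<dots> = \<epsilon> * (\<integral>\<omega>. (f \<omega>)\<^sup>2 \<partial>M) + (\<integral>\<omega>. (Y l \<omega> - W \<omega>)\<^sup>2 \<partial>M) / \<epsilon>"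
      using f iD by simp
    finally show "\<bar>\<integral>\<omega>. f \<omega> * (Y l \<omega> - W \<omega>) \<partial>M\<bar> \<le> \<epsilon> * (\<integral>\<omega>. (f \<omega>)\<^sup>2 \<partial>M) + (\<integral>\<omega>. (Y l \<omega> - W \<omega>)\<^sup>2 \<partial>M) / \<epsilon>" .
  qed
  have null: "(\<lambda>l. \<integral>\<omega>. f \<omega> * (Y l \<omega> - W \<omega>) \<partial>M) \<longlonglongrightarrow> 0"
    if [measurable]: "f \<in> borel_measurable M" and f: "integrable M (\<lambda>\<omega>. (f \<omega>)\<^sup>2)" for f
  proof (rule LIMSEQ_I)
    fix e :: real assume e: "0 < e"
    define I where "I = (\<integral>\<omega>. (f \<omega>)\<^sup>2 \<partial>M)"
    have I: "0 \<le> I" by (simp add: I_def)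
    \<comment> \<open>The +1 keeps the denominator positive when f is null; with this \<epsilon> the
      first summand of the bound is below e / 2.\<close>
    define \<epsilon> where "\<epsilon> = e / (2 * (I + 1))"
    have \<epsilon>: "0 < \<epsilon>" using e I by (simp add: \<epsilon>_def)
    have eI: "\<epsilon> * I < e / 2" using e I by (simp add: \<epsilon>_def field_simps)
    have "\<forall>\<^sub>F l in sequentially. (\<integral>\<omega>. (Y l \<omega> - W \<omega>)\<^sup>2 \<partial>M) < \<epsilon> * (e / 2)"
      by (rule order_tendstoD(2)[OF lim]) (use \<epsilon> e in simp)
    then obtain N where N: "\<And>l. N \<le> l \<Longrightarrow> (\<integral>\<omega>. (Y l \<omega> - W \<omega>)\<^sup>2 \<partial>M) < \<epsilon> * (e / 2)"
      by (auto simp: eventually_sequentially)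
    show "\<exists>N. \<forall>l\<ge>N. norm ((\<integral>\<omega>. f \<omega> * (Y l \<omega> - W \<omega>) \<partial>M) - 0) < e"
    proof (intro exI allI impI)
      fix l assume "N \<le> l"
      have "(\<integral>\<omega>. (Y l \<omega> - W \<omega>)\<^sup>2 \<partial>M) / \<epsilon> < e / 2"
        using N[OF \<open>N \<le> l\<close>] \<epsilon> by (simp add: field_simps)
      then have "\<bar>\<integral>\<omega>. f \<omega> * (Y l \<omega> - W \<omega>) \<partial>M\<bar> < e"
        using CS[OF that \<epsilon>, of l] eI unfolding I_def by linarith
      then show "norm ((\<integral>\<omega>. f \<omega> * (Y l \<omega> - W \<omega>) \<partial>M) - 0) < e"
        by simp
    qed
  qed
  have "integrable M (Y l)" "integrable M W" for l by (rule sqi; simp add: i iW)+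
  then have "(\<integral>\<omega>. 1 * (Y l \<omega> - W \<omega>) \<partial>M) = (\<integral>\<omega>. Y l \<omega> \<partial>M) - (\<integral>\<omega>. W \<omega> \<partial>M)" for l by simp
  with null[of "\<lambda>_. 1"] show "(\<lambda>l. \<integral>\<omega>. Y l \<omega> \<partial>M) \<longlonglongrightarrow> (\<integral>\<omega>. W \<omega> \<partial>M)"
    by (simp add: LIM_zero_iff)
  have "(\<integral>\<omega>. (Y l \<omega>)\<^sup>2 \<partial>M) = (\<integral>\<omega>. (Y l \<omega> - W \<omega>)\<^sup>2 \<partial>M) + 2 * (\<integral>\<omega>. W \<omega> * (Y l \<omega> - W \<omega>) \<partial>M) + (\<integral>\<omega>. (W \<omega>)\<^sup>2 \<partial>M)" for l
  proof -
    have "(\<integral>\<omega>. (Y l \<omega>)\<^sup>2 \<partial>M) = (\<integral>\<omega>. (Y l \<omega> - W \<omega>)\<^sup>2 + 2 * (W \<omega> * (Y l \<omega> - W \<omega>)) + (W \<omega>)\<^sup>2 \<partial>M)"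
      by (intro Bochner_Integration.integral_cong) (auto simp: power2_eq_square algebra_simps)
    then show ?thesis using iD[of W 1 l] iCS[of W 1 l] iW by simp
  qed
  moreover have "(\<lambda>l. (\<integral>\<omega>. (Y l \<omega> - W \<omega>)\<^sup>2 \<partial>M) + 2 * (\<integral>\<omega>. W \<omega> * (Y l \<omega> - W \<omega>) \<partial>M) + (\<integral>\<omega>. (W \<omega>)\<^sup>2 \<partial>M))
     \<longlonglongrightarrow> 0 + 2 * 0 + (\<integral>\<omega>. (W \<omega>)\<^sup>2 \<partial>M)"
    by (intro tendsto_add tendsto_mult tendsto_const lim null iW) simp
  ultimately show "(\<lambda>l. \<integral>\<omega>. (Y l \<omega>)\<^sup>2 \<partial>M) \<longlonglongrightarrow> (\<integral>\<omega>. (W \<omega>)\<^sup>2 \<partial>M)" by simp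
qed

section \<open>The mean operator\<close>

context ewt_params begin

section \<open>Growth bounds for the mean operator\<close>

definition mu_type :: "ewt_type \<Rightarrow> real" where "mu_type s = real (fst s) * ut (snd s)"

definition mean_op :: "(ewt_type \<Rightarrow> real) \<Rightarrow> ewt_type \<Rightarrow> real" where
  "mean_op h t = real (fst t) * child_mean h (snd t)"

text \<open>For v > 0 the density v * ut v is f0(v): integration against \<nu>. By
  \<open>left_ev_mean_op\<close> this is a left eigenfunctional of the mean operator.\<close>

definition left_ev :: "(ewt_type \<Rightarrow> real) \<Rightarrow> real" where
  "left_ev h = (\<integral>s. (snd s * ut (snd s)) * h s \<partial>TL)"

text \<open>One admissible constant is fixed here, as in \<open>utmin\<close> below, so that the
  contraction rate can be a constant of the development.\<close>

definition utmax :: real where "utmax = (SOME c. 0 < c \<and> (\<forall>x. ut x \<le> c * decay x))"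

lemma utmax: "0 < utmax" "ut x \<le> utmax * decay x"
  using someI_ex[OF ut_upper] by (auto simp: utmax_def)

definition utmin :: real where "utmin = (SOME c. 0 < c \<and> (\<forall>x. c * decay x \<le> ut x))"

lemma utmin: "0 < utmin" "utmin * decay x \<le> ut x"
  using someI_ex[OF ut_lower] by (auto simp: utmin_def)

lemma ut_le: "ut x \<le> utmax"
  using utmax(2)[of x] mult_left_mono[OF decay_bounds(2)[of x] less_imp_le[OF utmax(1)]] by linarith

lemma mu_type_measurable [measurable]: "mu_type \<in> borel_measurable borel"
  unfolding mu_type_def[abs_def] by measurable

lemma mu_type_nonneg: "0 \<le> mu_type s"
  using ut_pos by (simp add: mu_type_def less_imp_le)

lemma mu_type_le: "mu_type s \<le> utmax * real (fst s)"
  using mult_right_mono[OF ut_le, of "real (fst s)" "snd s"] by (simp add: mu_type_def mult.commute)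

lemma fst_le_wt: "real (fst s) \<le> wt s" "(real (fst s))\<^sup>2 \<le> wt s"
  by (simp_all add: wt_def power2_eq_square algebra_simps)

lemma mu_type_wt: "\<bar>mu_type s\<bar> \<le> utmax * wt s"
  unfolding abs_of_nonneg[OF mu_type_nonneg]
  using mu_type_le[of s] mult_left_mono[OF fst_le_wt(1)[of s] less_imp_le[OF utmax(1)]] by linarith

lemma mu_type_sq_wt: "(mu_type s)\<^sup>2 \<le> utmax\<^sup>2 * wt s"
proof -
  have "(mu_type s)\<^sup>2 \<le> (utmax * real (fst s))\<^sup>2"
    using mu_type_nonneg mu_type_le by (intro power_mono) auto
  also have "\<dots> = utmax\<^sup>2 * (real (fst s))\<^sup>2" by (simp add: power_mult_distrib)
  also have "\<dots> \<le> utmax\<^sup>2 * wt s" by (intro mult_left_mono fst_le_wt) simp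
  finally show ?thesis .
qed

lemma child_mean_mu_type: "child_mean mu_type x = \<beta> * ut x"
  using ut_eigen[of x] by (simp add: child_mean_def mu_type_def)

lemma mean_op_mu_type: "mean_op mu_type t = \<beta> * mu_type t"
  by (simp add: mean_op_def child_mean_mu_type mu_type_def)

lemma child_mean_measurable [measurable]:
  assumes [measurable]: "h \<in> borel_measurable borel" shows "child_mean h \<in> borel_measurable borel"
proof -
  interpret prob_space TL by (rule prob_TL)
  show ?thesis unfolding child_mean_def[abs_def] by measurable
qed

lemma mean_op_measurable [measurable]:
  assumes [measurable]: "h \<in> borel_measurable borel" shows "mean_op h \<in> borel_measurable borel"
  unfolding mean_op_def[abs_def] by measurable

lemma child_mean_mono:
  assumes [measurable]: "g \<in> borel_measurable borel" "h \<in> borel_measurable borel"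
    and b: "\<And>s. 0 < snd s \<Longrightarrow> \<bar>g s\<bar> \<le> C * wt s" "\<And>s. 0 < snd s \<Longrightarrow> \<bar>h s\<bar> \<le> D * wt s"
    and le: "\<And>s. 0 < snd s \<Longrightarrow> g s \<le> h s"
  shows "child_mean g x \<le> child_mean h x"
  unfolding child_mean_def
proof (intro integral_mono_AE AE_TLI mult_left_mono le)
  show "integrable TL (\<lambda>s. keep_prob x (snd s) * g s)" by (rule integrable_child_mean[OF _ b(1)]) measurable
  show "integrable TL (\<lambda>s. keep_prob x (snd s) * h s)" by (rule integrable_child_mean[OF _ b(2)]) measurable
qed (use keep_prob_bounds in \<open>auto simp: less_imp_le\<close>)

lemma child_mean_add:
  assumes [measurable]: "g \<in> borel_measurable borel" "h \<in> borel_measurable borel"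
    and b: "\<And>s. 0 < snd s \<Longrightarrow> \<bar>g s\<bar> \<le> C * wt s" "\<And>s. 0 < snd s \<Longrightarrow> \<bar>h s\<bar> \<le> D * wt s"
  shows "child_mean (\<lambda>s. g s + h s) x = child_mean g x + child_mean h x"
proof -
  have "integrable TL (\<lambda>s. keep_prob x (snd s) * g s)" by (rule integrable_child_mean[OF _ b(1)]) measurable
  moreover have "integrable TL (\<lambda>s. keep_prob x (snd s) * h s)" by (rule integrable_child_mean[OF _ b(2)]) measurable
  ultimately show ?thesis by (simp add: child_mean_def distrib_left)
qed

lemma child_mean_cmult: "child_mean (\<lambda>s. c * h s) x = c * child_mean h x"
proof -
  have "child_mean (\<lambda>s. c * h s) x = (\<integral>s. c * (keep_prob x (snd s) * h s) \<partial>TL)" by (simp add: child_mean_def mult_ac)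
  then show ?thesis by (simp add: child_mean_def)
qed

lemma child_mean_cong: 
  assumes "\<And>s. 0 < snd s \<Longrightarrow> g s = h s"
    and [measurable]: "g \<in> borel_measurable borel" "h \<in> borel_measurable borel"
  shows "child_mean g x = child_mean h x"
  unfolding child_mean_def
proof (intro integral_cong_AE AE_TLI)
  fix s :: ewt_type assume "0 < snd s"
  from assms(1)[OF this] show "keep_prob x (snd s) * g s = keep_prob x (snd s) * h s" by simp
qed measurable

definition Wbar :: real where "Wbar = (\<integral>s. (1 + snd s) * wt s \<partial>TL)"

lemma Wbar_nonneg: "0 \<le> Wbar"
  unfolding Wbar_def by (intro integral_nonneg_AE AE_TLI) (simp add: wt_nonneg)

text \<open>\<open>keep_prob_upper\<close> separates off \<open>decay x\<close>, which is at most ut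
  x / utmin, and leaves the integrable factor (1 + v) * wt. So after one application of the mean
  operator any function of growth \<open>wt\<close> is bounded by a multiple of
  \<open>mu_type\<close>.\<close>

lemma child_mean_wt_bound:
  assumes [measurable]: "h \<in> borel_measurable borel" and h: "\<And>s. 0 < snd s \<Longrightarrow> \<bar>h s\<bar> \<le> C * wt s" and C: "0 \<le> C"
  shows "\<bar>child_mean h x\<bar> \<le> C * Wbar / utmin * ut x"
proof -
  have "\<bar>child_mean h x\<bar> \<le> (\<integral>s. \<bar>keep_prob x (snd s) * h s\<bar> \<partial>TL)"
    unfolding child_mean_def using integral_norm_bound[of TL "\<lambda>s. keep_prob x (snd s) * h s"] by simp
  also have "\<dots> \<le> (\<integral>s. decay x * C * ((1 + snd s) * wt s) \<partial>TL)"
  proof (intro integral_mono_AE AE_TLI)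
    show "integrable TL (\<lambda>s. \<bar>keep_prob x (snd s) * h s\<bar>)" by (intro integrable_abs integrable_child_mean[OF _ h]) measurable
    show "integrable TL (\<lambda>s. decay x * C * ((1 + snd s) * wt s))" by (intro integrable_mult_right integrable_wt_snd)
    fix s :: ewt_type assume s: "0 < snd s"
    have "\<bar>keep_prob x (snd s) * h s\<bar> = keep_prob x (snd s) * \<bar>h s\<bar>"
      using keep_prob_bounds(1)[OF s, of x] by (simp add: abs_mult)
    also have "\<dots> \<le> (decay x * max 1 (snd s)) * (C * wt s)"
      using keep_prob_upper[OF s, of x] keep_prob_bounds(1)[OF s, of x] h[OF s] by (intro mult_mono) auto
    also have "\<dots> \<le> (decay x * (1 + snd s)) * (C * wt s)"
      using s decay_bounds[of x] C wt_nonneg[of s] by (intro mult_right_mono mult_left_mono) auto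
    finally show "\<bar>keep_prob x (snd s) * h s\<bar> \<le> decay x * C * ((1 + snd s) * wt s)" by (simp add: mult_ac)
  qed
  also have "\<dots> = decay x * (C * Wbar)" by (simp add: Wbar_def)
  also have "\<dots> \<le> (ut x / utmin) * (C * Wbar)"
    using utmin C Wbar_nonneg by (intro mult_right_mono) (auto simp: field_simps)
  finally show ?thesis by (simp add: field_simps)
qed

lemma mean_op_wt_bound:
  assumes "h \<in> borel_measurable borel" "\<And>s. 0 < snd s \<Longrightarrow> \<bar>h s\<bar> \<le> C * wt s" "0 \<le> C"
  shows "\<bar>mean_op h t\<bar> \<le> C * Wbar / utmin * mu_type t"
  using mult_left_mono[OF child_mean_wt_bound[OF assms, of "snd t"] of_nat_0_le_iff[of "fst t"]]
  unfolding mean_op_def mu_type_def abs_mult abs_of_nat by (simp only: mult_ac)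

lemma integrable_left_ev:
  assumes [measurable]: "h \<in> borel_measurable borel" and h: "\<And>s. 0 < snd s \<Longrightarrow> \<bar>h s\<bar> \<le> C * wt s"
  shows "integrable TL (\<lambda>s. (snd s * ut (snd s)) * h s)"
proof (rule integrable_TL_bound[of _ "utmax * C"])
  fix s :: ewt_type assume s: "0 < snd s"
  have "\<bar>(snd s * ut (snd s)) * h s\<bar> = (snd s * ut (snd s)) * \<bar>h s\<bar>"
    using s ut_pos[of "snd s"] by (simp add: abs_mult)
  also have "\<dots> \<le> ((1 + snd s) * utmax) * (C * wt s)"
    using s ut_pos[of "snd s"] ut_le[of "snd s"] h[OF s] utmax(1) by (intro mult_mono) auto
  finally show "\<bar>(snd s * ut (snd s)) * h s\<bar> \<le> utmax * C * ((1 + snd s) * wt s)" by (simp add: mult_ac)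
qed measurable

lemma left_ev_mu_type: "left_ev mu_type = 1"
  using ut_normalized by (simp add: left_ev_def mu_type_def)

lemma left_ev_nubar: "A \<in> sets type_space \<Longrightarrow> left_ev (indicator A) = nubar P A"
  by (simp add: left_ev_def nubar_eq)

lemma keep_prob_swap: "0 < y \<Longrightarrow> 0 < z \<Longrightarrow> y * keep_prob y z = z * keep_prob z y"
  using keep_prob_mult[of y z] keep_prob_mult[of z y] by (simp add: min.commute)

text \<open>Reversibility: \<open>z * keep_prob z z'\<close> is symmetric.\<close>

lemma left_ev_mean_op:
  assumes [measurable]: "h \<in> borel_measurable borel" and h: "\<And>s. 0 < snd s \<Longrightarrow> \<bar>h s\<bar> \<le> C * wt s"
  shows "left_ev (mean_op h) = \<beta> * left_ev h"
proof -
  interpret T: prob_space TL by (rule prob_TL)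
  interpret pair_sigma_finite TL TL ..
  let ?f = "\<lambda>s s'. (snd s * ut (snd s)) * (real (fst s) * (keep_prob (snd s) (snd s') * h s'))"
  have int: "integrable (TL \<Otimes>\<^sub>M TL) (\<lambda>(s, s'). ?f s s')"
  proof (rule Bochner_Integration.integrable_bound)
    show "integrable (TL \<Otimes>\<^sub>M TL) (\<lambda>(s, s'). (utmax * \<bar>C\<bar>) * ((1 + snd s) * wt s) * wt s')"
    proof (rule Fubini_integrable)
      have "(\<integral>s'. norm ((utmax * \<bar>C\<bar>) * ((1 + snd s) * wt s) * wt s') \<partial>TL) = \<bar>(utmax * \<bar>C\<bar>) * ((1 + snd s) * wt s)\<bar> * wtbar" for s
        by (simp add: abs_mult wtbar_def wt_nonneg)
      moreover have "integrable TL (\<lambda>s. \<bar>(utmax * \<bar>C\<bar>) * ((1 + snd s) * wt s)\<bar> * wtbar)"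
        by (intro integrable_mult_left integrable_abs integrable_mult_right integrable_wt_snd)
      ultimately show "integrable TL (\<lambda>s. \<integral>s'. norm (case (s, s') of (s, s') \<Rightarrow> (utmax * \<bar>C\<bar>) * ((1 + snd s) * wt s) * wt s') \<partial>TL)"
        by simp
      show "AE s in TL. integrable TL (\<lambda>s'. case (s, s') of (s, s') \<Rightarrow> (utmax * \<bar>C\<bar>) * ((1 + snd s) * wt s) * wt s')"
        by (simp add: integrable_wt)
    qed measurable
    have "AE p in TL \<Otimes>\<^sub>M TL. 0 < snd (fst p) \<and> 0 < snd (snd p)"
      by (rule AE_pair_measure) (measurable, use AE_TL_pos in auto)
    then show "AE p in TL \<Otimes>\<^sub>M TL. norm (case p of (s, s') \<Rightarrow> ?f s s')
      \<le> norm (case p of (s, s') \<Rightarrow> (utmax * \<bar>C\<bar>) * ((1 + snd s) * wt s) * wt s')"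
    proof eventually_elim
      case (elim p)
      obtain s s' where p: "p = (s, s')" by (cases p)
      have s: "0 < snd s" "0 < snd s'" using elim by (auto simp: p)
      have "\<bar>?f s s'\<bar> = (snd s * ut (snd s)) * (real (fst s) * (keep_prob (snd s) (snd s') * \<bar>h s'\<bar>))"
        using s ut_pos[of "snd s"] keep_prob_bounds(1)[OF s(2), of "snd s"] by (simp add: abs_mult)
      also have "\<dots> \<le> ((1 + snd s) * utmax) * (wt s * (1 * (\<bar>C\<bar> * wt s')))"
      proof (intro mult_mono)
        show "\<bar>h s'\<bar> \<le> \<bar>C\<bar> * wt s'"
          using h[OF s(2)] mult_right_mono[OF abs_ge_self[of C] wt_nonneg[of s']] by linarith
      qed (use s ut_pos[of "snd s"] ut_le[of "snd s"] keep_prob_bounds(1)[OF s(2), of "snd s"] keep_prob_bounds(2)[of "snd s" "snd s'"]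
          fst_le_wt(1)[of s] wt_nonneg utmax(1) in \<open>auto simp: less_imp_le\<close>)
      finally show ?case
        using s utmax(1) by (simp add: p abs_mult wt_nonneg mult_ac)
    qed
  qed measurable
  have "left_ev (mean_op h) = (\<integral>s. (\<integral>s'. ?f s s' \<partial>TL) \<partial>TL)"
    unfolding left_ev_def mean_op_def child_mean_def by simp
  also have "\<dots> = (\<integral>s'. (\<integral>s. ?f s s' \<partial>TL) \<partial>TL)"
    by (rule Fubini_integral[OF int, symmetric])
  also have "\<dots> = (\<integral>s'. \<beta> * ((snd s' * ut (snd s')) * h s') \<partial>TL)"
  proof (intro integral_cong_AE AE_TLI)
    show "(\<lambda>s'. \<integral>s. ?f s s' \<partial>TL) \<in> borel_measurable TL" by measurable
    fix s' :: ewt_type assume s': "0 < snd s'"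
    \<comment> \<open>The symmetry of the kernel moves the weight from v to v', and what is left to
      integrate over s is the right eigenfunction.\<close>
    have "(\<integral>s. ?f s s' \<partial>TL) = (\<integral>s. (snd s' * h s') * (keep_prob (snd s') (snd s) * mu_type s) \<partial>TL)"
    proof (intro integral_cong_AE AE_TLI)
      fix s :: ewt_type assume s: "0 < snd s"
      have "?f s s' = (snd s * keep_prob (snd s) (snd s')) * (ut (snd s) * real (fst s) * h s')" by (simp add: mult_ac)
      also have "\<dots> = (snd s' * keep_prob (snd s') (snd s)) * (ut (snd s) * real (fst s) * h s')"
        by (simp only: keep_prob_swap[OF s s'])
      finally show "?f s s' = (snd s' * h s') * (keep_prob (snd s') (snd s) * mu_type s)" by (simp add: mu_type_def mult_ac)
    qed measurable
    also have "\<dots> = (snd s' * h s') * child_mean mu_type (snd s')" by (simp add: child_mean_def)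
    finally show "(\<integral>s. ?f s s' \<partial>TL) = \<beta> * ((snd s' * ut (snd s')) * h s')" by (simp add: child_mean_mu_type mult_ac)
  qed measurable
  finally show ?thesis by (simp add: left_ev_def)
qed

text \<open>The eigenvalue of \<open>mu_type\<close>, reduced by what the minorizing kernel 1 /
  utmax^2 * ut x * (z * ut z) contributes to it.\<close>

definition \<rho> :: real where "\<rho> = \<beta> - 1 / utmax\<^sup>2"

text \<open>ut x <= utmax * decay x and z * ut z <= utmax * min 1 z, each factor costing one utmax;
  the product decay x * min 1 z lies below the kernel by \<open>keep_prob_lower\<close>.\<close>

lemma keep_prob_minorization: assumes z: "0 < z" shows "1 / utmax\<^sup>2 * (ut x * (z * ut z)) \<le> keep_prob x z"
proof -
  have "z * ut z \<le> utmax * min 1 z"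
  proof -
    have "z * ut z \<le> z * (utmax * decay z)" using z utmax by (intro mult_left_mono) auto
    also have "\<dots> = utmax * min 1 z" using z by (auto simp: decay_def min_def max_def)
    finally show ?thesis .
  qed
  then have "ut x * (z * ut z) \<le> (utmax * decay x) * (utmax * min 1 z)"
    using utmax(1) utmax(2)[of x] ut_pos[of z] z decay_bounds(1)[of x]
    by (intro mult_mono[of "ut x"]) auto
  also have "\<dots> \<le> utmax\<^sup>2 * keep_prob x z"
    using mult_left_mono[OF keep_prob_lower[OF z, of x], of "utmax\<^sup>2"] by (simp add: power2_eq_square mult_ac)
  finally show ?thesis using utmax(1) by (simp add: field_simps)
qed

text \<open>Doeblin: on the kernel of \<open>left_ev\<close> one may subtract the minorizing rank-one kernel for free.\<close>

lemma child_mean_contraction: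
  assumes [measurable]: "h \<in> borel_measurable borel" and h: "\<And>s. 0 < snd s \<Longrightarrow> \<bar>h s\<bar> \<le> c * mu_type s"
    and P0: "left_ev h = 0" and c: "0 \<le> c"
  shows "\<bar>child_mean h x\<bar> \<le> c * \<rho> * ut x"
proof -
  let ?d = "1 / utmax\<^sup>2"
  let ?k = "\<lambda>s. keep_prob x (snd s) - ?d * (ut x * (snd s * ut (snd s)))"
  have hw: "\<bar>h s\<bar> \<le> (c * utmax) * wt s" if "0 < snd s" for s
    using h[OF that] mult_left_mono[OF mu_type_wt[of s] c] mu_type_nonneg[of s] by (simp add: mult.assoc)
  have i: "integrable TL (\<lambda>s. ?k s * g s)" "(\<integral>s. ?k s * g s \<partial>TL) = child_mean g x - ?d * ut x * left_ev g"
    if [measurable]: "g \<in> borel_measurable borel" and g: "\<And>s. 0 < snd s \<Longrightarrow> \<bar>g s\<bar> \<le> D * wt s" for g D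
  proof -
    have a: "integrable TL (\<lambda>s. keep_prob x (snd s) * g s)" by (rule integrable_child_mean[OF _ g]) measurable
    have b: "integrable TL (\<lambda>s. (?d * ut x) * ((snd s * ut (snd s)) * g s))"
      by (intro integrable_mult_right integrable_left_ev[OF _ g]) measurable
    have e: "?k s * g s = keep_prob x (snd s) * g s - (?d * ut x) * ((snd s * ut (snd s)) * g s)" for s
      by (simp add: algebra_simps)
    show "integrable TL (\<lambda>s. ?k s * g s)" unfolding e using a b by simp
    show "(\<integral>s. ?k s * g s \<partial>TL) = child_mean g x - ?d * ut x * left_ev g"
      unfolding e Bochner_Integration.integral_diff[OF a b] by (simp add: child_mean_def left_ev_def)
  qed
  have "\<bar>child_mean h x\<bar> = \<bar>\<integral>s. ?k s * h s \<partial>TL\<bar>" using i(2)[OF _ hw] P0 by simp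
  also have "\<dots> \<le> (\<integral>s. \<bar>?k s * h s\<bar> \<partial>TL)"
    using integral_norm_bound[of TL "\<lambda>s. ?k s * h s"] by simp
  also have "\<dots> \<le> (\<integral>s. c * (?k s * mu_type s) \<partial>TL)"
  proof (intro integral_mono_AE AE_TLI)
    show "integrable TL (\<lambda>s. \<bar>?k s * h s\<bar>)" by (intro integrable_abs i(1)[OF _ hw]) measurable
    show "integrable TL (\<lambda>s. c * (?k s * mu_type s))" by (intro integrable_mult_right i(1)[OF _ mu_type_wt]) measurable
    fix s :: ewt_type assume s: "0 < snd s"
    have k: "0 \<le> ?k s" using keep_prob_minorization[OF s, of x] by simp
    then have "\<bar>?k s * h s\<bar> = ?k s * \<bar>h s\<bar>" by (simp add: abs_mult)
    also have "\<dots> \<le> ?k s * (c * mu_type s)" by (intro mult_left_mono h s k)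
    finally show "\<bar>?k s * h s\<bar> \<le> c * (?k s * mu_type s)" by (simp add: mult_ac)
  qed
  \<comment> \<open>On \<open>mu_type\<close> the subtraction is not free: \<open>left_ev\<close> is
    1 there, so the whole constant 1 / utmax^2 is gained.\<close>
  also have "\<dots> = c * (child_mean mu_type x - ?d * ut x * left_ev mu_type)"
    using i(2)[OF _ mu_type_wt] by simp
  also have "\<dots> = c * \<rho> * ut x" by (simp add: child_mean_mu_type left_ev_mu_type \<rho>_def algebra_simps)
  finally show ?thesis .
qed

lemma mean_op_contraction:
  assumes "h \<in> borel_measurable borel" "\<And>s. 0 < snd s \<Longrightarrow> \<bar>h s\<bar> \<le> c * mu_type s" "left_ev h = 0" "0 \<le> c"
  shows "\<bar>mean_op h t\<bar> \<le> c * \<rho> * mu_type t"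
  using mult_left_mono[OF child_mean_contraction[OF assms, of "snd t"] of_nat_0_le_iff[of "fst t"]]
  unfolding mean_op_def mu_type_def abs_mult abs_of_nat by (simp only: mult_ac)

lemma rho_bounds: "0 \<le> \<rho>" "\<rho> < \<beta>"
proof -
  \<comment> \<open>The contraction for h = 0 with c = 1 reads 0 <= \<rho> * ut 0, which avoids
    comparing beta with utmax directly.\<close>
  have "\<bar>child_mean (\<lambda>_. 0) 0\<bar> \<le> 1 * \<rho> * ut 0"
    using mu_type_nonneg by (intro child_mean_contraction) (auto simp: left_ev_def)
  then show "0 \<le> \<rho>" using ut_pos[of 0] by (simp add: child_mean_def zero_le_mult_iff)
  show "\<rho> < \<beta>" using utmax(1) by (simp add: \<rho>_def)
qed

section \<open>Decay of first and second moments along the generations\<close>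

lemma Em_gen_step_mean_op: "L2_wt g C \<Longrightarrow> Em (gen_step g) = mean_op (Em g)"
  by (intro ext) (simp add: Em_gen_step mean_op_def)

text \<open>The bound starts at generation one: g itself is controlled only by \<open>wt\<close>,
  and it takes one application of the mean operator to reach a multiple of \<open>mu_type\<close>,
  on which the contraction acts.\<close>

lemma Em_gen_sum_bound:
  assumes g: "L2_wt g C" and P0: "left_ev (Em g) = 0"
  shows "\<bar>Em (gen_sum (Suc l) g) t\<bar> \<le> ((1 + C) * Wbar / utmin) * \<rho> ^ l * mu_type t" "left_ev (Em (gen_sum (Suc l) g)) = 0"
proof -
  let ?a = "(1 + C) * Wbar / utmin"
  have C: "0 \<le> C" by (rule L1_wt_nonneg[OF L2_wt_sq[OF g]])
  have a: "0 \<le> ?a" using C Wbar_nonneg utmin(1) by simp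
  have "(\<forall>t. \<bar>Em (gen_sum (Suc l) g) t\<bar> \<le> ?a * \<rho> ^ l * mu_type t) \<and> left_ev (Em (gen_sum (Suc l) g)) = 0"
  proof (induction l)
    case 0
    have "\<bar>mean_op (Em g) t\<bar> \<le> ?a * mu_type t" for t
      using L1_wt_Em_bound[OF L2_wt_L1_wt[OF g]] L2_wt_measurable[OF g] C by (intro mean_op_wt_bound) auto
    moreover have "left_ev (mean_op (Em g)) = 0"
      using left_ev_mean_op[OF _ L1_wt_Em_bound[OF L2_wt_L1_wt[OF g]]] L2_wt_measurable[OF g] P0 by simp
    ultimately show ?case by (simp add: Em_gen_step_mean_op[OF g])
  next
    case (Suc l)
    obtain D where D: "L2_wt (gen_sum (Suc l) g) D" using L2_wt_gen_sum[OF g] by blast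
    have "\<bar>mean_op (Em (gen_sum (Suc l) g)) t\<bar> \<le> (?a * \<rho> ^ l) * \<rho> * mu_type t" for t
    proof (rule mean_op_contraction)
      show "Em (gen_sum (Suc l) g) \<in> borel_measurable borel" by (rule Em_measurable[OF L2_wt_measurable[OF D]])
      show "\<bar>Em (gen_sum (Suc l) g) s\<bar> \<le> ?a * \<rho> ^ l * mu_type s" for s using Suc by blast
      show "0 \<le> ?a * \<rho> ^ l" by (intro mult_nonneg_nonneg a zero_le_power rho_bounds)
    qed (use Suc in blast)
    moreover have "left_ev (mean_op (Em (gen_sum (Suc l) g))) = 0"
      unfolding left_ev_mean_op[OF Em_measurable[OF L2_wt_measurable[OF D]] L1_wt_Em_bound[OF L2_wt_L1_wt[OF D]]] conjunct2[OF Suc]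
      by simp
    ultimately show ?case
      unfolding gen_sum_Suc[of "Suc l"] Em_gen_step_mean_op[OF D] by (simp add: mult_ac)
  qed
  then show "\<bar>Em (gen_sum (Suc l) g) t\<bar> \<le> ?a * \<rho> ^ l * mu_type t" "left_ev (Em (gen_sum (Suc l) g)) = 0" by blast+
qed

lemma Em_sq_gen_step:
  assumes g: "L2_wt g C"
  shows "Em (\<lambda>\<omega>. (gen_step g \<omega>)\<^sup>2) t = mean_op (Em (\<lambda>\<omega>. (g \<omega>)\<^sup>2)) t
    + real (fst t) * (real (fst t) - 1) * (child_mean (Em g) (snd t))\<^sup>2"
  using Em_gen_step_mult[OF g g, of t] by (simp add: power2_eq_square mean_op_def)

text \<open>Enlarging m * (m - 1) to m^2 turns the off-diagonal part into the square of the
  mean.\<close>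

lemma Em_sq_gen_step_le:
  assumes g: "L2_wt g C"
  shows "Em (\<lambda>\<omega>. (gen_step g \<omega>)\<^sup>2) t \<le> mean_op (Em (\<lambda>\<omega>. (g \<omega>)\<^sup>2)) t + (Em (gen_step g) t)\<^sup>2"
proof -
  have "real (fst t) * (real (fst t) - 1) * (child_mean (Em g) (snd t))\<^sup>2 \<le> real (fst t) * real (fst t) * (child_mean (Em g) (snd t))\<^sup>2"
    by (intro mult_right_mono mult_left_mono) auto
  then show ?thesis
    unfolding Em_sq_gen_step[OF g] Em_gen_step[OF g] by (simp add: power2_eq_square mult_ac)
qed

text \<open>The midpoint between 1 and the larger of two decay factors: 1 / beta from the mean
  operator acting on squares, and (\<rho> / beta)^2 from the squared means. The gap to the maximum
  is needed to absorb the source term in the recursion for second moments.\<close>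

definition rate :: real where "rate = (1 + max (1 / \<beta>) ((\<rho> / \<beta>)\<^sup>2)) / 2"

lemma rate_bounds: assumes "1 < \<beta>"
  shows "0 < rate" "rate < 1" "1 / \<beta> \<le> rate" "(\<rho> / \<beta>)\<^sup>2 \<le> rate" "max (1 / \<beta>) ((\<rho> / \<beta>)\<^sup>2) < rate"
proof -
  have "(\<rho> / \<beta>)\<^sup>2 < 1" using rho_bounds assms by (simp add: power_less_one_iff)
  moreover have "1 / \<beta> < 1" using assms by simp
  ultimately have m: "max (1 / \<beta>) ((\<rho> / \<beta>)\<^sup>2) < 1" by simp
  then show "rate < 1" "max (1 / \<beta>) ((\<rho> / \<beta>)\<^sup>2) < rate" by (simp_all add: rate_def)
  then show "0 < rate" "1 / \<beta> \<le> rate" "(\<rho> / \<beta>)\<^sup>2 \<le> rate" using assms by (auto simp: less_max_iff_disj) (smt (verit) divide_pos_pos)+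
qed

text \<open>The induction carries a bound with a part in mu and a part in mu^2. The mean operator
  multiplies mu by beta and maps mu^2 to at most D * mu; the squared mean supplies the new mu^2
  part. No growth in mu^2 accumulates, since only its fresh contribution survives each step.\<close>

lemma Em_sq_gen_sum_bound:
  assumes g: "L2_wt g C" and P0: "left_ev (Em g) = 0" and b1: "1 < \<beta>"
  shows "\<exists>K. \<forall>l. Em (\<lambda>\<omega>. (gen_sum l g \<omega>)\<^sup>2) t \<le> K * (rate * \<beta>\<^sup>2) ^ l"
proof -
  define s1 where "s1 = max (1 / \<beta>) ((\<rho> / \<beta>)\<^sup>2)"
  define a where "a = (1 + C) * Wbar / utmin"
  define D where "D = utmax\<^sup>2 * Wbar / utmin"
  \<comment> \<open>The first summand covers generation one; the second is what is needed for a^2 *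
    D <= B * beta^2 * (rate - s1), the cost of turning mu^2 into mu in each step.\<close>
  define B where "B = C * Wbar / utmin + D * a\<^sup>2 / (\<beta>\<^sup>2 * (rate - s1))"
  note r = rate_bounds[OF b1]
  have s1: "s1 < rate" "1 / \<beta> \<le> s1" "(\<rho> / \<beta>)\<^sup>2 \<le> s1" using r by (auto simp: s1_def)
  have \<beta>s: "\<beta> \<le> s1 * \<beta>\<^sup>2" using s1(2) b1 by (simp add: field_simps power2_eq_square)
  have \<rho>s: "\<rho>\<^sup>2 \<le> rate * \<beta>\<^sup>2" using r(4) b1 by (simp add: field_simps power_divide)
  have C: "0 \<le> C" by (rule L1_wt_nonneg[OF L2_wt_sq[OF g]])
  have D: "0 \<le> D" using Wbar_nonneg utmin(1) by (simp add: D_def)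
  have B: "0 \<le> B" using C D Wbar_nonneg utmin(1) s1 by (simp add: B_def)
  let ?R = "rate * \<beta>\<^sup>2"
  have R: "0 < ?R" using r b1 by simp
  have T2: "mean_op (\<lambda>s. (mu_type s)\<^sup>2) t \<le> D * mu_type t" for t
    using mean_op_wt_bound[of "\<lambda>s. (mu_type s)\<^sup>2" "utmax\<^sup>2" t] mu_type_sq_wt unfolding D_def by fastforce
  have e1: "(Em (gen_sum (Suc l) g) t)\<^sup>2 \<le> a\<^sup>2 * (\<rho>\<^sup>2) ^ l * (mu_type t)\<^sup>2" for l t
  proof -
    have "\<bar>Em (gen_sum (Suc l) g) t\<bar>\<^sup>2 \<le> (a * \<rho> ^ l * mu_type t)\<^sup>2"
      unfolding a_def by (intro power_mono Em_gen_sum_bound[OF g P0]) simp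
    then show ?thesis by (simp add: power_mult_distrib power_mult[symmetric] mult.commute)
  qed
  have main: "Em (\<lambda>\<omega>. (gen_sum (Suc l) g \<omega>)\<^sup>2) t \<le> B * ?R ^ l * mu_type t + a\<^sup>2 * (\<rho>\<^sup>2) ^ l * (mu_type t)\<^sup>2" for l t
  proof (induction l arbitrary: t)
    case 0
    note [measurable] = L2_wt_measurable[OF g]
    have "\<bar>mean_op (Em (\<lambda>\<omega>. (g \<omega>)\<^sup>2)) t\<bar> \<le> C * Wbar / utmin * mu_type t"
      using L1_wt_Em_bound[OF L2_wt_sq[OF g]] C by (intro mean_op_wt_bound) auto
    moreover have "C * Wbar / utmin * mu_type t \<le> B * mu_type t"
      using D s1 b1 mu_type_nonneg[of t] by (intro mult_right_mono) (auto simp: B_def)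
    moreover have "Em (\<lambda>\<omega>. (gen_step g \<omega>)\<^sup>2) t \<le> mean_op (Em (\<lambda>\<omega>. (g \<omega>)\<^sup>2)) t + (Em (gen_step g) t)\<^sup>2"
      by (rule Em_sq_gen_step_le[OF g])
    ultimately show ?case using e1[of 0 t] by simp
  next
    case (Suc l)
    obtain E where E: "L2_wt (gen_sum (Suc l) g) E" using L2_wt_gen_sum[OF g] by blast
    note [measurable] = L2_wt_measurable[OF E]
    let ?e2 = "Em (\<lambda>\<omega>. (gen_sum (Suc l) g \<omega>)\<^sup>2)"
    have b1': "\<bar>B * ?R ^ l * mu_type s\<bar> \<le> (B * ?R ^ l * utmax) * wt s" for s
      using mult_left_mono[OF mu_type_wt[of s], of "B * ?R ^ l"] B R mu_type_nonneg[of s] by (simp add: mult_ac)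
    have b2': "\<bar>a\<^sup>2 * (\<rho>\<^sup>2) ^ l * (mu_type s)\<^sup>2\<bar> \<le> (a\<^sup>2 * (\<rho>\<^sup>2) ^ l * utmax\<^sup>2) * wt s" for s
      using mult_left_mono[OF mu_type_sq_wt[of s], of "a\<^sup>2 * (\<rho>\<^sup>2) ^ l"] by (simp add: mult_ac)
    have "child_mean ?e2 x \<le> child_mean (\<lambda>s. B * ?R ^ l * mu_type s + a\<^sup>2 * (\<rho>\<^sup>2) ^ l * (mu_type s)\<^sup>2) x" for x
    proof (rule child_mean_mono)
      show "\<bar>?e2 s\<bar> \<le> E * wt s" for s by (rule L1_wt_Em_bound[OF L2_wt_sq[OF E]])
      show "\<bar>B * ?R ^ l * mu_type s + a\<^sup>2 * (\<rho>\<^sup>2) ^ l * (mu_type s)\<^sup>2\<bar> \<le> (B * ?R ^ l * utmax + a\<^sup>2 * (\<rho>\<^sup>2) ^ l * utmax\<^sup>2) * wt s" for s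
        using b1'[of s] b2'[of s] unfolding distrib_right by linarith
      show "?e2 s \<le> B * ?R ^ l * mu_type s + a\<^sup>2 * (\<rho>\<^sup>2) ^ l * (mu_type s)\<^sup>2" for s by (rule Suc)
    qed measurable
    also have "child_mean (\<lambda>s. B * ?R ^ l * mu_type s + a\<^sup>2 * (\<rho>\<^sup>2) ^ l * (mu_type s)\<^sup>2) x
        = B * ?R ^ l * child_mean mu_type x + a\<^sup>2 * (\<rho>\<^sup>2) ^ l * child_mean (\<lambda>s. (mu_type s)\<^sup>2) x" for x
    proof -
      have "child_mean (\<lambda>s. B * ?R ^ l * mu_type s + a\<^sup>2 * (\<rho>\<^sup>2) ^ l * (mu_type s)\<^sup>2) x
        = child_mean (\<lambda>s. B * ?R ^ l * mu_type s) x + child_mean (\<lambda>s. a\<^sup>2 * (\<rho>\<^sup>2) ^ l * (mu_type s)\<^sup>2) x"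
        by (rule child_mean_add[OF _ _ b1' b2']) measurable
      then show ?thesis unfolding child_mean_cmult .
    qed
    finally have child_mean: "child_mean ?e2 x \<le> B * ?R ^ l * child_mean mu_type x + a\<^sup>2 * (\<rho>\<^sup>2) ^ l * child_mean (\<lambda>s. (mu_type s)\<^sup>2) x" for x .
    have "mean_op ?e2 t \<le> B * ?R ^ l * mean_op mu_type t + a\<^sup>2 * (\<rho>\<^sup>2) ^ l * mean_op (\<lambda>s. (mu_type s)\<^sup>2) t"
      using mult_left_mono[OF child_mean[of "snd t"], of "real (fst t)"] by (simp add: mean_op_def algebra_simps)
    also have "\<dots> \<le> B * ?R ^ l * (\<beta> * mu_type t) + a\<^sup>2 * ?R ^ l * (D * mu_type t)"
    proof -
      have "a\<^sup>2 * (\<rho>\<^sup>2) ^ l * mean_op (\<lambda>s. (mu_type s)\<^sup>2) t \<le> a\<^sup>2 * (\<rho>\<^sup>2) ^ l * (D * mu_type t)"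
        by (rule mult_left_mono[OF T2]) simp
      also have "\<dots> \<le> a\<^sup>2 * ?R ^ l * (D * mu_type t)"
      proof (rule mult_right_mono)
        show "a\<^sup>2 * (\<rho>\<^sup>2) ^ l \<le> a\<^sup>2 * ?R ^ l"
          by (rule mult_left_mono[OF power_mono[OF \<rho>s]]) simp_all
        show "0 \<le> D * mu_type t" by (rule mult_nonneg_nonneg[OF D mu_type_nonneg])
      qed
      finally show ?thesis unfolding mean_op_mu_type by simp
    qed
    also have "\<dots> = (B * \<beta> + a\<^sup>2 * D) * ?R ^ l * mu_type t" by (simp add: algebra_simps)
    also have "\<dots> \<le> (B * ?R) * ?R ^ l * mu_type t"
    proof (intro mult_right_mono)
      \<comment> \<open>rate * beta^2 is split as s1 * beta^2 plus (rate - s1) * beta^2: the first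
        part pays for the eigenvalue beta, the second for the source term.\<close>
      have "B * \<beta> \<le> B * (s1 * \<beta>\<^sup>2)" by (rule mult_left_mono[OF \<beta>s B])
      moreover have "a\<^sup>2 * D \<le> B * (\<beta>\<^sup>2 * (rate - s1))"
      proof -
        have "D * a\<^sup>2 / (\<beta>\<^sup>2 * (rate - s1)) \<le> B" using C Wbar_nonneg utmin(1) by (simp add: B_def)
        then show ?thesis using s1 b1 by (simp add: divide_le_eq mult.commute)
      qed
      ultimately show "B * \<beta> + a\<^sup>2 * D \<le> B * ?R" by (simp add: algebra_simps)
    qed (use R mu_type_nonneg in auto)
    finally have "mean_op ?e2 t \<le> B * ?R ^ Suc l * mu_type t" by (simp add: mult_ac)
    moreover have "Em (\<lambda>\<omega>. (gen_step (gen_sum (Suc l) g) \<omega>)\<^sup>2) t \<le> mean_op ?e2 t + (Em (gen_step (gen_sum (Suc l) g)) t)\<^sup>2"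
      by (rule Em_sq_gen_step_le[OF E])
    moreover have "(Em (gen_step (gen_sum (Suc l) g)) t)\<^sup>2 \<le> a\<^sup>2 * (\<rho>\<^sup>2) ^ Suc l * (mu_type t)\<^sup>2"
      using e1[of "Suc l" t] by simp
    ultimately show ?case by simp
  qed
  \<comment> \<open>The first summand serves l = 0; dividing the second by ?R compensates the shift
    from l + 1 to l in \<open>main\<close>.\<close>
  define K where "K = C * wt t + (B * mu_type t + a\<^sup>2 * (mu_type t)\<^sup>2) / ?R"
  have "Em (\<lambda>\<omega>. (gen_sum l g \<omega>)\<^sup>2) t \<le> K * ?R ^ l" for l
  proof (cases l)
    case 0
    have "Em (\<lambda>\<omega>. (g \<omega>)\<^sup>2) t \<le> C * wt t" using L1_wt_Em_bound[OF L2_wt_sq[OF g], of t] by simp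
    moreover have "0 \<le> (B * mu_type t + a\<^sup>2 * (mu_type t)\<^sup>2) / ?R" using B R mu_type_nonneg[of t] by simp
    ultimately show ?thesis using 0 by (simp add: K_def)
  next
    case (Suc k)
    have "Em (\<lambda>\<omega>. (gen_sum (Suc k) g \<omega>)\<^sup>2) t \<le> B * ?R ^ k * mu_type t + a\<^sup>2 * (\<rho>\<^sup>2) ^ k * (mu_type t)\<^sup>2" by (rule main)
    also have "\<dots> \<le> B * ?R ^ k * mu_type t + a\<^sup>2 * ?R ^ k * (mu_type t)\<^sup>2"
      using \<rho>s by (intro add_left_mono mult_right_mono mult_left_mono power_mono) auto
    also have "\<dots> = (B * mu_type t + a\<^sup>2 * (mu_type t)\<^sup>2) / ?R * ?R ^ Suc k"
    proof -
      have e: "u / r * r ^ Suc k = u * r ^ k" if "0 < r" for u r :: real using that by simp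
      show ?thesis unfolding e[OF R] by (simp only: distrib_right distrib_left ac_simps)
    qed
    also have "\<dots> \<le> K * ?R ^ Suc k"
    proof (rule mult_right_mono)
      show "(B * mu_type t + a\<^sup>2 * (mu_type t)\<^sup>2) / ?R \<le> K"
        unfolding K_def by (rule add_increasing[OF mult_nonneg_nonneg[OF C wt_nonneg] order_refl])
      show "0 \<le> ?R ^ Suc k" by (rule zero_le_power[OF less_imp_le[OF R]])
    qed
    finally show ?thesis unfolding Suc .
  qed
  then show ?thesis by (intro exI[of _ K] allI)
qed

end

section \<open>Signed measures on rectangles and additivity of sums over generations\<close>

lemma gen_sum_diff:
  fixes f g :: "ewt_sample \<Rightarrow> real"
  shows "gen_sum l (\<lambda>\<omega>. f \<omega> - g \<omega>) = (\<lambda>\<omega>. gen_sum l f \<omega> - gen_sum l g \<omega>)"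
proof (induction l)
  case (Suc l)
  show ?case unfolding gen_sum_Suc Suc
    by (auto simp: gen_step_def sum_subtractf[symmetric] intro!: sum.cong)
qed simp

lemma gen_sum_cmult:
  fixes f :: "ewt_sample \<Rightarrow> real"
  shows "gen_sum l (\<lambda>\<omega>. c * f \<omega>) = (\<lambda>\<omega>. c * gen_sum l f \<omega>)"
proof (induction l)
  case (Suc l)
  show ?case unfolding gen_sum_Suc Suc
    by (auto simp: gen_step_def sum_distrib_left intro!: sum.cong)
qed simp

lemma gen_sum_ennreal:
  assumes "\<And>\<omega>. 0 \<le> f \<omega>"
  shows "gen_sum l (\<lambda>\<omega>. ennreal (f \<omega>)) = (\<lambda>\<omega>. ennreal (gen_sum l f \<omega>)) \<and> (\<forall>\<omega>. 0 \<le> gen_sum l f \<omega>)"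
proof (induction l)
  case (Suc l)
  then have IH: "gen_sum l (\<lambda>\<omega>. ennreal (f \<omega>)) = (\<lambda>\<omega>. ennreal (gen_sum l f \<omega>))" and nn: "\<And>\<omega>. 0 \<le> gen_sum l f \<omega>" by auto
  have "gen_step (\<lambda>\<omega>. ennreal (gen_sum l f \<omega>)) \<omega> = ennreal (gen_step (gen_sum l f) \<omega>)" for \<omega>
    unfolding gen_step_def[of "gen_sum l f"] gen_step_def[of "\<lambda>\<omega>. ennreal (gen_sum l f \<omega>)"]
    by (rule trans[OF sum.cong[OF refl] sum_ennreal]) (auto simp: nn)
  moreover have "0 \<le> gen_step (gen_sum l f) \<omega>" for \<omega>
    unfolding gen_step_def[of "gen_sum l f"] by (intro sum_nonneg) (simp add: nn)
  ultimately show ?case unfolding gen_sum_Suc IH by auto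
qed (use assms in simp)

lemma gen_sum_add_ennreal:
  fixes f g :: "ewt_sample \<Rightarrow> ennreal"
  shows "gen_sum l (\<lambda>\<omega>. f \<omega> + g \<omega>) = (\<lambda>\<omega>. gen_sum l f \<omega> + gen_sum l g \<omega>)"
proof (induction l)
  case (Suc l)
  show ?case unfolding gen_sum_Suc Suc
    by (auto simp: gen_step_def sum.distrib[symmetric] intro!: sum.cong)
qed simp

lemma gen_sum_cmult_ennreal:
  fixes f :: "ewt_sample \<Rightarrow> ennreal"
  shows "gen_sum l (\<lambda>\<omega>. c * f \<omega>) = (\<lambda>\<omega>. c * gen_sum l f \<omega>)"
proof (induction l)
  case (Suc l)
  show ?case unfolding gen_sum_Suc Suc
    by (auto simp: gen_step_def sum_distrib_left intro!: sum.cong)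
qed simp

lemma gen_sum_suminf:
  fixes f :: "nat \<Rightarrow> ewt_sample \<Rightarrow> ennreal"
  shows "gen_sum l (\<lambda>\<omega>. \<Sum>i. f i \<omega>) = (\<lambda>\<omega>. \<Sum>i. gen_sum l (f i) \<omega>)"
proof (induction l)
  case (Suc l)
  have "gen_step (\<lambda>\<omega>. \<Sum>i. gen_sum l (f i) \<omega>) \<omega> = (\<Sum>i. gen_step (gen_sum l (f i)) \<omega>)" for \<omega>
    unfolding gen_step_def by (subst suminf_sum) (auto intro!: sum.cong)
  then show ?case unfolding gen_sum_Suc Suc by auto
qed simp

lemma gen_sum_mono:
  fixes f g :: "ewt_sample \<Rightarrow> ennreal"
  assumes "\<And>\<omega>. f \<omega> \<le> g \<omega>" shows "gen_sum l f \<omega> \<le> gen_sum l g \<omega>"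
proof (induction l arbitrary: \<omega>)
  case (Suc l)
  then show ?case unfolding gen_sum_Suc gen_step_def[of "gen_sum l _"] by (intro sum_mono) simp
qed (use assms in simp)

lemma gen_sum_SUP:
  fixes f :: "nat \<Rightarrow> ewt_sample \<Rightarrow> ennreal"
  assumes "\<And>\<omega>. incseq (\<lambda>i. f i \<omega>)"
  shows "gen_sum l (\<lambda>\<omega>. SUP i. f i \<omega>) = (\<lambda>\<omega>. SUP i. gen_sum l (f i) \<omega>)"
proof (induction l)
  case (Suc l)
  have "gen_step (\<lambda>\<omega>. SUP i. gen_sum l (f i) \<omega>) \<omega> = (SUP i. gen_step (gen_sum l (f i)) \<omega>)" for \<omega>
  proof -
    have inc: "incseq (\<lambda>i. gen_sum l (f i) \<omega>')" for \<omega>'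
      using assms by (auto simp: incseq_def intro!: gen_sum_mono)
    have "(SUP i. gen_step (gen_sum l (f i)) \<omega>) = (\<Sum>j = 1..fst (vtype \<omega> []).
        SUP i. if cost \<omega> [] j < snd (vtype \<omega> [j]) then gen_sum l (f i) (sub j \<omega>) else 0)"
      unfolding gen_step_def[of "gen_sum l _"] by (rule ennreal_SUP_sum) (use inc in \<open>auto simp: incseq_def\<close>)
    then show ?thesis unfolding gen_step_def[of "\<lambda>\<omega>. SUP i. gen_sum l (f i) \<omega>"] by (auto intro!: sum.cong)
  qed
  then show ?case unfolding gen_sum_Suc Suc by auto
qed simp

text \<open>The equation is moved to sums so that no subtraction of measures occurs.\<close>

lemma nn_integral_eq_of_measure_sums:
  assumes [measurable_cong]: "sets N2 = sets N1" "sets N3 = sets N1" "sets N4 = sets N1"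
    and eq: "\<And>X. X \<in> sets N1 \<Longrightarrow> emeasure N1 X + emeasure N2 X = emeasure N3 X + emeasure N4 X"
    and h: "h \<in> borel_measurable N1"
  shows "(\<integral>\<^sup>+p. h p \<partial>N1) + (\<integral>\<^sup>+p. h p \<partial>N2) = (\<integral>\<^sup>+p. h p \<partial>N3) + (\<integral>\<^sup>+p. h p \<partial>N4)"
  using h
proof (induction rule: borel_measurable_induct)
  case (cong f g)
  have sp: "space N2 = space N1" "space N3 = space N1" "space N4 = space N1"
    using assms(1-3) by (auto dest: sets_eq_imp_space_eq)
  have "(\<integral>\<^sup>+p. f p \<partial>N) = (\<integral>\<^sup>+p. g p \<partial>N)" if "space N = space N1" for N
    using cong that by (intro nn_integral_cong) auto
  with cong sp show ?case by simp
next
  case (set A)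
  then show ?case using eq[of A] assms(1-3) by simp
next
  case (mult u c)
  have [measurable]: "u \<in> borel_measurable N1" by fact
  show ?case using mult by (simp add: nn_integral_cmult distrib_left[symmetric])
next
  case (add u v)
  have [measurable]: "u \<in> borel_measurable N1" "v \<in> borel_measurable N1" by fact+
  show ?case using add by (simp add: nn_integral_add) (metis (no_types, lifting) add.assoc add.left_commute)
next
  case (seq U)
  have [measurable]: "U i \<in> borel_measurable N1" for i by fact
  have i: "incseq (\<lambda>i. \<integral>\<^sup>+p. U i p \<partial>N)" for N
    using seq by (auto simp: incseq_def le_fun_def intro!: nn_integral_mono)
  have s: "(\<integral>\<^sup>+p. Sup (range U) p \<partial>N) = (SUP i. \<integral>\<^sup>+p. U i p \<partial>N)" if [measurable_cong]: "sets N = sets N1" for N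
    unfolding Sup_apply image_image using seq by (intro nn_integral_monotone_convergence_SUP) auto
  have "(SUP i. \<integral>\<^sup>+p. U i p \<partial>N1) + (SUP i. \<integral>\<^sup>+p. U i p \<partial>N2) = (SUP i. \<integral>\<^sup>+p. U i p \<partial>N3) + (SUP i. \<integral>\<^sup>+p. U i p \<partial>N4)"
    using seq by (simp add: ennreal_SUP_add[OF i i, symmetric])
  then show ?case unfolding s[OF refl] s[OF assms(1)] s[OF assms(2)] s[OF assms(3)] .
qed

text \<open>Dynkin's argument for an identity between sums of measures: it passes to complements
  because the measures are finite, and to countable disjoint unions.\<close>

lemma finite_measure_sums_eq_on_rectangles:
  assumes fin: "finite_measure N1" "finite_measure N2" "finite_measure N3" "finite_measure N4"
    and sets: "sets N1 = sets (M \<Otimes>\<^sub>M M)" "sets N2 = sets (M \<Otimes>\<^sub>M M)" "sets N3 = sets (M \<Otimes>\<^sub>M M)" "sets N4 = sets (M \<Otimes>\<^sub>M M)"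
    and eq: "\<And>A B. A \<in> sets M \<Longrightarrow> B \<in> sets M \<Longrightarrow>
      measure N1 (A \<times> B) + measure N2 (A \<times> B) = measure N3 (A \<times> B) + measure N4 (A \<times> B)"
    and X: "X \<in> sets (M \<Otimes>\<^sub>M M)"
  shows "emeasure N1 X + emeasure N2 X = emeasure N3 X + emeasure N4 X"
proof -
  interpret N1: finite_measure N1 by fact
  interpret N2: finite_measure N2 by fact
  interpret N3: finite_measure N3 by fact
  interpret N4: finite_measure N4 by fact
  let ?R = "{A \<times> B | A B. A \<in> sets M \<and> B \<in> sets M}" and ?\<Omega> = "space M \<times> space M"
  have S: "sets (M \<Otimes>\<^sub>M M) = sigma_sets ?\<Omega> ?R" by (rule sets_pair_measure)
  have "X \<in> sigma_sets ?\<Omega> ?R" using X S by simp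
  then have "measure N1 X + measure N2 X = measure N3 X + measure N4 X"
  proof (rule sigma_sets_induct_disjoint[rotated 2])
    show "?R \<subseteq> Pow ?\<Omega>" by (auto dest: sets.sets_into_space)
    show "Int_stable ?R" by (rule Int_stable_pair_measure_generator)
  next
    fix A assume A: "A \<in> sigma_sets ?\<Omega> ?R" and IH: "measure N1 A + measure N2 A = measure N3 A + measure N4 A"
    have sp: "space N1 = ?\<Omega>" "space N2 = ?\<Omega>" "space N3 = ?\<Omega>" "space N4 = ?\<Omega>"
      using sets by (auto dest!: sets_eq_imp_space_eq simp: space_pair_measure)
    have "measure N1 ?\<Omega> + measure N2 ?\<Omega> = measure N3 ?\<Omega> + measure N4 ?\<Omega>" by (rule eq) auto
    with IH A show "measure N1 (?\<Omega> - A) + measure N2 (?\<Omega> - A) = measure N3 (?\<Omega> - A) + measure N4 (?\<Omega> - A)"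
      using N1.finite_measure_compl[of A] N2.finite_measure_compl[of A] N3.finite_measure_compl[of A] N4.finite_measure_compl[of A]
      by (simp add: sp sets S)
  next
    fix A :: "nat \<Rightarrow> _" assume A: "disjoint_family A" "range A \<subseteq> sigma_sets ?\<Omega> ?R"
      and IH: "\<And>i. measure N1 (A i) + measure N2 (A i) = measure N3 (A i) + measure N4 (A i)"
    have 1: "(\<lambda>i. measure N1 (A i)) sums measure N1 (\<Union>i. A i)" "(\<lambda>i. measure N2 (A i)) sums measure N2 (\<Union>i. A i)"
      "(\<lambda>i. measure N3 (A i)) sums measure N3 (\<Union>i. A i)" "(\<lambda>i. measure N4 (A i)) sums measure N4 (\<Union>i. A i)"
      using A S sets
      by (auto intro!: N1.finite_measure_UNION N2.finite_measure_UNION N3.finite_measure_UNION N4.finite_measure_UNION)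
    from sums_add[OF 1(1,2)] sums_add[OF 1(3,4)] show
      "measure N1 (\<Union>i. A i) + measure N2 (\<Union>i. A i) = measure N3 (\<Union>i. A i) + measure N4 (\<Union>i. A i)"
      unfolding IH by (rule sums_unique2)
  qed (use eq in auto)
  then show ?thesis
    by (simp add: N1.emeasure_eq_measure N2.emeasure_eq_measure N3.emeasure_eq_measure N4.emeasure_eq_measure
        flip: ennreal_plus)
qed

text \<open>For two decompositions the identity N1 + N4 = N3 + N2 holds on rectangles, hence
  everywhere. Nonnegativity of f carries it over to the integrals, so the value chosen by
  \<open>THE\<close> is unique.\<close>

lemma signed_rect_integral_eq:
  assumes N: "finite_measure N1" "finite_measure N2"
    "sets N1 = sets (M \<Otimes>\<^sub>M M)" "sets N2 = sets (M \<Otimes>\<^sub>M M)"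
    "\<And>A B. A \<in> sets M \<Longrightarrow> B \<in> sets M \<Longrightarrow> v A B = measure N1 (A \<times> B) - measure N2 (A \<times> B)"
    "integrable N1 f" "integrable N2 f"
    and nn: "\<And>p. p \<in> space (M \<Otimes>\<^sub>M M) \<Longrightarrow> 0 \<le> f p"
  shows "signed_rect_integral M v f = (LINT p|N1. f p) - (LINT p|N2. f p)"
  unfolding signed_rect_integral_def
proof (rule the_equality)
  show "\<exists>N\<^sub>1 N\<^sub>2. finite_measure N\<^sub>1 \<and> finite_measure N\<^sub>2 \<and>
     sets N\<^sub>1 = sets (M \<Otimes>\<^sub>M M) \<and> sets N\<^sub>2 = sets (M \<Otimes>\<^sub>M M) \<and>
     (\<forall>A\<^sub>1\<in>sets M. \<forall>A\<^sub>2\<in>sets M. v A\<^sub>1 A\<^sub>2 = measure N\<^sub>1 (A\<^sub>1 \<times> A\<^sub>2) - measure N\<^sub>2 (A\<^sub>1 \<times> A\<^sub>2)) \<and>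
     integrable N\<^sub>1 f \<and> integrable N\<^sub>2 f \<and> (LINT p|N1. f p) - (LINT p|N2. f p) = (LINT p|N\<^sub>1. f p) - (LINT p|N\<^sub>2. f p)"
    using N by (intro exI[of _ N1] exI[of _ N2]) simp
next
  fix r assume "\<exists>N\<^sub>1 N\<^sub>2. finite_measure N\<^sub>1 \<and> finite_measure N\<^sub>2 \<and>
     sets N\<^sub>1 = sets (M \<Otimes>\<^sub>M M) \<and> sets N\<^sub>2 = sets (M \<Otimes>\<^sub>M M) \<and>
     (\<forall>A\<^sub>1\<in>sets M. \<forall>A\<^sub>2\<in>sets M. v A\<^sub>1 A\<^sub>2 = measure N\<^sub>1 (A\<^sub>1 \<times> A\<^sub>2) - measure N\<^sub>2 (A\<^sub>1 \<times> A\<^sub>2)) \<and>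
     integrable N\<^sub>1 f \<and> integrable N\<^sub>2 f \<and> r = (LINT p|N\<^sub>1. f p) - (LINT p|N\<^sub>2. f p)"
  then obtain N3 N4 where N': "finite_measure N3" "finite_measure N4"
    "sets N3 = sets (M \<Otimes>\<^sub>M M)" "sets N4 = sets (M \<Otimes>\<^sub>M M)"
    "\<And>A B. A \<in> sets M \<Longrightarrow> B \<in> sets M \<Longrightarrow> v A B = measure N3 (A \<times> B) - measure N4 (A \<times> B)"
    "integrable N3 f" "integrable N4 f" and r: "r = (LINT p|N3. f p) - (LINT p|N4. f p)"
    by blast
  have m: "measure N1 (A \<times> B) + measure N4 (A \<times> B) = measure N3 (A \<times> B) + measure N2 (A \<times> B)"
    if "A \<in> sets M" "B \<in> sets M" for A B
    using N(5)[OF that] N'(5)[OF that] by linarith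
  have e: "emeasure N1 X + emeasure N4 X = emeasure N3 X + emeasure N2 X" if "X \<in> sets (M \<Otimes>\<^sub>M M)" for X
    by (rule finite_measure_sums_eq_on_rectangles[OF N(1) N'(2) N'(1) N(2) N(3) N'(4) N'(3) N(4) m that])
  have "(\<integral>\<^sup>+p. ennreal (f p) \<partial>N1) + (\<integral>\<^sup>+p. ennreal (f p) \<partial>N4) = (\<integral>\<^sup>+p. ennreal (f p) \<partial>N3) + (\<integral>\<^sup>+p. ennreal (f p) \<partial>N2)"
    by (rule nn_integral_eq_of_measure_sums) (use e N N' in auto)
  moreover have nn': "AE p in N. 0 \<le> f p" if "sets N = sets (M \<Otimes>\<^sub>M M)" for N
    using nn sets_eq_imp_space_eq[OF that] by (intro AE_I2) simp
  ultimately have "ennreal (LINT p|N1. f p) + ennreal (LINT p|N4. f p) = ennreal (LINT p|N3. f p) + ennreal (LINT p|N2. f p)"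
    using N N' by (simp add: nn_integral_eq_integral)
  then have "(LINT p|N1. f p) + (LINT p|N4. f p) = (LINT p|N3. f p) + (LINT p|N2. f p)"
    using N N' nn' by (simp flip: ennreal_plus add: integral_nonneg_AE)
  then show "r = (LINT p|N1. f p) - (LINT p|N2. f p)" using r by simp
qed

section \<open>The second moment of the martingale\<close>

context ewt_params begin

definition rootmu :: "ewt_sample \<Rightarrow> real" where "rootmu \<omega> = mu_type (vtype \<omega> [])"

lemma mu_type_abs_le: "\<bar>mu_type s\<bar> \<le> utmax * (1 + real (fst s))"
  unfolding abs_of_nonneg[OF mu_type_nonneg] using mu_type_le[of s] utmax(1) by (simp add: distrib_left)

lemma L2_wt_rootmu: "L2_wt rootmu (utmax\<^sup>2)"
  unfolding rootmu_def[abs_def] by (rule L2_wt_root[OF _ mu_type_abs_le]) measurable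

lemma Em_rootmu: "Em rootmu = mu_type" "Em (\<lambda>\<omega>. (rootmu \<omega>)\<^sup>2) = (\<lambda>s. (mu_type s)\<^sup>2)"
  unfolding rootmu_def[abs_def] by (intro ext Em_root[of mu_type] Em_root[of "\<lambda>s. (mu_type s)\<^sup>2"]; measurable)+

lemma mean_op_cmult: "mean_op (\<lambda>s. c * h s) t = c * mean_op h t"
  by (simp add: mean_op_def child_mean_cmult)

lemma Em_gen_sum_rootmu: "Em (gen_sum l rootmu) = (\<lambda>t. \<beta> ^ l * mu_type t)"
proof (induction l)
  case (Suc l)
  obtain C where C: "L2_wt (gen_sum l rootmu) C" using L2_wt_gen_sum[OF L2_wt_rootmu] by blast
  show ?case
    unfolding gen_sum_Suc Em_gen_step_mean_op[OF C] Suc by (intro ext) (simp add: mean_op_cmult mean_op_mu_type)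
qed (simp add: Em_rootmu)

text \<open>For v >= 0, the variance of the sum of mu over the kept children given the root type,
  from m independent contributions. The value 0 for v < 0 matches the mean measures, which live on
  \<open>type_space\<close>.\<close>

definition mu_var :: "ewt_type \<Rightarrow> real" where
  "mu_var s = (if 0 \<le> snd s then real (fst s) * (child_mean (\<lambda>s. (mu_type s)\<^sup>2) (snd s) - (child_mean mu_type (snd s))\<^sup>2) else 0)"

lemma mu_var_measurable [measurable]: "mu_var \<in> borel_measurable borel"
  unfolding mu_var_def[abs_def] by measurable

lemma child_mean_mu_type_sq_bounds: "0 \<le> child_mean (\<lambda>s. (mu_type s)\<^sup>2) x" "child_mean (\<lambda>s. (mu_type s)\<^sup>2) x \<le> utmax\<^sup>2 * Wbar / utmin * utmax"
proof -
  show "0 \<le> child_mean (\<lambda>s. (mu_type s)\<^sup>2) x"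
    unfolding child_mean_def by (intro integral_nonneg_AE AE_TLI mult_nonneg_nonneg less_imp_le[OF keep_prob_bounds(1)]) auto
  have "\<bar>child_mean (\<lambda>s. (mu_type s)\<^sup>2) x\<bar> \<le> utmax\<^sup>2 * Wbar / utmin * ut x"
    by (rule child_mean_wt_bound) (measurable, simp_all add: mu_type_sq_wt)
  also have "\<dots> \<le> utmax\<^sup>2 * Wbar / utmin * utmax"
    using Wbar_nonneg utmin(1) by (intro mult_left_mono ut_le) auto
  finally show "child_mean (\<lambda>s. (mu_type s)\<^sup>2) x \<le> utmax\<^sup>2 * Wbar / utmin * utmax" by simp
qed

text \<open>Growth linear in n is what \<open>L2_wt_root\<close> requires, since its square is then
  within the weight.\<close>

lemma mu_var_bound: "\<exists>C. \<forall>s. \<bar>mu_var s\<bar> \<le> C * (1 + real (fst s))"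
proof (intro exI allI)
  fix s :: ewt_type
  define C where "C = utmax\<^sup>2 * Wbar / utmin * utmax + (\<beta> * utmax)\<^sup>2"
  let ?m = "real (fst s)" and ?X = "child_mean (\<lambda>s. (mu_type s)\<^sup>2) (snd s) - (child_mean mu_type (snd s))\<^sup>2"
  have C: "0 \<le> C" using Wbar_nonneg utmin(1) utmax(1) by (simp add: C_def)
  have "(child_mean mu_type (snd s))\<^sup>2 \<le> (\<beta> * utmax)\<^sup>2"
    unfolding child_mean_mu_type using beta_pos ut_pos[of "snd s"] ut_le[of "snd s"] by (intro power_mono mult_left_mono) auto
  then have "\<bar>?X\<bar> \<le> C"
    unfolding C_def
    using child_mean_mu_type_sq_bounds[of "snd s"] zero_le_power2[of "child_mean mu_type (snd s)"] zero_le_power2[of "\<beta> * utmax"] by linarith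
  then have "\<bar>?m * ?X\<bar> \<le> ?m * C"
    unfolding abs_mult abs_of_nat by (rule mult_left_mono) simp
  then have "\<bar>mu_var s\<bar> \<le> ?m * C" using C by (auto simp: mu_var_def)
  also have "\<dots> \<le> C * (1 + ?m)" using C by (simp add: distrib_left)
  finally show "\<bar>mu_var s\<bar> \<le> (utmax\<^sup>2 * Wbar / utmin * utmax + (\<beta> * utmax)\<^sup>2) * (1 + ?m)"
    unfolding C_def .
qed

definition rootV :: "ewt_sample \<Rightarrow> real" where "rootV \<omega> = mu_var (vtype \<omega> [])"

lemma L2_wt_rootV: "\<exists>C. L2_wt rootV C"
proof -
  obtain C where "\<And>s. \<bar>mu_var s\<bar> \<le> C * (1 + real (fst s))" using mu_var_bound by blast
  from L2_wt_root[OF mu_var_measurable this] show ?thesis unfolding rootV_def[abs_def] by blast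
qed

text \<open>Jensen's inequality for one generation step; the excess of the second moment over the
  squared mean is \<open>mu_var\<close>.\<close>

lemma mu_var_nonneg: "0 \<le> mu_var s"
proof (cases "0 \<le> snd s")
  case True
  have "(Em (gen_step rootmu) s)\<^sup>2 \<le> Em (\<lambda>\<omega>. (gen_step rootmu \<omega>)\<^sup>2) s"
    by (rule Em_square_le[OF L2_wt_gen_step[OF L2_wt_rootmu]])
  also have "\<dots> = (Em (gen_step rootmu) s)\<^sup>2 + mu_var s"
    unfolding Em_sq_gen_step[OF L2_wt_rootmu] Em_gen_step[OF L2_wt_rootmu] Em_rootmu mu_var_def mean_op_def
    using True by (simp add: power2_eq_square algebra_simps)
  finally show ?thesis by simp
qed (simp add: mu_var_def)

lemma child_mean_sum:
  assumes "\<And>j. j \<in> J \<Longrightarrow> h j \<in> borel_measurable borel"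
    "\<And>j s. j \<in> J \<Longrightarrow> 0 < snd s \<Longrightarrow> \<bar>h j s\<bar> \<le> C j * wt s"
  shows "child_mean (\<lambda>s. \<Sum>j\<in>J. h j s) x = (\<Sum>j\<in>J. child_mean (h j) x)"
  unfolding child_mean_def sum_distrib_left
  by (rule Bochner_Integration.integral_sum, rule integrable_child_mean[OF assms(1) assms(2)])

text \<open>The second moment of \<open>gen_sum l rootmu\<close>, that is of \<open>\<beta>\<^sup>l\<close> times the martingale at time \<open>l\<close>, is
  exactly a partial sum of the series in \<open>U\<close>.\<close>

lemma Em_sq_gen_sum_rootmu:
  assumes "0 \<le> snd t"
  shows "Em (\<lambda>\<omega>. (gen_sum l rootmu \<omega>)\<^sup>2) t =
    \<beta> ^ (2 * l) * (mu_type t)\<^sup>2 + (\<Sum>j<l. \<beta> ^ (2 * (l - Suc j)) * Em (gen_sum j rootV) t)"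
  using assms
proof (induction l arbitrary: t)
  case 0
  show ?case by (simp add: Em_rootmu)
next
  case (Suc l)
  let ?m = "real (fst t)" and ?x = "snd t"
  obtain C where C: "L2_wt (gen_sum l rootmu) C" using L2_wt_gen_sum[OF L2_wt_rootmu] by blast
  obtain C0 where C0: "L2_wt rootV C0" using L2_wt_rootV by blast
  have "\<exists>D. L2_wt (gen_sum j rootV) D" for j by (rule L2_wt_gen_sum[OF C0])
  then obtain D where D: "\<And>j. L2_wt (gen_sum j rootV) (D j)" by metis
  note [measurable] = L2_wt_measurable[OF C] L2_wt_measurable[OF D]
  let ?c = "\<lambda>j. \<beta> ^ (2 * (l - Suc j))"
  have b1: "\<bar>\<beta> ^ (2 * l) * (mu_type s)\<^sup>2\<bar> \<le> (\<beta> ^ (2 * l) * utmax\<^sup>2) * wt s" for s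
    using mult_left_mono[OF mu_type_sq_wt[of s], of "\<beta> ^ (2 * l)"] beta_pos by (simp add: mult.assoc)
  have b2: "\<bar>?c j * Em (gen_sum j rootV) s\<bar> \<le> (?c j * (1 + D j)) * wt s" for j s
    using mult_left_mono[OF L1_wt_Em_bound[OF L2_wt_L1_wt[OF D[of j]], of s], of "?c j"] beta_pos
    by (simp add: abs_mult mult.assoc)
  have b3: "\<bar>\<Sum>j<l. ?c j * Em (gen_sum j rootV) s\<bar> \<le> (\<Sum>j<l. ?c j * (1 + D j)) * wt s" for s
    unfolding sum_distrib_right by (rule order_trans[OF sum_abs sum_mono[OF b2]])
  have "child_mean (Em (\<lambda>\<omega>. (gen_sum l rootmu \<omega>)\<^sup>2)) ?x
    = child_mean (\<lambda>s. \<beta> ^ (2 * l) * (mu_type s)\<^sup>2 + (\<Sum>j<l. ?c j * Em (gen_sum j rootV) s)) ?x"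
  proof (rule child_mean_cong)
    show "Em (\<lambda>\<omega>. (gen_sum l rootmu \<omega>)\<^sup>2) s = \<beta> ^ (2 * l) * (mu_type s)\<^sup>2 + (\<Sum>j<l. ?c j * Em (gen_sum j rootV) s)"
      if "0 < snd s" for s by (rule Suc.IH[OF less_imp_le[OF that]])
  qed measurable
  also have "\<dots> = child_mean (\<lambda>s. \<beta> ^ (2 * l) * (mu_type s)\<^sup>2) ?x + child_mean (\<lambda>s. \<Sum>j<l. ?c j * Em (gen_sum j rootV) s) ?x"
    by (rule child_mean_add[OF _ _ b1 b3]) measurable
  also have "child_mean (\<lambda>s. \<Sum>j<l. ?c j * Em (gen_sum j rootV) s) ?x = (\<Sum>j<l. child_mean (\<lambda>s. ?c j * Em (gen_sum j rootV) s) ?x)"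
    by (rule child_mean_sum[OF _ b2]) measurable
  finally have So2: "child_mean (Em (\<lambda>\<omega>. (gen_sum l rootmu \<omega>)\<^sup>2)) ?x
    = \<beta> ^ (2 * l) * child_mean (\<lambda>s. (mu_type s)\<^sup>2) ?x + (\<Sum>j<l. ?c j * child_mean (Em (gen_sum j rootV)) ?x)"
    unfolding child_mean_cmult .
  have So1: "child_mean (Em (gen_sum l rootmu)) ?x = \<beta> ^ l * child_mean mu_type ?x"
    unfolding Em_gen_sum_rootmu child_mean_cmult ..
  have V: "mu_var t = Em (gen_sum 0 rootV) t"
    using Em_root[OF mu_var_measurable, of t] by (simp add: rootV_def[abs_def])
  have m: "?m * child_mean mu_type ?x = \<beta> * mu_type t" using mean_op_mu_type[of t] by (simp add: mean_op_def)
  have "Em (\<lambda>\<omega>. (gen_sum (Suc l) rootmu \<omega>)\<^sup>2) t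
    = ?m * child_mean (Em (\<lambda>\<omega>. (gen_sum l rootmu \<omega>)\<^sup>2)) ?x + ?m * (?m - 1) * (child_mean (Em (gen_sum l rootmu)) ?x)\<^sup>2"
    unfolding gen_sum_Suc by (rule Em_sq_gen_step[OF C, unfolded mean_op_def])
  also have "\<dots> = \<beta> ^ (2 * l) * (?m * (child_mean (\<lambda>s. (mu_type s)\<^sup>2) ?x - (child_mean mu_type ?x)\<^sup>2)) + \<beta> ^ (2 * l) * (?m * child_mean mu_type ?x)\<^sup>2
      + (\<Sum>j<l. ?c j * (?m * child_mean (Em (gen_sum j rootV)) ?x))"
  proof -
    have p: "(\<beta> ^ l * child_mean mu_type ?x)\<^sup>2 = \<beta> ^ (2 * l) * (child_mean mu_type ?x)\<^sup>2"
      by (simp add: power_mult_distrib power_mult[symmetric] mult.commute)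
    have s: "?m * (\<Sum>j<l. ?c j * child_mean (Em (gen_sum j rootV)) ?x) = (\<Sum>j<l. ?c j * (?m * child_mean (Em (gen_sum j rootV)) ?x))"
      unfolding sum_distrib_left by (simp add: mult_ac)
    \<comment> \<open>Writing m * (m - 1) as m^2 - m isolates the variance created at the root and
      the square of the mean. The former becomes the term j = 0 of the new sum, and the terms
      inherited from the children move up by one index.\<close>
    have "?m * (a * A + S) + ?m * (?m - 1) * (a * B\<^sup>2) = a * (?m * (A - B\<^sup>2)) + a * (?m * B)\<^sup>2 + ?m * S" for a A B S
      by (simp add: power2_eq_square algebra_simps)
    then show ?thesis unfolding So2 So1 p s[symmetric] .
  qed
  also have "?m * (child_mean (\<lambda>s. (mu_type s)\<^sup>2) ?x - (child_mean mu_type ?x)\<^sup>2) = Em (gen_sum 0 rootV) t"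
    unfolding V[symmetric] using Suc.prems by (simp add: mu_var_def)
  also have "(\<Sum>j<l. ?c j * (?m * child_mean (Em (gen_sum j rootV)) ?x)) = (\<Sum>j<l. \<beta> ^ (2 * (Suc l - Suc (Suc j))) * Em (gen_sum (Suc j) rootV) t)"
    unfolding gen_sum_Suc Em_gen_step[OF D] by simp
  also have "\<beta> ^ (2 * l) * Em (gen_sum 0 rootV) t + \<beta> ^ (2 * l) * (?m * child_mean mu_type ?x)\<^sup>2
      + (\<Sum>j<l. \<beta> ^ (2 * (Suc l - Suc (Suc j))) * Em (gen_sum (Suc j) rootV) t)
    = \<beta> ^ (2 * Suc l) * (mu_type t)\<^sup>2 + (\<Sum>j<Suc l. \<beta> ^ (2 * (Suc l - Suc j)) * Em (gen_sum j rootV) t)"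
    unfolding m by (subst sum.lessThan_Suc_shift) (simp add: power_mult_distrib power2_eq_square)
  finally show ?case .
qed

section \<open>The mean measure of a generation\<close>

lemma space_type_space: "space type_space = UNIV \<times> {0..}"
  by (simp add: type_space_def space_restrict_space)

lemma type_space_sets_borel: "space type_space \<in> sets borel"
  using sets_type_space[of "space type_space"] by auto

lemma type_space_measurable_iff:
  fixes h :: "ewt_type \<Rightarrow> ennreal"
  shows "h \<in> borel_measurable type_space \<longleftrightarrow> (\<lambda>s. h s * indicator (space type_space) s) \<in> borel_measurable borel"
  using type_space_sets_borel unfolding space_type_space unfolding type_space_def
  by (subst borel_measurable_restrict_space_iff_ennreal) auto

text \<open>\<open>measure_of\<close> yields this set function only once it is known to be countably
  additive, which holds because generation sums commute with countable sums.\<close>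

lemma emeasure_mean_measure:
  assumes A: "A \<in> sets type_space"
  shows "emeasure (mean_measure P l t) A = (\<integral>\<^sup>+\<omega>. gen_sum l (\<lambda>\<omega>. indicator A (vtype \<omega> [])) \<omega> \<partial>\<kappa> t)"
proof -
  let ?\<mu> = "\<lambda>A. \<integral>\<^sup>+\<omega>. of_nat (Z l A \<omega>) \<partial>\<kappa> t"
  have e: "(of_nat (Z l A \<omega>) :: ennreal) = gen_sum l (\<lambda>\<omega>. indicator A (vtype \<omega> [])) \<omega>" for A \<omega>
    unfolding Z_eq_gen_sum by (simp add: indicator_def of_bool_def)
  have m: "gen_sum l (\<lambda>\<omega>. indicator A (vtype \<omega> []) :: ennreal) \<in> borel_measurable (\<kappa> t)" if "A \<in> sets type_space" for A
  proof -
    have [measurable]: "A \<in> sets borel" using that by (simp add: sets_type_space)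
    have [measurable]: "(\<lambda>\<omega>. vtype \<omega> []) \<in> tree_space \<rightarrow>\<^sub>M borel" by (intro vtype_measurable) simp
    show ?thesis by measurable
  qed
  have "emeasure (mean_measure P l t) A = ?\<mu> A"
  proof (rule emeasure_measure_of)
    show "mean_measure P l t = measure_of (space type_space) (sets type_space) ?\<mu>"
      by (simp add: mean_measure_def)
    have S: "sets (mean_measure P l t) = sets type_space"
      by (simp add: mean_measure_def sets.sets_measure_of_eq)
    show "A \<in> sets (mean_measure P l t)" using A S by simp
    show "sets type_space \<subseteq> Pow (space type_space)" by (rule sets.space_closed)
    show "positive (sets (mean_measure P l t)) ?\<mu>"
      by (simp add: positive_def Z_def)
    show "countably_additive (sets (mean_measure P l t)) ?\<mu>"
    proof (rule countably_additiveI)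
      fix A :: "nat \<Rightarrow> _" assume A: "range A \<subseteq> sets (mean_measure P l t)" "disjoint_family A"
      have "(\<Sum>i. ?\<mu> (A i)) = (\<integral>\<^sup>+\<omega>. (\<Sum>i. gen_sum l (\<lambda>\<omega>. indicator (A i) (vtype \<omega> [])) \<omega>) \<partial>\<kappa> t)"
        unfolding e using A S by (intro nn_integral_suminf[symmetric] m) auto
      also have "\<dots> = (\<integral>\<^sup>+\<omega>. gen_sum l (\<lambda>\<omega>. \<Sum>i. indicator (A i) (vtype \<omega> [])) \<omega> \<partial>\<kappa> t)"
        unfolding gen_sum_suminf ..
      also have "\<dots> = ?\<mu> (\<Union>i. A i)"
        unfolding e suminf_indicator[OF A(2)] ..
      finally show "(\<Sum>i. ?\<mu> (A i)) = ?\<mu> (\<Union>i. A i)" .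
    qed
  qed
  then show ?thesis unfolding e .
qed

lemma sets_mean_measure [simp, measurable_cong]: "sets (mean_measure P l t) = sets type_space"
  and space_mean_measure [simp]: "space (mean_measure P l t) = space type_space"
  by (simp_all add: mean_measure_def sets.sets_measure_of_eq sets.space_measure_of_eq)

text \<open>The first-moment formula for branching processes, extended from indicators by monotone
  approximation. As h is measurable on \<open>type_space\<close> only, it is cut off to 0
  outside.\<close>

lemma nn_integral_mean_measure:
  assumes "h \<in> borel_measurable type_space"
  shows "(\<integral>\<^sup>+s. h s \<partial>mean_measure P l t)
    = (\<integral>\<^sup>+\<omega>. gen_sum l (\<lambda>\<omega>. h (vtype \<omega> []) * indicator (space type_space) (vtype \<omega> [])) \<omega> \<partial>\<kappa> t)"
proof -
  have m: "gen_sum l (\<lambda>\<omega>. u (vtype \<omega> []) * indicator (space type_space) (vtype \<omega> [])) \<in> borel_measurable (\<kappa> t)"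
    if "u \<in> borel_measurable type_space" for u :: "ewt_type \<Rightarrow> ennreal"
  proof -
    have "(\<lambda>\<omega>. vtype \<omega> []) \<in> tree_space \<rightarrow>\<^sub>M borel" by (intro vtype_measurable) simp
    from measurable_compose[OF this that[unfolded type_space_measurable_iff]] show ?thesis by measurable
  qed
  show ?thesis using assms
  proof (induction rule: borel_measurable_induct)
    case (cong f g)
    then have "f s * indicator (space type_space) s = g s * indicator (space type_space) s" for s
      by (simp add: indicator_def)
    moreover have "(\<integral>\<^sup>+s. f s \<partial>mean_measure P l t) = (\<integral>\<^sup>+s. g s \<partial>mean_measure P l t)"
      using cong by (intro nn_integral_cong) simp
    ultimately show ?case using cong by simp
  next
    case (set A)
    have "indicator A s * indicator (space type_space) s = (indicator A s :: ennreal)" for s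
      using sets.sets_into_space[OF set] by (auto simp: indicator_def)
    then show ?case using set by (simp add: emeasure_mean_measure)
  next
    case (mult u c)
    have [measurable]: "u \<in> borel_measurable type_space" by fact
    show ?case using mult m[of u] by (simp add: nn_integral_cmult mult.assoc gen_sum_cmult_ennreal)
  next
    case (add u v)
    have [measurable]: "u \<in> borel_measurable type_space" "v \<in> borel_measurable type_space" by fact+
    show ?case using add m[of u] m[of v] by (simp add: nn_integral_add distrib_right gen_sum_add_ennreal)
  next
    case (seq U)
    have [measurable]: "U i \<in> borel_measurable type_space" for i by fact
    let ?g = "\<lambda>i \<omega>. U i (vtype \<omega> []) * indicator (space type_space) (vtype \<omega> [])"
    have inc: "incseq (\<lambda>i. ?g i \<omega>)" for \<omega>
    proof (rule incseq_SucI)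
      fix i
      have "U i \<le> U (Suc i)" using \<open>incseq U\<close> by (rule incseq_SucD)
      then show "?g i \<omega> \<le> ?g (Suc i) \<omega>" by (rule mult_right_mono[OF le_funD zero_le])
    qed
    have "(\<integral>\<^sup>+s. Sup (range U) s \<partial>mean_measure P l t) = (SUP i. \<integral>\<^sup>+s. U i s \<partial>mean_measure P l t)"
      unfolding Sup_apply image_image using seq by (intro nn_integral_monotone_convergence_SUP) auto
    also have "\<dots> = (SUP i. \<integral>\<^sup>+\<omega>. gen_sum l (?g i) \<omega> \<partial>\<kappa> t)" using seq by simp
    also have "\<dots> = (\<integral>\<^sup>+\<omega>. (SUP i. gen_sum l (?g i) \<omega>) \<partial>\<kappa> t)"
    proof (rule nn_integral_monotone_convergence_SUP[symmetric])
      show "incseq (\<lambda>i. gen_sum l (?g i))"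
        by (intro incseq_SucI le_funI gen_sum_mono incseq_SucD[OF inc])
      show "gen_sum l (?g i) \<in> borel_measurable (\<kappa> t)" for i by (intro m) measurable
    qed
    also have "\<dots> = (\<integral>\<^sup>+\<omega>. gen_sum l (\<lambda>\<omega>. SUP i. ?g i \<omega>) \<omega> \<partial>\<kappa> t)"
      unfolding gen_sum_SUP[OF inc] ..
    also have "(\<lambda>\<omega>. SUP i. ?g i \<omega>) = (\<lambda>\<omega>. Sup (range U) (vtype \<omega> []) * indicator (space type_space) (vtype \<omega> []))"
      unfolding Sup_apply image_image by (intro ext) (rule SUP_mult_right_ennreal[symmetric])
    finally show ?case .
  qed
qed

lemma integral_mean_measure_mu_var: "(LINT s|mean_measure P l t. mu_var s) = Em (gen_sum l rootV) t"
proof -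
  have [measurable]: "mu_var \<in> borel_measurable type_space"
    using mu_var_measurable unfolding type_space_def by (rule measurable_restrict_space1)
  obtain C where C: "L2_wt rootV C" using L2_wt_rootV by blast
  note [measurable] = L2_wt_measurable[OF C]
  \<comment> \<open>This is where the value 0 for negative v makes the cutoff invisible.\<close>
  have r: "ennreal (mu_var s) * indicator (space type_space) s = ennreal (mu_var s)" for s
    by (cases s) (auto simp: indicator_def space_type_space mu_var_def)
  have g: "gen_sum l (\<lambda>\<omega>. ennreal (rootV \<omega>)) = (\<lambda>\<omega>. ennreal (gen_sum l rootV \<omega>))" "\<And>\<omega>. 0 \<le> gen_sum l rootV \<omega>"
    using gen_sum_ennreal[of rootV l] mu_var_nonneg by (auto simp: rootV_def)
  have "(LINT s|mean_measure P l t. mu_var s) = enn2real (\<integral>\<^sup>+s. ennreal (mu_var s) \<partial>mean_measure P l t)"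
    by (intro integral_eq_nn_integral AE_I2 mu_var_nonneg) measurable
  also have "(\<integral>\<^sup>+s. ennreal (mu_var s) \<partial>mean_measure P l t) = (\<integral>\<^sup>+\<omega>. gen_sum l (\<lambda>\<omega>. ennreal (rootV \<omega>)) \<omega> \<partial>\<kappa> t)"
    by (subst nn_integral_mean_measure) (measurable, simp add: r rootV_def)
  also have "\<dots> = (\<integral>\<^sup>+\<omega>. ennreal (gen_sum l rootV \<omega>) \<partial>\<kappa> t)" unfolding g(1) ..
  also have "enn2real \<dots> = Em (gen_sum l rootV) t"
    unfolding Em_def by (intro integral_eq_nn_integral[symmetric] AE_I2 g(2)) measurable
  finally show ?thesis .
qed


definition clip :: "ewt_type \<Rightarrow> ewt_type" where "clip s = (fst s, max 0 (snd s))"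

lemma clip_measurable: "clip \<in> borel \<rightarrow>\<^sub>M type_space"
  unfolding type_space_def
proof (rule measurable_restrict_space2)
  show "clip \<in> space borel \<rightarrow> UNIV \<times> {0..}" by (auto simp: clip_def)
  show "clip \<in> borel \<rightarrow>\<^sub>M borel" unfolding clip_def[abs_def] by measurable
qed

lemma clip_eq: "0 < snd s \<Longrightarrow> clip s = s"
  by (simp add: clip_def prod_eq_iff)

text \<open>\<open>c = m\<close> gives the mean measure of the first generation; \<open>clip\<close> moves the type law onto
  \<open>type_space\<close> and is almost everywhere the identity.\<close>

definition GenL :: "real \<Rightarrow> real \<Rightarrow> ewt_type measure" where
  "GenL c x = distr (density TL (\<lambda>s. ennreal (c * keep_prob x (snd s)))) type_space clip"

lemma sets_GenL [simp, measurable_cong]: "sets (GenL c x) = sets type_space"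
  and space_GenL [simp]: "space (GenL c x) = space type_space"
  by (simp_all add: GenL_def)

text \<open>h lives on \<open>type_space\<close> and g on all pairs: \<open>mu\<close> is controlled
  for v >= 0 only, whereas \<open>child_mean\<close> takes Borel functions on the whole product.
  They need to agree for v > 0, which holds almost surely.\<close>

lemma integral_GenL:
  fixes g h :: "ewt_type \<Rightarrow> real"
  assumes c: "0 \<le> c" and [measurable]: "h \<in> borel_measurable type_space" "g \<in> borel_measurable borel"
    and gh: "\<And>s. 0 < snd s \<Longrightarrow> h s = g s" and g: "\<And>s. 0 < snd s \<Longrightarrow> \<bar>g s\<bar> \<le> C * wt s"
  shows "integrable (GenL c x) h" "(LINT s|GenL c x. h s) = c * child_mean g x"
proof -
  have [measurable]: "clip \<in> density TL (\<lambda>s. ennreal (c * keep_prob x (snd s))) \<rightarrow>\<^sub>M type_space"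
    using clip_measurable by (simp add: measurable_cong_sets[OF sets_TL refl])
  have [measurable]: "(\<lambda>s. h (clip s)) \<in> borel_measurable TL"
    using measurable_compose[OF clip_measurable, of h borel] by measurable
  have ae0: "AE s in TL. 0 \<le> c * keep_prob x (snd s)"
    by (intro AE_TLI mult_nonneg_nonneg c less_imp_le[OF keep_prob_bounds(1)])
  have i: "integrable TL (\<lambda>s. c * (keep_prob x (snd s) * g s))"
    by (intro integrable_mult_right integrable_child_mean[OF _ g]) measurable
  have ae: "AE s in TL. (c * keep_prob x (snd s)) *\<^sub>R h (clip s) = c * (keep_prob x (snd s) * g s)"
    by (intro AE_TLI) (simp add: clip_eq gh mult.assoc)
  have i2: "integrable TL (\<lambda>s. (c * keep_prob x (snd s)) *\<^sub>R h (clip s))"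
    using i by (subst integrable_cong_AE[OF _ _ ae]) measurable
  show "integrable (GenL c x) h"
    unfolding GenL_def using i2 ae0
    by (subst integrable_distr_eq, measurable, subst integrable_density) auto
  have "(LINT s|GenL c x. h s) = (LINT s|density TL (\<lambda>s. ennreal (c * keep_prob x (snd s))). h (clip s))"
    unfolding GenL_def by (rule integral_distr) measurable
  also have "\<dots> = (LINT s|TL. (c * keep_prob x (snd s)) *\<^sub>R h (clip s))"
    by (rule integral_density) (measurable, rule ae0)
  also have "\<dots> = (LINT s|TL. c * (keep_prob x (snd s) * g s))"
    by (rule integral_cong_AE[OF _ _ ae]) measurable
  finally show "(LINT s|GenL c x. h s) = c * child_mean g x" by (simp add: child_mean_def)
qed

lemma finite_GenL: assumes "0 \<le> c" shows "finite_measure (GenL c x)"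
proof -
  interpret T: prob_space TL by (rule prob_TL)
  have [measurable]: "clip \<in> density TL (\<lambda>s. ennreal (c * keep_prob x (snd s))) \<rightarrow>\<^sub>M type_space"
    using clip_measurable by (simp add: measurable_cong_sets[OF sets_TL refl])
  have "emeasure (density TL (\<lambda>s. ennreal (c * keep_prob x (snd s)))) UNIV = (\<integral>\<^sup>+s. ennreal (c * keep_prob x (snd s)) \<partial>TL)"
    by (subst emeasure_density) auto
  also have "\<dots> \<le> (\<integral>\<^sup>+s. ennreal c \<partial>TL)"
    using mult_left_mono[OF keep_prob_bounds(2) assms] by (intro nn_integral_mono ennreal_leI) simp
  also have "\<dots> < \<infinity>" using T.emeasure_space_1 by simp
  finally have "finite_measure (density TL (\<lambda>s. ennreal (c * keep_prob x (snd s))))"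
    by (intro finite_measureI) simp
  then show ?thesis unfolding GenL_def by (rule finite_measure.finite_measure_distr) measurable
qed

lemma indicator_wt: "\<bar>indicator A s\<bar> \<le> 1 * wt s"
  using wt_ge_1[of s] wt_nonneg[of s] by (simp add: indicator_def)

lemma measure_GenL:
  assumes "0 \<le> c" and A: "A \<in> sets type_space"
  shows "measure (GenL c x) A = c * child_mean (indicator A) x"
proof -
  have [measurable]: "A \<in> sets borel" using A by (simp add: sets_type_space)
  have "measure (GenL c x) A = (LINT s|GenL c x. indicator A s)"
    using A sets.sets_into_space[OF A] by (simp add: Int_absorb2)
  also have "\<dots> = c * child_mean (indicator A) x"
    by (rule integral_GenL(2)[OF assms(1) _ _ _ indicator_wt]) (use A in auto)
  finally show ?thesis .
qed

section \<open>The covariance measure of the first generation\<close>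

definition rootin :: "ewt_type set \<Rightarrow> ewt_sample \<Rightarrow> real" where
  "rootin A \<omega> = indicator A (vtype \<omega> [])"

lemma L2_wt_rootin: assumes "A \<in> sets borel" shows "L2_wt (rootin A) 1"
proof -
  have "\<bar>indicator A s\<bar> \<le> 1 * (1 + real (fst s))" for s :: ewt_type by (simp add: indicator_def)
  from L2_wt_root[OF _ this] show ?thesis using assms unfolding rootin_def[abs_def] by simp
qed

lemma Em_rootin: "A \<in> sets borel \<Longrightarrow> Em (rootin A) = indicator A"
  unfolding rootin_def[abs_def] by (intro ext Em_root[of "indicator A"]) simp

lemma Z_rootin: "real (Z l A \<omega>) = gen_sum l (rootin A) \<omega>"
  unfolding rootin_def[abs_def] Z_eq_gen_sum by (simp add: indicator_def of_bool_def)

text \<open>Covariances of m i.i.d. indicator vectors: the factor m * (m - 1) of the off-diagonal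
  terms minus m^2 from the product of the means leaves -m.\<close>

lemma cov_rect_eq:
  assumes A: "A \<in> sets type_space" and B: "B \<in> sets type_space"
  shows "cov_rect P t A B = real (fst t) * child_mean (indicator (A \<inter> B)) (snd t)
    - real (fst t) * child_mean (indicator A) (snd t) * child_mean (indicator B) (snd t)"
proof -
  have AB: "A \<in> sets borel" "B \<in> sets borel" using A B by (simp_all add: sets_type_space)
  note sA = L2_wt_rootin[OF AB(1)] and sB = L2_wt_rootin[OF AB(2)]
  note tA = L2_wt_gen_step[OF sA] and tB = L2_wt_gen_step[OF sB]
  interpret prob_space "\<kappa> t" by (rule prob_space_ewt_given)
  have Z1: "real (Z 1 A \<omega>) = gen_step (rootin A) \<omega>" for A \<omega> unfolding Z_rootin by simp
  let ?a = "Em (gen_step (rootin A)) t" and ?b = "Em (gen_step (rootin B)) t"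
  have iA: "integrable (\<kappa> t) (gen_step (rootin A))" and iB: "integrable (\<kappa> t) (gen_step (rootin B))"
    and iAB: "integrable (\<kappa> t) (\<lambda>\<omega>. gen_step (rootin A) \<omega> * gen_step (rootin B) \<omega>)"
    by (rule L1_wt_integrable[OF L2_wt_L1_wt[OF tA]] L1_wt_integrable[OF L2_wt_L1_wt[OF tB]] L1_wt_integrable[OF L2_wt_mult[OF tA tB]])+
  have "cov_rect P t A B = (\<integral>\<omega>. (gen_step (rootin A) \<omega> - ?a) * (gen_step (rootin B) \<omega> - ?b) \<partial>\<kappa> t)"
    unfolding cov_rect_def covar_def Z1 Em_def ..
  also have "\<dots> = (\<integral>\<omega>. gen_step (rootin A) \<omega> * gen_step (rootin B) \<omega> - ?b * gen_step (rootin A) \<omega> - ?a * gen_step (rootin B) \<omega> + ?a * ?b \<partial>\<kappa> t)"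
    by (simp add: algebra_simps)
  also have "\<dots> = Em (\<lambda>\<omega>. gen_step (rootin A) \<omega> * gen_step (rootin B) \<omega>) t - ?b * ?a - ?a * ?b + ?a * ?b"
    using iA iB iAB prob_space by (simp add: Em_def)
  also have "\<dots> = Em (\<lambda>\<omega>. gen_step (rootin A) \<omega> * gen_step (rootin B) \<omega>) t - ?a * ?b" by simp
  also have "(\<lambda>\<omega>. rootin A \<omega> * rootin B \<omega>) = rootin (A \<inter> B)"
    by (auto simp: rootin_def indicator_inter_arith)
  then have "Em (\<lambda>\<omega>. gen_step (rootin A) \<omega> * gen_step (rootin B) \<omega>) t = real (fst t) * child_mean (indicator (A \<inter> B)) (snd t)
    + real (fst t) * (real (fst t) - 1) * (child_mean (indicator A) (snd t) * child_mean (indicator B) (snd t))"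
    unfolding Em_gen_step_mult[OF sA sB] using AB by (simp add: Em_rootin)
  finally show ?thesis
    unfolding Em_gen_step[OF sA] Em_gen_step[OF sB] Em_rootin[OF AB(1)] Em_rootin[OF AB(2)] by (simp add: algebra_simps)
qed

lemma mu_mu_type: "0 \<le> snd s \<Longrightarrow> mu P (fst s) (snd s) = mu_type s"
  by (simp add: mu_eq mu_type_def)

text \<open>The covariance is the law of a child paired with itself minus a product of laws, an
  explicit difference of two finite measures. Evaluated at the product of two copies of mu it is a
  variance.\<close>

lemma signed_rect_integral_mu:
  assumes t: "0 \<le> snd t"
  shows "signed_rect_integral type_space (cov_rect P t)
    (\<lambda>(s1, s2). mu P (fst s1) (snd s1) * mu P (fst s2) (snd s2)) = mu_var t"
proof -
  let ?m = "real (fst t)" and ?x = "snd t" and ?D = "GenL (real (fst t)) (snd t)" and ?E = "GenL 1 (snd t)"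
  let ?f = "\<lambda>(s1, s2). mu P (fst s1) (snd s1) * mu P (fst s2) (snd s2)"
  let ?mu = "\<lambda>s. mu P (fst s) (snd s)"
  interpret D: finite_measure ?D by (rule finite_GenL) simp
  interpret E: finite_measure ?E by (rule finite_GenL) simp
  interpret DE: pair_sigma_finite ?D ?E ..
  have mb: "mu_type \<in> borel_measurable type_space"
    using mu_type_measurable unfolding type_space_def by (rule measurable_restrict_space1)
  have [measurable]: "?mu \<in> borel_measurable type_space"
    using mb by (subst measurable_cong[of _ _ mu_type]) (auto simp: space_type_space mu_eq mu_type_def)
  \<comment> \<open>The diagonal measure accounts for a child counted in both sets. In the
    subtracted product the factor m sits in ?D only, so that m occurs once, as in
    \<open>cov_rect_eq\<close>.\<close>
  define \<Delta> where "\<Delta> = distr ?D (type_space \<Otimes>\<^sub>M type_space) (\<lambda>s. (s, s))"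
  have dm: "(\<lambda>s. (s, s)) \<in> ?D \<rightarrow>\<^sub>M type_space \<Otimes>\<^sub>M type_space" by measurable
  have fm: "?f \<in> borel_measurable (type_space \<Otimes>\<^sub>M type_space)" by measurable
  have mi: "integrable ?E ?mu" "(LINT s|?E. ?mu s) = 1 * child_mean mu_type ?x" and mi': "integrable ?D ?mu" "(LINT s|?D. ?mu s) = ?m * child_mean mu_type ?x"
    by (rule integral_GenL[OF _ _ mu_type_measurable _ mu_type_wt]; simp add: mu_mu_type)+
  have sq: "integrable ?D (\<lambda>s. ?mu s * ?mu s)" "(LINT s|?D. ?mu s * ?mu s) = ?m * child_mean (\<lambda>s. (mu_type s)\<^sup>2) ?x"
    by (rule integral_GenL[of _ _ "\<lambda>s. (mu_type s)\<^sup>2" "utmax\<^sup>2"]; simp add: mu_mu_type power2_eq_square mu_type_sq_wt[unfolded power2_eq_square])+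
  have iDE: "integrable (?D \<Otimes>\<^sub>M ?E) ?f"
  proof (rule DE.Fubini_integrable)
    show "integrable ?D (\<lambda>s. \<integral>s'. norm (?f (s, s')) \<partial>?E)"
      using mi' by (simp add: abs_mult)
    show "AE s in ?D. integrable ?E (\<lambda>s'. ?f (s, s'))" using mi by simp
  qed measurable
  have "signed_rect_integral type_space (cov_rect P t) ?f = (LINT p|\<Delta>. ?f p) - (LINT p|(?D \<Otimes>\<^sub>M ?E). ?f p)"
  proof (rule signed_rect_integral_eq)
    show "finite_measure \<Delta>" unfolding \<Delta>_def by (rule D.finite_measure_distr[OF dm])
    show "finite_measure (?D \<Otimes>\<^sub>M ?E)"
      by (intro finite_measure_pair_measure D.finite_measure_axioms E.finite_measure_axioms)
    show "sets \<Delta> = sets (type_space \<Otimes>\<^sub>M type_space)" by (simp add: \<Delta>_def)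
    show "sets (?D \<Otimes>\<^sub>M ?E) = sets (type_space \<Otimes>\<^sub>M type_space)" by (intro sets_pair_measure_cong) simp_all
    show "integrable \<Delta> ?f"
      unfolding \<Delta>_def by (subst integrable_distr_eq[OF dm fm]) (use sq in simp)
    show "integrable (?D \<Otimes>\<^sub>M ?E) ?f" by (rule iDE)
    show "0 \<le> ?f p" if "p \<in> space (type_space \<Otimes>\<^sub>M type_space)" for p
      using that by (auto simp: space_pair_measure space_type_space mu_eq intro!: mult_nonneg_nonneg less_imp_le[OF ut_pos])
    fix A B assume AB: "A \<in> sets type_space" "B \<in> sets type_space"
    have "measure \<Delta> (A \<times> B) = measure ?D (A \<inter> B)"
      unfolding \<Delta>_def using AB sets.sets_into_space[OF AB(1)] sets.sets_into_space[OF AB(2)]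
      by (subst measure_distr[OF dm]) (auto intro!: arg_cong[where f = "measure _"])
    also have "\<dots> = ?m * child_mean (indicator (A \<inter> B)) ?x" using AB by (intro measure_GenL) auto
    finally have 1: "measure \<Delta> (A \<times> B) = ?m * child_mean (indicator (A \<inter> B)) ?x" .
    have "emeasure (?D \<Otimes>\<^sub>M ?E) (A \<times> B) = emeasure ?D A * emeasure ?E B"
      using AB by (intro E.emeasure_pair_measure_Times) auto
    then have "measure (?D \<Otimes>\<^sub>M ?E) (A \<times> B) = measure ?D A * measure ?E B"
      by (simp add: measure_def enn2real_mult)
    also have "\<dots> = ?m * child_mean (indicator A) ?x * child_mean (indicator B) ?x" using AB by (simp add: measure_GenL)
    finally show "cov_rect P t A B = measure \<Delta> (A \<times> B) - measure (?D \<Otimes>\<^sub>M ?E) (A \<times> B)"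
      unfolding 1 cov_rect_eq[OF AB] by simp
  qed
  also have "(LINT p|\<Delta>. ?f p) = ?m * child_mean (\<lambda>s. (mu_type s)\<^sup>2) ?x"
    unfolding \<Delta>_def integral_distr[OF dm fm] using sq by simp
  also have "(LINT p|(?D \<Otimes>\<^sub>M ?E). ?f p) = (LINT s|?D. LINT s'|?E. ?f (s, s'))"
    by (rule DE.integral_fst'[OF iDE, symmetric])
  also have "\<dots> = ?m * child_mean mu_type ?x * child_mean mu_type ?x"
    using mi mi' by simp
  finally show ?thesis using t by (simp add: mu_var_def power2_eq_square right_diff_distrib)
qed

lemma U_eq:
  assumes "0 \<le> x"
  shows "U P m x = (mu_type (m, x))\<^sup>2 + (\<Sum>l. 1 / \<beta> ^ (2 * Suc l) * Em (gen_sum l rootV) (m, x))"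
proof -
  have "(LINT t|mean_measure P l (m, x). signed_rect_integral type_space (cov_rect P t)
      (\<lambda>(s1, s2). mu P (fst s1) (snd s1) * mu P (fst s2) (snd s2))) = Em (gen_sum l rootV) (m, x)" for l
  proof -
    have "(LINT t|mean_measure P l (m, x). signed_rect_integral type_space (cov_rect P t)
      (\<lambda>(s1, s2). mu P (fst s1) (snd s1) * mu P (fst s2) (snd s2))) = (LINT t|mean_measure P l (m, x). mu_var t)"
      by (intro Bochner_Integration.integral_cong refl signed_rect_integral_mu) (auto simp: space_type_space)
    then show ?thesis unfolding integral_mean_measure_mu_var .
  qed
  then show ?thesis
    unfolding U_def using mu_mu_type[of "(m, x)"] assms by simp
qed

end

section \<open>Convergence\<close>

context ewt_params begin

definition nsum :: "(ewt_sample \<Rightarrow> real) \<Rightarrow> nat \<Rightarrow> ewt_sample \<Rightarrow> real" where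
  "nsum g l \<omega> = gen_sum l g \<omega> / \<beta> ^ l"

lemma nsum_square_integrable:
  assumes "L2_wt g C"
  shows "nsum g l \<in> borel_measurable (\<kappa> t)" "integrable (\<kappa> t) (\<lambda>\<omega>. (nsum g l \<omega>)\<^sup>2)"
    "(\<integral>\<omega>. nsum g l \<omega> \<partial>\<kappa> t) = Em (gen_sum l g) t / \<beta> ^ l"
    "(\<integral>\<omega>. (nsum g l \<omega>)\<^sup>2 \<partial>\<kappa> t) = Em (\<lambda>\<omega>. (gen_sum l g \<omega>)\<^sup>2) t / (\<beta>\<^sup>2) ^ l"
proof -
  obtain D where D: "L2_wt (gen_sum l g) D" using L2_wt_gen_sum[OF assms] by blast
  note [measurable] = L2_wt_measurable[OF D]
  have e: "(nsum g l \<omega>)\<^sup>2 = (gen_sum l g \<omega>)\<^sup>2 / (\<beta>\<^sup>2) ^ l" for \<omega>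
    unfolding nsum_def power_divide by (simp only: power_mult[symmetric] mult.commute)
  show "nsum g l \<in> borel_measurable (\<kappa> t)" unfolding nsum_def[abs_def] by measurable
  show "integrable (\<kappa> t) (\<lambda>\<omega>. (nsum g l \<omega>)\<^sup>2)"
    unfolding e by (intro integrable_divide L1_wt_integrable[OF L2_wt_sq[OF D]])
  show "(\<integral>\<omega>. nsum g l \<omega> \<partial>\<kappa> t) = Em (gen_sum l g) t / \<beta> ^ l"
    unfolding nsum_def Em_def by (rule integral_divide_zero)
  show "(\<integral>\<omega>. (nsum g l \<omega>)\<^sup>2 \<partial>\<kappa> t) = Em (\<lambda>\<omega>. (gen_sum l g \<omega>)\<^sup>2) t / (\<beta>\<^sup>2) ^ l"
    unfolding e Em_def by (rule integral_divide_zero)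
qed

text \<open>The square root brings the decay into the form K * q^(2 l) used by the geometric
  convergence lemmas.\<close>

lemma nsum_L2_decay:
  assumes g: "L2_wt g C" and P0: "left_ev (Em g) = 0" and b1: "1 < \<beta>"
  shows "\<exists>K. \<forall>l. (\<integral>\<omega>. (nsum g l \<omega>)\<^sup>2 \<partial>\<kappa> t) \<le> K * sqrt rate ^ (2 * l)"
proof -
  obtain K where K: "\<And>l. Em (\<lambda>\<omega>. (gen_sum l g \<omega>)\<^sup>2) t \<le> K * (rate * \<beta>\<^sup>2) ^ l"
    using Em_sq_gen_sum_bound[OF g P0 b1] by blast
  have "(\<integral>\<omega>. (nsum g l \<omega>)\<^sup>2 \<partial>\<kappa> t) \<le> K * sqrt rate ^ (2 * l)" for l
  proof -
    have b: "0 < (\<beta>\<^sup>2) ^ l" using beta_pos by simp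
    have r: "sqrt rate ^ (2 * l) = rate ^ l"
      using rate_bounds(1)[OF b1] by (simp add: power_mult)
    have "Em (\<lambda>\<omega>. (gen_sum l g \<omega>)\<^sup>2) t \<le> K * rate ^ l * (\<beta>\<^sup>2) ^ l"
      using K[of l] by (simp only: power_mult_distrib mult.assoc)
    then show ?thesis
      unfolding nsum_square_integrable(4)[OF g] r using b by (simp only: pos_divide_le_eq)
  qed
  then show ?thesis by (intro exI[of _ K] allI)
qed

lemma sqrt_rate: assumes "1 < \<beta>" shows "0 < sqrt rate" "sqrt rate < 1"
  using rate_bounds[OF assms] by simp_all

text \<open>Iterates of \<open>gen_step\<close> commute, so generation l + 1 can be seen as a sum
  over generation l of one further step. An increment is thus a generation sum of a single
  functional.\<close>

lemma nsum_rootmu_increment: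
  "nsum rootmu (Suc l) \<omega> - nsum rootmu l \<omega> = nsum (\<lambda>\<omega>. 1 / \<beta> * gen_step rootmu \<omega> - rootmu \<omega>) l \<omega>"
proof -
  have "gen_sum l (gen_step rootmu) = gen_sum (Suc l) rootmu" by (simp only: funpow_Suc_right comp_def)
  then show ?thesis
    unfolding nsum_def gen_sum_diff gen_sum_cmult using beta_pos by (simp add: field_simps)
qed

lemma martingale_limit:
  assumes b1: "1 < \<beta>"
  obtains W where "W \<in> borel_measurable (\<kappa> t)" "integrable (\<kappa> t) (\<lambda>\<omega>. (W \<omega>)\<^sup>2)"
    "AE \<omega> in \<kappa> t. (\<lambda>l. nsum rootmu l \<omega>) \<longlonglongrightarrow> W \<omega>"
    "(\<lambda>l. \<integral>\<omega>. (nsum rootmu l \<omega> - W \<omega>)\<^sup>2 \<partial>\<kappa> t) \<longlonglongrightarrow> 0"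
proof -
  let ?g = "\<lambda>\<omega>. 1 / \<beta> * gen_step rootmu \<omega> - rootmu \<omega>"
  note s1 = L2_wt_cmult[OF L2_wt_gen_step[OF L2_wt_rootmu], of "1 / \<beta>"]
  note g = L2_wt_diff[OF s1 L2_wt_rootmu]
  \<comment> \<open>The martingale property: mu is an eigenfunction with eigenvalue beta. The
    condition on \<open>left_ev\<close> is then immediate.\<close>
  have "Em ?g s = 0" for s
  proof -
    have "Em ?g s = Em (\<lambda>\<omega>. 1 / \<beta> * gen_step rootmu \<omega>) s - Em rootmu s"
      unfolding Em_def
      by (intro Bochner_Integration.integral_diff L1_wt_integrable[OF L2_wt_L1_wt[OF s1]] L1_wt_integrable[OF L2_wt_L1_wt[OF L2_wt_rootmu]])
    also have "Em (\<lambda>\<omega>. 1 / \<beta> * gen_step rootmu \<omega>) s = 1 / \<beta> * Em (gen_step rootmu) s"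
      unfolding Em_def by (rule integral_mult_right_zero)
    finally show ?thesis
      unfolding Em_gen_step_mean_op[OF L2_wt_rootmu] Em_rootmu mean_op_mu_type using beta_pos by simp
  qed
  then have P0: "left_ev (Em ?g) = 0" by (simp add: left_ev_def)
  obtain K where "\<And>l. (\<integral>\<omega>. (nsum ?g l \<omega>)\<^sup>2 \<partial>\<kappa> t) \<le> K * sqrt rate ^ (2 * l)"
    using nsum_L2_decay[OF g P0 b1] by blast
  then have K: "(\<integral>\<omega>. (nsum rootmu (Suc l) \<omega> - nsum rootmu l \<omega>)\<^sup>2 \<partial>\<kappa> t) \<le> K * sqrt rate ^ (2 * l)" for l
    unfolding nsum_rootmu_increment .
  show thesis
    by (rule L2_geometric_limit[OF prob_space_ewt_given[of P t] nsum_square_integrable(1,2)[OF L2_wt_rootmu] K sqrt_rate[OF b1]])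
      (rule that)
qed

text \<open>\<open>indicator A - nubar P A * mu_type\<close> lies in the kernel of \<open>left_ev\<close>.\<close>

lemma counts_minus_martingale:
  assumes b1: "1 < \<beta>" and A: "A \<in> sets type_space"
  shows "AE \<omega> in \<kappa> t. (\<lambda>l. nsum (rootin A) l \<omega> - nubar P A * nsum rootmu l \<omega>) \<longlonglongrightarrow> 0"
    "(\<lambda>l. \<integral>\<omega>. (nsum (rootin A) l \<omega> - nubar P A * nsum rootmu l \<omega>)\<^sup>2 \<partial>\<kappa> t) \<longlonglongrightarrow> 0"
    "integrable (\<kappa> t) (\<lambda>\<omega>. (nsum (rootin A) l \<omega> - nubar P A * nsum rootmu l \<omega>)\<^sup>2)"
proof -
  let ?c = "nubar P A"
  let ?g = "\<lambda>\<omega>. rootin A \<omega> - ?c * rootmu \<omega>"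
  have A' [measurable]: "A \<in> sets borel" using A by (simp add: sets_type_space)
  note s1 = L2_wt_rootin[OF A'] and s2 = L2_wt_cmult[OF L2_wt_rootmu, of ?c]
  note g = L2_wt_diff[OF s1 s2]
  have Eg: "Em ?g s = indicator A s - ?c * mu_type s" for s
  proof -
    have "Em ?g s = Em (rootin A) s - Em (\<lambda>\<omega>. ?c * rootmu \<omega>) s"
      unfolding Em_def
      by (intro Bochner_Integration.integral_diff L1_wt_integrable[OF L2_wt_L1_wt[OF s1]] L1_wt_integrable[OF L2_wt_L1_wt[OF s2]])
    also have "Em (\<lambda>\<omega>. ?c * rootmu \<omega>) s = ?c * Em rootmu s"
      unfolding Em_def by (rule integral_mult_right_zero)
    finally show ?thesis unfolding Em_rootin[OF A'] Em_rootmu .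
  qed
  have P0: "left_ev (Em ?g) = 0"
  proof -
    have i1: "integrable TL (\<lambda>s. (snd s * ut (snd s)) * indicator A s)"
      by (rule integrable_left_ev[OF _ indicator_wt]) measurable
    have i2: "integrable TL (\<lambda>s. ?c * ((snd s * ut (snd s)) * mu_type s))"
      by (intro integrable_mult_right integrable_left_ev[OF _ mu_type_wt]) measurable
    have "left_ev (Em ?g) = (\<integral>s. (snd s * ut (snd s)) * indicator A s - ?c * ((snd s * ut (snd s)) * mu_type s) \<partial>TL)"
      unfolding left_ev_def Eg by (simp add: algebra_simps)
    also have "\<dots> = left_ev (indicator A) - ?c * left_ev mu_type"
      unfolding Bochner_Integration.integral_diff[OF i1 i2] by (simp add: left_ev_def)
    finally show ?thesis by (simp add: left_ev_nubar[OF A] left_ev_mu_type)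
  qed
  have e: "nsum ?g l \<omega> = nsum (rootin A) l \<omega> - ?c * nsum rootmu l \<omega>" for l \<omega>
    unfolding nsum_def gen_sum_diff gen_sum_cmult by (simp add: diff_divide_distrib)
  obtain K where K: "\<And>l. (\<integral>\<omega>. (nsum ?g l \<omega>)\<^sup>2 \<partial>\<kappa> t) \<le> K * sqrt rate ^ (2 * l)"
    using nsum_L2_decay[OF g P0 b1] by blast
  note n = L2_geometric_null[OF prob_space_ewt_given[of P t] nsum_square_integrable(1,2)[OF g] K sqrt_rate[OF b1]]
  show "AE \<omega> in \<kappa> t. (\<lambda>l. nsum (rootin A) l \<omega> - ?c * nsum rootmu l \<omega>) \<longlonglongrightarrow> 0"
    using n(1) unfolding e .
  show "(\<lambda>l. \<integral>\<omega>. (nsum (rootin A) l \<omega> - ?c * nsum rootmu l \<omega>)\<^sup>2 \<partial>\<kappa> t) \<longlonglongrightarrow> 0"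
    using n(2) unfolding e .
  show "integrable (\<kappa> t) (\<lambda>\<omega>. (nsum (rootin A) l \<omega> - ?c * nsum rootmu l \<omega>)\<^sup>2)"
    using nsum_square_integrable(2)[OF g, of t l] unfolding e .
qed

lemma counts_converge:
  assumes b1: "1 < \<beta>" and x: "0 \<le> x"
  shows "\<exists>W :: ewt_type set \<Rightarrow> ewt_sample \<Rightarrow> real.
    (\<forall>A\<in>sets type_space.
       tendsto_L2 (\<kappa> (m, x)) (\<lambda>l \<omega>. real (Z l A \<omega>) / \<beta> ^ l) (W A) \<and>
       (AE \<omega> in \<kappa> (m, x). (\<lambda>l. real (Z l A \<omega>) / \<beta> ^ l) \<longlonglongrightarrow> W A \<omega>) \<and>
       (LINT \<omega>|\<kappa> (m, x). W A \<omega>) = mu P m x * nubar P A \<and>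
       (LINT \<omega>|\<kappa> (m, x). (W A \<omega>)\<^sup>2) = U P m x * (nubar P A)\<^sup>2) \<and>
    (\<forall>A\<in>sets type_space. \<forall>B\<in>sets type_space. nubar P A > 0 \<longrightarrow>
       (AE \<omega> in \<kappa> (m, x). W B \<omega> = nubar P B / nubar P A * W A \<omega>))"
proof -
  let ?t = "(m, x)"
  obtain W where W: "W \<in> borel_measurable (\<kappa> ?t)" "integrable (\<kappa> ?t) (\<lambda>\<omega>. (W \<omega>)\<^sup>2)"
    "AE \<omega> in \<kappa> ?t. (\<lambda>l. nsum rootmu l \<omega>) \<longlonglongrightarrow> W \<omega>"
    "(\<lambda>l. \<integral>\<omega>. (nsum rootmu l \<omega> - W \<omega>)\<^sup>2 \<partial>\<kappa> ?t) \<longlonglongrightarrow> 0"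
    using martingale_limit[OF b1] .
  note N = nsum_square_integrable[OF L2_wt_rootmu, where t = ?t]
  note lim = L2_limit_moments[OF prob_space_ewt_given[of P ?t] N(1) W(1) N(2) W(2) W(4)]
  have m1: "(\<integral>\<omega>. W \<omega> \<partial>\<kappa> ?t) = mu_type ?t"
  proof (rule LIMSEQ_unique[OF lim(1)])
    have "(\<integral>\<omega>. nsum rootmu l \<omega> \<partial>\<kappa> ?t) = mu_type ?t" for l
      unfolding N(3) Em_gen_sum_rootmu using beta_pos by simp
    then show "(\<lambda>l. \<integral>\<omega>. nsum rootmu l \<omega> \<partial>\<kappa> ?t) \<longlonglongrightarrow> mu_type ?t" by simp
  qed
  have m2: "(\<integral>\<omega>. (W \<omega>)\<^sup>2 \<partial>\<kappa> ?t) = U P m x"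
  proof -
    let ?c = "\<lambda>j. 1 / \<beta> ^ (2 * Suc j) * Em (gen_sum j rootV) ?t"
    have e: "(\<integral>\<omega>. (nsum rootmu l \<omega>)\<^sup>2 \<partial>\<kappa> ?t) = (mu_type ?t)\<^sup>2 + (\<Sum>j<l. ?c j)" for l
    proof -
      have b: "\<beta> ^ (2 * l) \<noteq> 0" using beta_pos by simp
      have "\<beta> ^ (2 * (l - Suc j)) / \<beta> ^ (2 * l) = 1 / \<beta> ^ (2 * Suc j)" if "j < l" for j
      proof -
        have "2 * l = 2 * (l - Suc j) + 2 * Suc j" using that by simp
        then have "\<beta> ^ (2 * l) = \<beta> ^ (2 * (l - Suc j)) * \<beta> ^ (2 * Suc j)" by (metis power_add)
        then show ?thesis using beta_pos by simp
      qed
      then have s: "(\<Sum>j<l. \<beta> ^ (2 * (l - Suc j)) * Em (gen_sum j rootV) ?t) / \<beta> ^ (2 * l) = (\<Sum>j<l. ?c j)"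
        unfolding sum_divide_distrib by (intro sum.cong refl) (metis lessThan_iff times_divide_eq_left)
      have "(\<integral>\<omega>. (nsum rootmu l \<omega>)\<^sup>2 \<partial>\<kappa> ?t)
        = (\<beta> ^ (2 * l) * (mu_type ?t)\<^sup>2 + (\<Sum>j<l. \<beta> ^ (2 * (l - Suc j)) * Em (gen_sum j rootV) ?t)) / \<beta> ^ (2 * l)"
        unfolding N(4) power_mult[symmetric] using Em_sq_gen_sum_rootmu[of ?t l] x by simp
      then show ?thesis unfolding add_divide_distrib s using b beta_pos by simp
    qed
    \<comment> \<open>The \<open>suminf\<close> in \<open>U\<close> is meaningful only if the series
      converges; convergence of the second moments to that of W supplies this together with the
      value.\<close>
    have "(\<lambda>l. ((mu_type ?t)\<^sup>2 + (\<Sum>j<l. ?c j)) - (mu_type ?t)\<^sup>2) \<longlonglongrightarrow> (\<integral>\<omega>. (W \<omega>)\<^sup>2 \<partial>\<kappa> ?t) - (mu_type ?t)\<^sup>2"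
      using lim(2) unfolding e by (intro tendsto_diff tendsto_const)
    then have "?c sums ((\<integral>\<omega>. (W \<omega>)\<^sup>2 \<partial>\<kappa> ?t) - (mu_type ?t)\<^sup>2)" by (simp add: sums_def)
    from sums_unique[OF this] show ?thesis unfolding U_eq[OF x] by simp
  qed
  \<comment> \<open>All limits are multiples of one random variable, so the proportionality between
    W(B) and W(A) holds at every sample point.\<close>
  define WA where "WA A \<omega> = nubar P A * W \<omega>" for A \<omega>
  have Z: "real (Z l A \<omega>) / \<beta> ^ l = nsum (rootin A) l \<omega>" for l A \<omega>
    unfolding Z_rootin nsum_def ..
  have sq2: "(a + b)\<^sup>2 \<le> 2 * a\<^sup>2 + 2 * b\<^sup>2" for a b :: real
    using zero_le_power2[of "a - b"] by (simp add: power2_eq_square algebra_simps)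
  have main: "tendsto_L2 (\<kappa> ?t) (\<lambda>l \<omega>. real (Z l A \<omega>) / \<beta> ^ l) (WA A) \<and>
       (AE \<omega> in \<kappa> ?t. (\<lambda>l. real (Z l A \<omega>) / \<beta> ^ l) \<longlonglongrightarrow> WA A \<omega>) \<and>
       (LINT \<omega>|\<kappa> ?t. WA A \<omega>) = mu P m x * nubar P A \<and>
       (LINT \<omega>|\<kappa> ?t. (WA A \<omega>)\<^sup>2) = U P m x * (nubar P A)\<^sup>2" if A: "A \<in> sets type_space" for A
  proof (intro conjI)
    have A': "A \<in> sets borel" using A by (simp add: sets_type_space)
    let ?c = "nubar P A"
    let ?X = "\<lambda>l \<omega>. nsum (rootin A) l \<omega> - ?c * nsum rootmu l \<omega>"
    note D = counts_minus_martingale[OF b1 A, where t = ?t]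
    note NA = nsum_square_integrable[OF L2_wt_rootin[OF A'], where t = ?t]
    note [measurable] = W(1) N(1) NA(1)
    show "AE \<omega> in \<kappa> ?t. (\<lambda>l. real (Z l A \<omega>) / \<beta> ^ l) \<longlonglongrightarrow> WA A \<omega>"
      using D(1) W(3)
    proof eventually_elim
      case (elim \<omega>)
      have "(\<lambda>l. ?X l \<omega> + ?c * nsum rootmu l \<omega>) \<longlonglongrightarrow> 0 + ?c * W \<omega>"
        by (intro tendsto_add tendsto_mult tendsto_const elim)
      then show ?case unfolding Z WA_def by simp
    qed
    show "(LINT \<omega>|\<kappa> ?t. WA A \<omega>) = mu P m x * ?c"
      unfolding WA_def using m1 mu_mu_type[of ?t] x by simp
    show "(LINT \<omega>|\<kappa> ?t. (WA A \<omega>)\<^sup>2) = U P m x * ?c\<^sup>2"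
      unfolding WA_def power_mult_distrib using m2 by simp
    have iD: "integrable (\<kappa> ?t) (\<lambda>\<omega>. (nsum rootmu l \<omega> - W \<omega>)\<^sup>2)" for l
    proof (rule Bochner_Integration.integrable_bound)
      show "integrable (\<kappa> ?t) (\<lambda>\<omega>. 2 * (nsum rootmu l \<omega>)\<^sup>2 + 2 * (W \<omega>)\<^sup>2)" using N(2) W(2) by simp
      show "AE \<omega> in \<kappa> ?t. norm ((nsum rootmu l \<omega> - W \<omega>)\<^sup>2) \<le> norm (2 * (nsum rootmu l \<omega>)\<^sup>2 + 2 * (W \<omega>)\<^sup>2)"
      proof (rule AE_I2)
        fix \<omega>
        show "norm ((nsum rootmu l \<omega> - W \<omega>)\<^sup>2) \<le> norm (2 * (nsum rootmu l \<omega>)\<^sup>2 + 2 * (W \<omega>)\<^sup>2)"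
          using sq2[of "nsum rootmu l \<omega>" "- W \<omega>"] by simp
      qed
    qed measurable
    \<comment> \<open>The deviation is split into the distance of the counts from the martingale and
      that of the martingale from its limit; both vanish in mean square.\<close>
    let ?B = "\<lambda>l \<omega>. 2 * (?X l \<omega>)\<^sup>2 + (2 * ?c\<^sup>2) * (nsum rootmu l \<omega> - W \<omega>)\<^sup>2"
    have le: "(nsum (rootin A) l \<omega> - WA A \<omega>)\<^sup>2 \<le> ?B l \<omega>" for l \<omega>
    proof -
      have e: "nsum (rootin A) l \<omega> - WA A \<omega> = ?X l \<omega> + ?c * (nsum rootmu l \<omega> - W \<omega>)"
        by (simp add: WA_def algebra_simps)
      show ?thesis
        unfolding e using sq2[of "?X l \<omega>" "?c * (nsum rootmu l \<omega> - W \<omega>)"]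
        by (simp only: power_mult_distrib mult.assoc)
    qed
    have iB: "integrable (\<kappa> ?t) (?B l)" for l
      by (intro Bochner_Integration.integrable_add integrable_mult_right D(3) iD)
    have iE: "integrable (\<kappa> ?t) (\<lambda>\<omega>. (nsum (rootin A) l \<omega> - WA A \<omega>)\<^sup>2)" for l
    proof (rule Bochner_Integration.integrable_bound[OF iB[of l]])
      show "(\<lambda>\<omega>. (nsum (rootin A) l \<omega> - WA A \<omega>)\<^sup>2) \<in> borel_measurable (\<kappa> ?t)"
        unfolding WA_def by measurable
      show "AE \<omega> in \<kappa> ?t. norm ((nsum (rootin A) l \<omega> - WA A \<omega>)\<^sup>2) \<le> norm (?B l \<omega>)"
        by (rule AE_I2) (use le in \<open>auto intro: order_trans[OF le]\<close>)
    qed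
    have "(\<lambda>l. \<integral>\<omega>. (nsum (rootin A) l \<omega> - WA A \<omega>)\<^sup>2 \<partial>\<kappa> ?t) \<longlonglongrightarrow> 0"
    proof (rule tendsto_sandwich[OF _ _ tendsto_const])
      have "(\<lambda>l. 2 * (\<integral>\<omega>. (?X l \<omega>)\<^sup>2 \<partial>\<kappa> ?t) + (2 * ?c\<^sup>2) * (\<integral>\<omega>. (nsum rootmu l \<omega> - W \<omega>)\<^sup>2 \<partial>\<kappa> ?t))
        \<longlonglongrightarrow> 2 * 0 + (2 * ?c\<^sup>2) * 0"
        by (intro tendsto_add tendsto_mult tendsto_const D(2) W(4))
      moreover have "(\<integral>\<omega>. ?B l \<omega> \<partial>\<kappa> ?t) = 2 * (\<integral>\<omega>. (?X l \<omega>)\<^sup>2 \<partial>\<kappa> ?t) + (2 * ?c\<^sup>2) * (\<integral>\<omega>. (nsum rootmu l \<omega> - W \<omega>)\<^sup>2 \<partial>\<kappa> ?t)" for l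
        by (subst Bochner_Integration.integral_add) (auto intro!: integrable_mult_right D(3) iD simp del: integrable_mult_right_iff)
      ultimately show "(\<lambda>l. \<integral>\<omega>. ?B l \<omega> \<partial>\<kappa> ?t) \<longlonglongrightarrow> 0" by simp
      show "\<forall>\<^sub>F l in sequentially. 0 \<le> (\<integral>\<omega>. (nsum (rootin A) l \<omega> - WA A \<omega>)\<^sup>2 \<partial>\<kappa> ?t)"
        by (intro always_eventually allI integral_nonneg_AE AE_I2) simp
      show "\<forall>\<^sub>F l in sequentially. (\<integral>\<omega>. (nsum (rootin A) l \<omega> - WA A \<omega>)\<^sup>2 \<partial>\<kappa> ?t) \<le> (\<integral>\<omega>. ?B l \<omega> \<partial>\<kappa> ?t)"
        by (intro always_eventually allI integral_mono iE iB le)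
    qed
    moreover have "WA A \<in> borel_measurable (\<kappa> ?t)" unfolding WA_def by measurable
    moreover have "integrable (\<kappa> ?t) (\<lambda>\<omega>. (WA A \<omega>)\<^sup>2)"
      unfolding WA_def power_mult_distrib by (intro integrable_mult_right W(2))
    ultimately show "tendsto_L2 (\<kappa> ?t) (\<lambda>l \<omega>. real (Z l A \<omega>) / \<beta> ^ l) (WA A)"
      unfolding tendsto_L2_def Z using NA(1,2) by blast
  qed
  have "AE \<omega> in \<kappa> ?t. WA B \<omega> = nubar P B / nubar P A * WA A \<omega>" if "nubar P A > 0" for A B
    using that by (simp add: WA_def)
  with main show ?thesis by (intro exI[of _ WA] conjI ballI impI) blast+
qed

end

theorem theorem5p21:
  fixes P :: "nat pmf" and m :: nat and x :: real
  assumes "pmf P 0 = 0" and "pmf P 1 < 1"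
    and "\<exists>\<theta>>0. integrable (measure_pmf P) (\<lambda>n. exp (\<theta> * real n))"
    and "beta0 P > 1"
    and "m \<ge> 1" and "x \<ge> 0"
  shows "\<exists>W :: ewt_type set \<Rightarrow> ewt_sample \<Rightarrow> real.
    (\<forall>A\<in>sets type_space.
       tendsto_L2 (ewt_given P (m, x)) (\<lambda>l \<omega>. real (Z l A \<omega>) / beta0 P ^ l) (W A) \<and>
       (AE \<omega> in ewt_given P (m, x). (\<lambda>l. real (Z l A \<omega>) / beta0 P ^ l) \<longlonglongrightarrow> W A \<omega>) \<and>
       (LINT \<omega>|ewt_given P (m, x). W A \<omega>) = mu P m x * nubar P A \<and>
       (LINT \<omega>|ewt_given P (m, x). (W A \<omega>)\<^sup>2) = U P m x * (nubar P A)\<^sup>2) \<and>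
    (\<forall>A\<in>sets type_space. \<forall>B\<in>sets type_space. nubar P A > 0 \<longrightarrow>
       (AE \<omega> in ewt_given P (m, x). W B \<omega> = nubar P B / nubar P A * W A \<omega>))"
proof -
  interpret ewt_params P
    using assms(1-3) by unfold_locales
  show ?thesis by (rule counts_converge[OF assms(4,6)])
qed

end
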